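(* Let $\Omega=\mathbb{T}\times[0,\pi]$. Let $\rho_0\in C^\infty(\Omega)$ be even in $x_1$, and let $\omega_0\in C^\infty(\Omega)$ be odd in $x_1$. Assume that there exists $k_0>0$ such that $\rho_0\ge k_0>0$ on $\{0\}\times[0,\pi]$, and $\rho_0\le 0$ on $\{\pi\}\times[0,\pi]$. Consider the corresponding solution $(\rho,\omega)$ of the inviscid Boussinesq system in vorticity form $$\rho_t+u\cdot\nabla\rho=0,\qquad \omega_t+u\cdot\nabla\omega=-\partial_1\rho,\qquad u=\nabla^\perp(-\Delta)^{-1}\omega$$ on $\Omega$ (with no-flow boundary condition $u\cdot n|_{\partial\Omega}=0$) with initial data $(\rho_0,\omega_0)$, and let $T$ be the lifespan of the smooth solution $(\rho,\omega)$. Then there exist some constants $T_0(\rho_0,\omega_0)\ge 0$ and $c=c(\rho_0,\omega_0)>0$ such that $$\|\omega(t)\|_{L^p(\Omega)}\ge c\,t^{3-\frac2p}\quad\text{for all }p\in[1,\infty],\ t\in[T_0,T),$$ $$\|u(t)\|_{L^\infty(\Omega)}\ge c\,t\quad\text{for all }t\in[T_0,T),$$ and $$\sup_{\tau\in[0,t]}\|\nabla\rho(\tau)\|_{L^\infty(\Omega)}>c\,t^2\quad\text{for all }t\in[0,T).$$ In particular, if $\int_{[0,\pi]\times[0,\pi]}\omega_0\,dx\ge 0$, then $T_0=0$ in all the estimates above.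
   Context: $\mathbb{T}=(-\pi,\pi]$ with periodic identification, so $\Omega=\mathbb{T}\times[0,\pi]$ is a strip that is $2\pi$-periodic in $x_1$; $n$ is the unit normal to $\partial\Omega$. The vorticity is $\omega=\partial_1u_2-\partial_2u_1$; the velocity $u=(u_1,u_2)$ is divergence free and recovered from $\omega$ by the Biot–Savart law $u=\nabla^\perp(-\Delta)^{-1}\omega$, with $\nabla^\perp=(\partial_2,-\partial_1)$ and $(-\Delta)^{-1}$ the inverse of the Laplacian with zero Dirichlet boundary condition on $\partial\Omega$ (so $u\cdot n=0$ on $\partial\Omega$). The system is equivalent to $\rho_t+u\cdot\nabla\rho=0$, $u_t+u\cdot\nabla u=-\nabla p-\rho e_2$, $\nabla\cdot u=0$, with $e_2=(0,1)^T$. Smooth solutions exist locally in time; $T\in(0,\infty]$ is the maximal time of existence of the smooth solution. For $p=\infty$, $\frac{2}{p}$ is read as $0$. The constants $T_0$ and $c$ depend only on the initial data (not on $p$ or $t$). *)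

theory Defs
  imports "HOL-Probability.Essential_Supremum"
begin

text \<open>
  Functions on \<open>\<Omega> = \<T> \<times> [0,\<pi>]\<close> are functions on the plane that are \<open>2\<pi>\<close>-periodic in the first
  coordinate on the closed strip; their values off the strip are never used.
\<close>

definition strip :: "(real \<times> real) set" where
  "strip = UNIV \<times> {0..pi}"

definition period_cell :: "(real \<times> real) set" where
  "period_cell = {-pi<..pi} \<times> {0..pi}"

definition x1_periodic :: "(real \<times> real \<Rightarrow> 'b) \<Rightarrow> bool" where
  "x1_periodic f \<longleftrightarrow> (\<forall>(x1, x2)\<in>strip. f (x1 + 2 * pi, x2) = f (x1, x2))"

definition x1_even :: "(real \<times> real \<Rightarrow> real) \<Rightarrow> bool" where
  "x1_even f \<longleftrightarrow> (\<forall>(x1, x2)\<in>strip. f (- x1, x2) = f (x1, x2))"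

definition x1_odd :: "(real \<times> real \<Rightarrow> real) \<Rightarrow> bool" where
  "x1_odd f \<longleftrightarrow> (\<forall>(x1, x2)\<in>strip. f (- x1, x2) = - f (x1, x2))"

text \<open>
  Smoothness up to the boundary: derivatives are taken within \<open>S\<close>, hence one-sided at boundary
  points. They are unique on the sets used below, which are convex with nonempty interior.
\<close>

primrec Ck_on :: "nat \<Rightarrow> 'a::euclidean_space set \<Rightarrow> ('a \<Rightarrow> 'b::real_normed_vector) \<Rightarrow> bool" where
  "Ck_on 0 S f \<longleftrightarrow> continuous_on S f"
| "Ck_on (Suc k) S f \<longleftrightarrow> f differentiable_on S \<and>
     (\<forall>b\<in>Basis. Ck_on k S (\<lambda>x. frechet_derivative f (at x within S) b))"

definition smooth_on :: "'a::euclidean_space set \<Rightarrow> ('a \<Rightarrow> 'b::real_normed_vector) \<Rightarrow> bool" where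
  "smooth_on S f \<longleftrightarrow> (\<forall>k. Ck_on k S f)"

definition smooth_Omega :: "(real \<times> real \<Rightarrow> 'b::real_normed_vector) \<Rightarrow> bool" where
  "smooth_Omega f \<longleftrightarrow> smooth_on strip f \<and> x1_periodic f"

definition partial1 :: "(real \<times> real \<Rightarrow> real) \<Rightarrow> real \<times> real \<Rightarrow> real" where
  "partial1 f x = frechet_derivative f (at x within strip) (1, 0)"

definition partial2 :: "(real \<times> real \<Rightarrow> real) \<Rightarrow> real \<times> real \<Rightarrow> real" where
  "partial2 f x = frechet_derivative f (at x within strip) (0, 1)"

definition grad :: "(real \<times> real \<Rightarrow> real) \<Rightarrow> real \<times> real \<Rightarrow> real \<times> real" where
  "grad f x = (partial1 f x, partial2 f x)"

definition grad_perp :: "(real \<times> real \<Rightarrow> real) \<Rightarrow> real \<times> real \<Rightarrow> real \<times> real" where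
  "grad_perp f x = (partial2 f x, - partial1 f x)"

definition laplacian :: "(real \<times> real \<Rightarrow> real) \<Rightarrow> real \<times> real \<Rightarrow> real" where
  "laplacian f x = partial1 (partial1 f) x + partial2 (partial2 f) x"

text \<open>The graph of \<open>(-\<Delta>)\<^sup>-\<^sup>1\<close>: \<open>\<psi>\<close> is the Dirichlet solution with right-hand side \<open>w\<close>.\<close>

definition inv_neg_laplacian :: "(real \<times> real \<Rightarrow> real) \<Rightarrow> (real \<times> real \<Rightarrow> real) \<Rightarrow> bool" where
  "inv_neg_laplacian w \<psi> \<longleftrightarrow> smooth_Omega \<psi> \<and>
     (\<forall>x\<in>strip. - laplacian \<psi> x = w x) \<and>
     (\<forall>x1. \<psi> (x1, 0) = 0 \<and> \<psi> (x1, pi) = 0)"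

definition biot_savart :: "(real \<times> real \<Rightarrow> real) \<Rightarrow> (real \<times> real \<Rightarrow> real \<times> real) \<Rightarrow> bool" where
  "biot_savart w v \<longleftrightarrow> (\<exists>\<psi>. inv_neg_laplacian w \<psi> \<and> (\<forall>x\<in>strip. v x = grad_perp \<psi> x))"

definition no_flow :: "(real \<times> real \<Rightarrow> real \<times> real) \<Rightarrow> bool" where
  "no_flow v \<longleftrightarrow> (\<forall>x1. snd (v (x1, 0)) = 0 \<and> snd (v (x1, pi)) = 0)"

definition spacetime :: "ereal \<Rightarrow> (real \<times> real \<times> real) set" where
  "spacetime T = {t. 0 \<le> t \<and> ereal t < T} \<times> strip"

text \<open>
  Smooth solutions on \<open>[0,T)\<close>, jointly smooth in time and space, up to time \<open>0\<close> and up to the walls;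
  the time derivative at \<open>t = 0\<close> is one-sided.
\<close>

definition boussinesq_solution ::
  "ereal \<Rightarrow> (real \<times> real \<Rightarrow> real) \<Rightarrow> (real \<times> real \<Rightarrow> real) \<Rightarrow>
   (real \<Rightarrow> real \<times> real \<Rightarrow> real) \<Rightarrow> (real \<Rightarrow> real \<times> real \<Rightarrow> real) \<Rightarrow>
   (real \<Rightarrow> real \<times> real \<Rightarrow> real \<times> real) \<Rightarrow> bool" where
  "boussinesq_solution T \<rho>0 \<omega>0 \<rho> \<omega> u \<longleftrightarrow>
     0 < T \<and>
     smooth_on (spacetime T) (\<lambda>(t, x). \<rho> t x) \<and>
     smooth_on (spacetime T) (\<lambda>(t, x). \<omega> t x) \<and>
     smooth_on (spacetime T) (\<lambda>(t, x). u t x) \<and>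
     (\<forall>x\<in>strip. \<rho> 0 x = \<rho>0 x \<and> \<omega> 0 x = \<omega>0 x) \<and>
     (\<forall>t. 0 \<le> t \<and> ereal t < T \<longrightarrow>
        x1_periodic (\<rho> t) \<and> x1_periodic (\<omega> t) \<and> x1_periodic (u t) \<and>
        biot_savart (\<omega> t) (u t) \<and> no_flow (u t) \<and>
        (\<forall>x\<in>strip.
           ((\<lambda>s. \<rho> s x) has_real_derivative - (u t x \<bullet> grad (\<rho> t) x)) (at t within {0..}) \<and>
           ((\<lambda>s. \<omega> s x) has_real_derivative - (u t x \<bullet> grad (\<omega> t) x) - partial1 (\<rho> t) x)
             (at t within {0..})))"

definition lifespan :: "(real \<times> real \<Rightarrow> real) \<Rightarrow> (real \<times> real \<Rightarrow> real) \<Rightarrow> ereal" where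
  "lifespan \<rho>0 \<omega>0 = Sup {T. \<exists>\<rho> \<omega> u. boussinesq_solution T \<rho>0 \<omega>0 \<rho> \<omega> u}"

text \<open>
  The \<open>L\<^sup>p(\<Omega>)\<close> norm, computed over one period. It is finite for the functions continuous on the
  strip and periodic to which it is applied, so the conversion from \<open>ereal\<close> loses nothing.
\<close>

definition Lp_norm :: "ereal \<Rightarrow> (real \<times> real \<Rightarrow> 'b::real_normed_vector) \<Rightarrow> real" where
  "Lp_norm p f =
     (if p = \<infinity> then real_of_ereal (esssup (restrict_space lborel period_cell) (\<lambda>x. ereal (norm (f x))))
      else (LINT x|restrict_space lborel period_cell. norm (f x) powr real_of_ereal p)
             powr (1 / real_of_ereal p))"

end

theory Submission
  imports Defs
begin

text \<open>
  The proof plays the growth of a circulation against the conservation of energy.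

  By uniqueness a solution with \<open>\<rho>0\<close> even and \<open>\<omega>0\<close> odd in \<open>x1\<close> keeps its symmetry, so the horizontal
  velocity vanishes on \<open>x1 = 0\<close> and \<open>x1 = \<pi>\<close> (\<open>no_flow_through_sides\<close>). The flow preserves these two
  lines, hence also the inequalities \<open>\<rho> \<ge> k0\<close> on the first and \<open>\<rho> \<le> 0\<close> on the second. On the square
  \<open>[0, \<pi>]\<^sup>2\<close> between them, with boundary tangent to the flow, the total vorticity grows at the rate
  \<open>\<integral> \<rho>(0, y) - \<rho>(\<pi>, y) dy \<ge> k0 \<pi>\<close> (\<open>vorticity_growth\<close>). By Stokes' theorem this is the growth of
  the circulation along the boundary of the square, which makes the maximal velocity grow linearly
  (\<open>circulation_velocity\<close>).

  At the same time the kinetic energy stays bounded, since the energy is conserved and \<open>\<rho>\<close> is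
  bounded (\<open>kinetic_energy_bound\<close>). A velocity that is of size \<open>t\<close> along the boundary but bounded in
  \<open>L\<^sup>2\<close> must drop off within a layer of width of order \<open>1 / t\<^sup>2\<close>. With a cutoff at this scale, half of
  the vorticity \<open>\<integral> \<omega> \<ge> c t\<close> is found inside the layer, and concentration of mass \<open>t\<close> on a set of measure
  \<open>1 / t\<^sup>2\<close> forces an \<open>L\<^sup>p\<close> norm of order \<open>t \<cdot> t powr (2 * (1 - 1 / p)) = t powr (3 - 2 / p)\<close> (\<open>circulation_Lp\<close>).

  Finally \<open>\<omega>\<close> is transported with source \<open>- \<partial>\<^sub>1\<rho>\<close>, so the maximum principle bounds its maximum by
  \<open>C + t sup |\<nabla>\<rho>|\<close>, and growth of order \<open>t\<^sup>3\<close> forces \<open>sup |\<nabla>\<rho>|\<close> to grow like \<open>t\<^sup>2\<close>. For small times the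
  gap between the two sides bounds the gradient from below.

  The constants depend on the data only through \<open>k0\<close>, the bounds of \<open>\<rho>0\<close> and \<open>\<omega>0\<close>, the initial circulation
  and the initial kinetic energy, and the latter is determined by \<open>\<omega>0\<close>.
\<close>

section \<open>Differential calculus on the strip\<close>

text \<open>The partial derivatives are those of the system, one-sided at the walls. Periodicity is part of the
  notion, so that the two vertical sides of a period cell cancel in the divergence theorem.\<close>

definition C1_Omega :: "(real \<times> real \<Rightarrow> real) \<Rightarrow> bool" where
  "C1_Omega f \<longleftrightarrow> f differentiable_on strip \<and> continuous_on strip (partial1 f) \<and>
     continuous_on strip (partial2 f) \<and> x1_periodic f"

lemma mem_strip [simp]: "(x, y) \<in> strip \<longleftrightarrow> 0 \<le> y \<and> y \<le> pi"
  by (auto simp: strip_def)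

lemma x1_periodicD: "x1_periodic f \<Longrightarrow> 0 \<le> y \<Longrightarrow> y \<le> pi \<Longrightarrow> f (x + 2 * pi, y) = f (x, y)"
  unfolding x1_periodic_def by (auto simp: strip_def)

lemma has_derivative_along_curve:
  assumes "(f has_derivative D) (at (l s) within S)" "(l has_vector_derivative v) (at s within J)"
    "l ` J \<subseteq> S"
  shows "((\<lambda>r. f (l r)) has_vector_derivative D v) (at s within J)"
  using vector_derivative_diff_chain_within[OF assms(2) has_derivative_subset[OF assms(1,3)]]
  by (simp add: o_def)

lemma partial1_DERIV:
  assumes "f differentiable (at (x, y) within strip)" "0 \<le> y" "y \<le> pi"
  shows "((\<lambda>a. f (a, y)) has_real_derivative partial1 f (x, y)) (at x)"
proof -
  have "((\<lambda>a. (a, y)) has_vector_derivative (1, 0)) (at x within UNIV)"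
    by (auto intro!: derivative_eq_intros simp: has_vector_derivative_def)
  then have "((\<lambda>a. f (a, y)) has_vector_derivative frechet_derivative f (at (x, y) within strip) (1, 0))
      (at x within UNIV)"
    by (rule has_derivative_along_curve[where S=strip, rotated])
      (use assms in \<open>auto intro: frechet_derivative_works[THEN iffD1]\<close>)
  then show ?thesis
    by (simp add: has_real_derivative_iff_has_vector_derivative partial1_def)
qed

lemma partial2_DERIV:
  assumes "f differentiable (at (x, y) within strip)"
  shows "((\<lambda>b. f (x, b)) has_real_derivative partial2 f (x, y)) (at y within {0..pi})"
proof -
  have "((\<lambda>b. (x, b)) has_vector_derivative (0, 1)) (at y within {0..pi})"
    by (auto intro!: derivative_eq_intros simp: has_vector_derivative_def)
  then have "((\<lambda>b. f (x, b)) has_vector_derivative frechet_derivative f (at (x, y) within strip) (0, 1))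
      (at y within {0..pi})"
    by (rule has_derivative_along_curve[where S=strip, rotated])
      (use assms in \<open>auto intro: frechet_derivative_works[THEN iffD1]\<close>)
  then show ?thesis
    by (simp add: has_real_derivative_iff_has_vector_derivative partial2_def)
qed

lemma DERIV_unique_Icc:
  fixes f :: "real \<Rightarrow> real"
  assumes "(f has_real_derivative d) (at y within {p..q})" "(f has_real_derivative e) (at y within {p..q})"
    "p < q" "y \<in> {p..q}"
  shows "d = e"
proof (rule vector_derivative_unique_within_closed_interval)
  show "(f has_vector_derivative d) (at y within cbox p q)" "(f has_vector_derivative e) (at y within cbox p q)"
    using assms(1,2) by (simp_all add: has_real_derivative_iff_has_vector_derivative)
qed (use assms in auto)

lemma DERIV_cong_within:
  fixes f :: "real \<Rightarrow> real"
  assumes "(f has_real_derivative d) (at y within S)" "y \<in> S" "\<And>x. x \<in> S \<Longrightarrow> g x = f x"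
  shows "(g has_real_derivative d) (at y within S)"
  by (rule has_field_derivative_transform_within[OF assms(1), where d=1]) (use assms in auto)

lemma partial1_eqI:
  assumes "f differentiable (at (x, y) within strip)" "0 \<le> y" "y \<le> pi"
    "((\<lambda>a. f (a, y)) has_real_derivative d) (at x)"
  shows "partial1 f (x, y) = d"
  using DERIV_unique[OF partial1_DERIV[OF assms(1-3)] assms(4)] .

lemma partial2_eqI:
  assumes "f differentiable (at (x, y) within strip)" "0 \<le> y" "y \<le> pi"
    "((\<lambda>b. f (x, b)) has_real_derivative d) (at y within {0..pi})"
  shows "partial2 f (x, y) = d"
  by (rule DERIV_unique_Icc[OF partial2_DERIV[OF assms(1)] assms(4)]) (use assms in auto)

lemma C1_differentiable_at: "C1_Omega f \<Longrightarrow> 0 \<le> y \<Longrightarrow> y \<le> pi \<Longrightarrow> f differentiable (at (x, y) within strip)"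
  by (auto simp: C1_Omega_def differentiable_on_def)

lemma C1_DERIV1:
  "C1_Omega f \<Longrightarrow> 0 \<le> y \<Longrightarrow> y \<le> pi \<Longrightarrow> ((\<lambda>a. f (a, y)) has_real_derivative partial1 f (x, y)) (at x)"
  by (intro partial1_DERIV C1_differentiable_at)

lemma C1_DERIV1_within:
  "C1_Omega f \<Longrightarrow> 0 \<le> y \<Longrightarrow> y \<le> pi \<Longrightarrow>
    ((\<lambda>a. f (a, y)) has_real_derivative partial1 f (x, y)) (at x within S)"
  by (rule has_field_derivative_at_within[OF C1_DERIV1])

lemma C1_DERIV2:
  "C1_Omega f \<Longrightarrow> 0 \<le> y \<Longrightarrow> y \<le> pi \<Longrightarrow>
    ((\<lambda>b. f (x, b)) has_real_derivative partial2 f (x, y)) (at y within {0..pi})"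
  by (intro partial2_DERIV C1_differentiable_at)

lemma C1_cont: "C1_Omega f \<Longrightarrow> continuous_on strip f"
  by (auto simp: C1_Omega_def differentiable_imp_continuous_on)

lemma C1_cont1: "C1_Omega f \<Longrightarrow> continuous_on strip (partial1 f)"
  by (auto simp: C1_Omega_def)

lemma C1_cont2: "C1_Omega f \<Longrightarrow> continuous_on strip (partial2 f)"
  by (auto simp: C1_Omega_def)

lemma C1_periodic: "C1_Omega f \<Longrightarrow> 0 \<le> y \<Longrightarrow> y \<le> pi \<Longrightarrow> f (x + 2 * pi, y) = f (x, y)"
  by (auto simp: C1_Omega_def intro!: x1_periodicD)

text \<open>A Frechet derivative is linear, hence determined by its values in the two axis directions. Within the
  strip these are ordinary one-dimensional derivatives, one-sided at the walls, so the rules for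
  \<open>partial1\<close> and \<open>partial2\<close> reduce to calculus in one variable.\<close>

lemma C1_OmegaI:
  assumes diff: "f differentiable_on strip" and per: "x1_periodic f"
    and d1: "\<And>x y. 0 \<le> y \<Longrightarrow> y \<le> pi \<Longrightarrow> ((\<lambda>a. f (a, y)) has_real_derivative f1 (x, y)) (at x)"
    and d2: "\<And>x y. 0 \<le> y \<Longrightarrow> y \<le> pi \<Longrightarrow>
      ((\<lambda>b. f (x, b)) has_real_derivative f2 (x, y)) (at y within {0..pi})"
    and cont: "continuous_on strip f1" "continuous_on strip f2"
  shows "C1_Omega f \<and> (\<forall>x\<in>strip. partial1 f x = f1 x \<and> partial2 f x = f2 x)"
proof -
  have df: "f differentiable (at (x, y) within strip)" if "0 \<le> y" "y \<le> pi" for x y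
    using diff that by (auto simp: differentiable_on_def)
  have eq: "\<forall>x\<in>strip. partial1 f x = f1 x \<and> partial2 f x = f2 x"
    using partial1_eqI[OF df] partial2_eqI[OF df] d1 d2 by auto
  moreover have "continuous_on strip (partial1 f)" "continuous_on strip (partial2 f)"
    using eq cont by (auto cong: continuous_on_cong)
  ultimately show ?thesis using diff per by (auto simp: C1_Omega_def)
qed

lemma C1_product_rule:
  assumes f: "C1_Omega f" and g: "C1_Omega g"
  shows "C1_Omega (\<lambda>x. f x * g x) \<and> (\<forall>x\<in>strip.
    partial1 (\<lambda>x. f x * g x) x = partial1 f x * g x + f x * partial1 g x \<and>
    partial2 (\<lambda>x. f x * g x) x = partial2 f x * g x + f x * partial2 g x)"
proof (rule C1_OmegaI)
  show "(\<lambda>x. f x * g x) differentiable_on strip"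
    using f g by (auto simp: C1_Omega_def intro: differentiable_on_mult)
  show "x1_periodic (\<lambda>x. f x * g x)"
    by (auto simp: x1_periodic_def C1_periodic[OF f] C1_periodic[OF g])
qed (auto intro!: derivative_eq_intros C1_DERIV1 C1_DERIV2 continuous_intros C1_cont[OF f] C1_cont[OF g]
    C1_cont1[OF f] C1_cont1[OF g] C1_cont2[OF f] C1_cont2[OF g] f g)

lemma C1_sum_rule:
  assumes f: "C1_Omega f" and g: "C1_Omega g"
  shows "C1_Omega (\<lambda>x. f x + g x) \<and> (\<forall>x\<in>strip.
    partial1 (\<lambda>x. f x + g x) x = partial1 f x + partial1 g x \<and>
    partial2 (\<lambda>x. f x + g x) x = partial2 f x + partial2 g x)"
proof (rule C1_OmegaI)
  show "(\<lambda>x. f x + g x) differentiable_on strip"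
    using f g by (auto simp: C1_Omega_def intro: differentiable_on_add)
  show "x1_periodic (\<lambda>x. f x + g x)"
    by (auto simp: x1_periodic_def C1_periodic[OF f] C1_periodic[OF g])
qed (auto intro!: derivative_eq_intros C1_DERIV1 C1_DERIV2 continuous_intros C1_cont[OF f] C1_cont[OF g]
    C1_cont1[OF f] C1_cont1[OF g] C1_cont2[OF f] C1_cont2[OF g] f g)

lemma C1_minus_rule:
  assumes f: "C1_Omega f"
  shows "C1_Omega (\<lambda>x. - f x) \<and> (\<forall>x\<in>strip.
    partial1 (\<lambda>x. - f x) x = - partial1 f x \<and> partial2 (\<lambda>x. - f x) x = - partial2 f x)"
proof (rule C1_OmegaI)
  show "(\<lambda>x. - f x) differentiable_on strip"
    using f by (auto simp: C1_Omega_def intro: differentiable_on_minus)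
  show "x1_periodic (\<lambda>x. - f x)"
    by (auto simp: x1_periodic_def C1_periodic[OF f])
qed (auto intro!: derivative_eq_intros C1_DERIV1 C1_DERIV2 continuous_intros
    C1_cont1[OF f] C1_cont2[OF f] f)

lemma C1_difference_rule:
  assumes f: "C1_Omega f" and g: "C1_Omega g"
  shows "C1_Omega (\<lambda>x. f x - g x) \<and> (\<forall>x\<in>strip.
    partial1 (\<lambda>x. f x - g x) x = partial1 f x - partial1 g x \<and>
    partial2 (\<lambda>x. f x - g x) x = partial2 f x - partial2 g x)"
  using C1_sum_rule[OF f, of "\<lambda>x. - g x"] C1_minus_rule[OF g] by simp

lemmas C1_arith [simp, intro] = C1_product_rule[THEN conjunct1] C1_sum_rule[THEN conjunct1]
  C1_minus_rule[THEN conjunct1] C1_difference_rule[THEN conjunct1]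

lemma partial_arith [simp]:
  assumes "C1_Omega f" "C1_Omega g" "x \<in> strip"
  shows "partial1 (\<lambda>x. f x * g x) x = partial1 f x * g x + f x * partial1 g x"
    "partial2 (\<lambda>x. f x * g x) x = partial2 f x * g x + f x * partial2 g x"
    "partial1 (\<lambda>x. f x + g x) x = partial1 f x + partial1 g x"
    "partial2 (\<lambda>x. f x + g x) x = partial2 f x + partial2 g x"
    "partial1 (\<lambda>x. f x - g x) x = partial1 f x - partial1 g x"
    "partial2 (\<lambda>x. f x - g x) x = partial2 f x - partial2 g x"
  using C1_product_rule[OF assms(1,2)] C1_sum_rule[OF assms(1,2)] C1_difference_rule[OF assms(1,2)] assms(3) by simp_all

lemma partial_minus [simp]:
  assumes "C1_Omega f" "x \<in> strip"
  shows "partial1 (\<lambda>x. - f x) x = - partial1 f x" "partial2 (\<lambda>x. - f x) x = - partial2 f x"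
  using C1_minus_rule[OF assms(1)] assms(2) by simp_all

lemma C1_vertical:
  assumes "\<And>y. 0 \<le> y \<Longrightarrow> y \<le> pi \<Longrightarrow> (g has_real_derivative g' y) (at y)" "continuous_on {0..pi} g'"
  shows "C1_Omega (\<lambda>x. g (snd x)) \<and> (\<forall>x\<in>strip.
    partial1 (\<lambda>x. g (snd x)) x = 0 \<and> partial2 (\<lambda>x. g (snd x)) x = g' (snd x))"
proof (intro C1_OmegaI)
  show "(\<lambda>x. g (snd x)) differentiable_on strip"
    unfolding differentiable_on_def
  proof
    fix x :: "real \<times> real" assume "x \<in> strip"
    then have "(g has_derivative (\<lambda>h. g' (snd x) * h)) (at (snd x))"
      using assms(1)[of "snd x"] by (cases x) (auto simp: has_field_derivative_def)
    then have "((\<lambda>x. g (snd x)) has_derivative (\<lambda>h. g' (snd x) * snd h)) (at x within strip)"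
      by (rule has_derivative_compose[OF has_derivative_snd[OF has_derivative_ident]])
    then show "(\<lambda>x. g (snd x)) differentiable at x within strip"
      by (rule differentiableI)
  qed
  show "continuous_on strip (\<lambda>x. g' (snd x))"
    by (rule continuous_on_compose2[OF assms(2)]) (auto intro!: continuous_intros simp: strip_def)
  show "((\<lambda>b. g (snd (x, b))) has_real_derivative g' (snd (x, y))) (at y within {0..pi})"
    if "0 \<le> y" "y \<le> pi" for x y :: real
    using has_field_derivative_at_within[OF assms(1)[OF that]] by simp
qed (auto simp: x1_periodic_def)

lemma C1_const [simp]: "C1_Omega (\<lambda>x. c)"
  and partial_const [simp]: "x \<in> strip \<Longrightarrow> partial1 (\<lambda>x. c) x = 0" "x \<in> strip \<Longrightarrow> partial2 (\<lambda>x. c) x = 0"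
  using C1_vertical[of "\<lambda>_. c" "\<lambda>_. 0"] by auto

lemma C1_snd [simp]: "C1_Omega (\<lambda>x. snd x)"
  and partial_snd [simp]: "x \<in> strip \<Longrightarrow> partial1 (\<lambda>x. snd x) x = 0" "x \<in> strip \<Longrightarrow> partial2 (\<lambda>x. snd x) x = 1"
  using C1_vertical[of "\<lambda>y. y" "\<lambda>_. 1"] by auto

lemma C1_cong:
  assumes f: "C1_Omega f" and eq: "\<And>x. x \<in> strip \<Longrightarrow> g x = f x"
  shows "C1_Omega g \<and> (\<forall>x\<in>strip. partial1 g x = partial1 f x \<and> partial2 g x = partial2 f x)"
proof (intro C1_OmegaI)
  show "g differentiable_on strip"
    using f eq unfolding C1_Omega_def differentiable_on_def differentiable_def
    by (metis has_derivative_transform)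
  show "x1_periodic g"
    using C1_periodic[OF f] eq by (auto simp: x1_periodic_def)
  fix x y :: real assume y: "0 \<le> y" "y \<le> pi"
  show "((\<lambda>a. g (a, y)) has_real_derivative partial1 f (x, y)) (at x)"
    using C1_DERIV1[OF f y] eq y by simp
  show "((\<lambda>b. g (x, b)) has_real_derivative partial2 f (x, y)) (at y within {0..pi})"
    by (rule DERIV_cong_within[OF C1_DERIV2[OF f y]]) (use eq y in auto)
qed (use f in \<open>auto simp: C1_Omega_def\<close>)

lemma smooth_Omega_C1:
  fixes f :: "real \<times> real \<Rightarrow> real"
  assumes "smooth_Omega f" shows "C1_Omega f"
proof -
  have "Ck_on (Suc 0) strip f" using assms by (auto simp: smooth_Omega_def smooth_on_def)
  moreover have "(1, 0) \<in> (Basis :: (real \<times> real) set)" "(0, 1) \<in> (Basis :: (real \<times> real) set)"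
    by (auto simp: Basis_prod_def)
  ultimately show ?thesis using assms
    by (auto simp: C1_Omega_def smooth_Omega_def partial1_def[abs_def] partial2_def[abs_def])
qed

section \<open>Integration over rectangles\<close>

lemma cbox_subset_strip: "0 \<le> c \<Longrightarrow> d \<le> pi \<Longrightarrow> cbox (a, c) (b, d) \<subseteq> strip"
  by (auto simp: cbox_Pair_eq strip_def)

lemma integral_partial1:
  assumes f: "C1_Omega f" and "a \<le> b" "0 \<le> c" "d \<le> pi"
  shows "integral (cbox (a, c) (b, d)) (partial1 f) = integral {c..d} (\<lambda>y. f (b, y) - f (a, y))"
proof -
  have cont: "continuous_on (cbox (a, c) (b, d)) (partial1 f)"
    by (rule continuous_on_subset[OF C1_cont1[OF f]]) (use assms cbox_subset_strip in auto)
  have "integral (cbox (a, c) (b, d)) (partial1 f) =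
      integral (cbox a b) (\<lambda>x. integral (cbox c d) (\<lambda>y. partial1 f (x, y)))"
    by (rule integral_prod_continuous[OF cont])
  also have "\<dots> = integral (cbox c d) (\<lambda>y. integral (cbox a b) (\<lambda>x. partial1 f (x, y)))"
    using integral_swap_continuous[of a c b d "\<lambda>x y. partial1 f (x, y)"] cont by simp
  also have "\<dots> = integral {c..d} (\<lambda>y. f (b, y) - f (a, y))"
  proof (simp, rule integral_cong)
    fix y assume y: "y \<in> {c..d}"
    show "integral {a..b} (\<lambda>x. partial1 f (x, y)) = f (b, y) - f (a, y)"
      by (rule integral_unique, rule fundamental_theorem_of_calculus)
        (use assms y in \<open>auto simp flip: has_real_derivative_iff_has_vector_derivative
            intro!: C1_DERIV1_within[OF f]\<close>)
  qed
  finally show ?thesis .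
qed

lemma integral_partial2:
  assumes f: "C1_Omega f" and "c \<le> d" "0 \<le> c" "d \<le> pi"
  shows "integral (cbox (a, c) (b, d)) (partial2 f) = integral {a..b} (\<lambda>x. f (x, d) - f (x, c))"
proof -
  have cont: "continuous_on (cbox (a, c) (b, d)) (partial2 f)"
    by (rule continuous_on_subset[OF C1_cont2[OF f]]) (use assms cbox_subset_strip in auto)
  have "integral (cbox (a, c) (b, d)) (partial2 f) =
      integral (cbox a b) (\<lambda>x. integral (cbox c d) (\<lambda>y. partial2 f (x, y)))"
    by (rule integral_prod_continuous[OF cont])
  also have "\<dots> = integral {a..b} (\<lambda>x. f (x, d) - f (x, c))"
  proof (simp, rule integral_cong)
    fix x assume "x \<in> {a..b}"
    show "integral {c..d} (\<lambda>y. partial2 f (x, y)) = f (x, d) - f (x, c)"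
      by (rule integral_unique, rule fundamental_theorem_of_calculus)
        (use assms in \<open>auto simp flip: has_real_derivative_iff_has_vector_derivative
            intro!: DERIV_subset[OF C1_DERIV2[OF f]]\<close>)
  qed
  finally show ?thesis .
qed

abbreviation cell :: "(real \<times> real) set" where "cell \<equiv> cbox (- pi, 0) (pi, pi)"

abbreviation half_cell :: "(real \<times> real) set" where "half_cell \<equiv> cbox (0, 0) (pi, pi)"

lemma cell_subset_strip: "cell \<subseteq> strip" and half_cell_subset_strip: "half_cell \<subseteq> strip"
  and half_cell_subset_cell: "half_cell \<subseteq> cell"
  by (auto simp: cbox_Pair_eq strip_def)

lemma integrable_on_box:
  fixes f :: "real \<times> real \<Rightarrow> real"
  assumes "continuous_on strip f" "0 \<le> c" "d \<le> pi"
  shows "f integrable_on cbox (a, c) (b, d)"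
  by (rule integrable_continuous[OF continuous_on_subset[OF assms(1) cbox_subset_strip[OF assms(2,3)]]])

lemma box_divergence:
  assumes g: "C1_Omega g" and h: "C1_Omega h" and "a \<le> b"
    and F: "\<And>x. x \<in> strip \<Longrightarrow> F x = partial1 g x + partial2 h x"
  shows "integral (cbox (a, 0) (b, pi)) F =
    integral {0..pi} (\<lambda>y. g (b, y) - g (a, y)) + integral {a..b} (\<lambda>x. h (x, pi) - h (x, 0))"
proof -
  have "integral (cbox (a, 0) (b, pi)) F = integral (cbox (a, 0) (b, pi)) (\<lambda>x. partial1 g x + partial2 h x)"
    using F cbox_subset_strip[of 0 pi a b] by (intro integral_cong) auto
  also have "\<dots> = integral (cbox (a, 0) (b, pi)) (partial1 g) + integral (cbox (a, 0) (b, pi)) (partial2 h)"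
    by (intro integral_add integrable_on_box C1_cont1 C1_cont2 g h) auto
  finally show ?thesis
    by (simp add: integral_partial1[OF g \<open>a \<le> b\<close>] integral_partial2[OF h])
qed

text \<open>The flux through the sides \<open>x1 = \<plusminus>\<pi>\<close> cancels by periodicity.\<close>

lemma cell_divergence:
  assumes g: "C1_Omega g" and h: "C1_Omega h"
    and F: "\<And>x. x \<in> strip \<Longrightarrow> F x = partial1 g x + partial2 h x"
    and walls: "\<And>x. h (x, 0) = 0" "\<And>x. h (x, pi) = 0"
  shows "integral cell F = 0"
proof -
  have "g (pi, y) = g (- pi, y)" if "0 \<le> y" "y \<le> pi" for y
    using C1_periodic[OF g that, of "- pi"] by simp
  then have "integral {0..pi} (\<lambda>y. g (pi, y) - g (- pi, y)) = integral {0..pi} (\<lambda>y. 0)"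
    by (intro integral_cong) auto
  then show ?thesis
    using box_divergence[OF g h _ F, of "- pi" pi] walls by simp
qed

text \<open>The derivative in \<open>y\<close> of the integral of \<open>partial1 f\<close> over \<open>[a, b] \<times> {y}\<close> can be computed under
  the integral sign, or after carrying out the integral; comparing both results and differentiating
  in \<open>b\<close> gives the symmetry of the mixed derivatives.\<close>

lemma mixed_partials:
  assumes f: "C1_Omega f" and p: "C1_Omega (partial1 f)" and q: "C1_Omega (partial2 f)"
    and x: "x \<in> strip"
  shows "partial2 (partial1 f) x = partial1 (partial2 f) x"
proof -
  obtain x1 y where xy: "x = (x1, y)" by (cases x)
  with x have y: "0 \<le> y" "y \<le> pi" by auto
  define a where "a = x1 - 1"
  have eq: "integral {a..b} (\<lambda>s. partial2 (partial1 f) (s, y)) = partial2 f (b, y) - partial2 f (a, y)"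
    if b: "a \<le> b" for b
  proof -
    have "((\<lambda>v. integral (cbox a b) (\<lambda>s. partial1 f (s, v))) has_real_derivative
        integral (cbox a b) (\<lambda>s. partial2 (partial1 f) (s, y))) (at y within {0..pi})"
    proof (rule leibniz_rule_field_derivative)
      show "(\<lambda>s. partial1 f (s, v)) integrable_on cbox a b" if "v \<in> {0..pi}" for v
        using that by (intro integrable_continuous continuous_on_compose2[OF C1_cont1[OF f]])
          (auto intro!: continuous_intros)
      show "continuous_on ({0..pi} \<times> cbox a b) (\<lambda>(v, s). partial2 (partial1 f) (s, v))"
        unfolding split_beta
        by (intro continuous_on_compose2[OF C1_cont2[OF p]]) (auto intro!: continuous_intros simp: strip_def)
    qed (use y in \<open>auto intro!: C1_DERIV2[OF p]\<close>)
    moreover have "integral (cbox a b) (\<lambda>s. partial1 f (s, v)) = f (b, v) - f (a, v)"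
      if "v \<in> {0..pi}" for v
      unfolding cbox_interval
      by (rule integral_unique, rule fundamental_theorem_of_calculus)
        (use b that in \<open>auto simp flip: has_real_derivative_iff_has_vector_derivative
            intro!: C1_DERIV1_within[OF f]\<close>)
    ultimately have "((\<lambda>v. f (b, v) - f (a, v)) has_real_derivative
        integral (cbox a b) (\<lambda>s. partial2 (partial1 f) (s, y))) (at y within {0..pi})"
      using y by (elim DERIV_cong_within) auto
    moreover have "((\<lambda>v. f (b, v) - f (a, v)) has_real_derivative
        partial2 f (b, y) - partial2 f (a, y)) (at y within {0..pi})"
      using y by (auto intro!: derivative_eq_intros C1_DERIV2[OF f])
    ultimately show ?thesis
      using DERIV_unique_Icc[of _ _ y 0 pi] y by auto
  qed
  have "((\<lambda>b. integral {a..b} (\<lambda>s. partial2 (partial1 f) (s, y))) has_real_derivative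
      partial2 (partial1 f) (x1, y)) (at x1 within {a..x1 + 1})"
    using y by (intro integral_has_real_derivative continuous_on_compose2[OF C1_cont2[OF p]])
      (auto intro!: continuous_intros simp: a_def)
  then have "((\<lambda>b. partial2 f (b, y) - partial2 f (a, y)) has_real_derivative
      partial2 (partial1 f) (x1, y)) (at x1 within {a..x1 + 1})"
    by (rule has_field_derivative_transform_within[where d=1]) (auto simp: eq, auto simp: a_def)
  moreover have "((\<lambda>b. partial2 f (b, y) - partial2 f (a, y)) has_real_derivative
      partial1 (partial2 f) (x1, y)) (at x1 within {a..x1 + 1})"
    using y by (auto intro!: derivative_eq_intros C1_DERIV1_within[OF q])
  ultimately show ?thesis
    unfolding xy by (rule DERIV_unique_Icc) (auto simp: a_def)
qed

section \<open>Incompressible flows and their energy identities\<close>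

text \<open>The kinematics at a fixed time: velocity \<open>(a, b)\<close>, stream function \<open>\<psi>\<close>, vorticity \<open>w\<close>. Only \<open>a\<close>, \<open>b\<close>,
  \<open>\<psi>\<close> are differentiated, and only once; the notion is linear, so it applies to differences of two
  solutions.\<close>

definition stream_flow ::
  "(real \<times> real \<Rightarrow> real) \<Rightarrow> (real \<times> real \<Rightarrow> real) \<Rightarrow> (real \<times> real \<Rightarrow> real) \<Rightarrow> (real \<times> real \<Rightarrow> real) \<Rightarrow> bool"
  where
  "stream_flow w \<psi> a b \<longleftrightarrow> C1_Omega \<psi> \<and> C1_Omega a \<and> C1_Omega b \<and>
     (\<forall>x\<in>strip. a x = partial2 \<psi> x \<and> b x = - partial1 \<psi> x \<and> w x = partial1 b x - partial2 a x) \<and>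
     (\<forall>x1. \<psi> (x1, 0) = 0 \<and> \<psi> (x1, pi) = 0)"

lemma stream_flowD:
  assumes "stream_flow w \<psi> a b"
  shows "C1_Omega \<psi>" "C1_Omega a" "C1_Omega b"
    "\<And>x. x \<in> strip \<Longrightarrow> partial2 \<psi> x = a x" "\<And>x. x \<in> strip \<Longrightarrow> partial1 \<psi> x = - b x"
    "\<And>x. x \<in> strip \<Longrightarrow> w x = partial1 b x - partial2 a x"
    "\<And>x1. \<psi> (x1, 0) = 0" "\<And>x1. \<psi> (x1, pi) = 0"
  using assms by (auto simp: stream_flow_def)

lemma stream_flow_walls:
  assumes "stream_flow w \<psi> a b"
  shows "b (x, 0) = 0" "b (x, pi) = 0"
proof -
  note s = stream_flowD[OF assms]
  have "partial1 \<psi> (x, y) = 0" if "y = 0 \<or> y = pi" for y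
  proof (rule partial1_eqI)
    show "((\<lambda>a. \<psi> (a, y)) has_real_derivative 0) (at x)"
      using that s(7,8) by auto
  qed (use that C1_differentiable_at[OF s(1)] in auto)
  then show "b (x, 0) = 0" "b (x, pi) = 0"
    using s(5)[of "(x, 0)"] s(5)[of "(x, pi)"] by auto
qed

lemma stream_flow_div:
  assumes "stream_flow w \<psi> a b" "x \<in> strip"
  shows "partial2 b x = - partial1 a x"
proof -
  note s = stream_flowD[OF assms(1)]
  have 1: "C1_Omega (partial1 \<psi>) \<and> (\<forall>x\<in>strip. partial1 (partial1 \<psi>) x = partial1 (\<lambda>x. - b x) x \<and>
      partial2 (partial1 \<psi>) x = partial2 (\<lambda>x. - b x) x)"
    by (rule C1_cong) (use s in auto)
  have 2: "C1_Omega (partial2 \<psi>) \<and> (\<forall>x\<in>strip. partial1 (partial2 \<psi>) x = partial1 a x \<and>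
      partial2 (partial2 \<psi>) x = partial2 a x)"
    by (rule C1_cong) (use s in auto)
  show ?thesis
    using mixed_partials[OF s(1) 1[THEN conjunct1] 2[THEN conjunct1] assms(2)] 1 2 s assms(2) by auto
qed

lemma stream_flow_minus:
  assumes 1: "stream_flow w \<psi> a b" and 2: "stream_flow w' \<psi>' a' b'"
  shows "stream_flow (\<lambda>x. w x - w' x) (\<lambda>x. \<psi> x - \<psi>' x) (\<lambda>x. a x - a' x) (\<lambda>x. b x - b' x)"
  using stream_flowD[OF 1] stream_flowD[OF 2] unfolding stream_flow_def by (simp del: split_paired_All)

text \<open>The two integrands add up to the divergence of \<open>p f (a, b)\<close>, whose flux through the walls vanishes.
  This skew-symmetry makes the advection terms drop out of the energy identities.\<close>

lemma transport_parts:
  assumes u: "stream_flow w \<psi> a b" and f: "C1_Omega f" and p: "C1_Omega p"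
  shows "integral cell (\<lambda>x. p x * (a x * partial1 f x + b x * partial2 f x)) =
    - integral cell (\<lambda>x. f x * (a x * partial1 p x + b x * partial2 p x))"
proof -
  note s = stream_flowD[OF u]
  note c = C1_cont[OF f] C1_cont[OF p] C1_cont[OF s(2)] C1_cont[OF s(3)]
    C1_cont1[OF f] C1_cont2[OF f] C1_cont1[OF p] C1_cont2[OF p]
  have "integral cell (\<lambda>x. p x * (a x * partial1 f x + b x * partial2 f x) +
      f x * (a x * partial1 p x + b x * partial2 p x)) = 0"
  proof (rule cell_divergence)
    show "C1_Omega (\<lambda>x. p x * f x * a x)" "C1_Omega (\<lambda>x. p x * f x * b x)"
      using s f p by simp_all
    show "p (x, 0) * f (x, 0) * b (x, 0) = 0" "p (x, pi) * f (x, pi) * b (x, pi) = 0" for x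
      using stream_flow_walls[OF u] by auto
  qed (use s f p in \<open>simp add: stream_flow_div[OF u] algebra_simps\<close>)
  moreover have "(\<lambda>x. p x * (a x * partial1 f x + b x * partial2 f x)) integrable_on cell"
    "(\<lambda>x. f x * (a x * partial1 p x + b x * partial2 p x)) integrable_on cell"
    by (intro integrable_on_box continuous_intros c; simp)+
  ultimately show ?thesis
    by (simp add: integral_add)
qed

text \<open>Integration by parts on the side of the second flow; \<open>\<psi>\<close> vanishes on the walls. The left-hand side is
  symmetric in the two flows, so the pairing of stream function and vorticity is symmetric as well.\<close>

lemma stream_function_parts:
  assumes 1: "stream_flow w \<psi> a b" and 2: "stream_flow w' \<psi>' a' b'"
  shows "integral cell (\<lambda>x. a x * a' x + b x * b' x) = integral cell (\<lambda>x. \<psi> x * w' x)"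
proof -
  note s = stream_flowD[OF 1] and s' = stream_flowD[OF 2]
  note c = C1_cont[OF s(1)] C1_cont[OF s(2)] C1_cont[OF s(3)] C1_cont[OF s'(2)] C1_cont[OF s'(3)]
    C1_cont1[OF s'(3)] C1_cont2[OF s'(2)]
  have "integral cell (\<lambda>x. (a x * a' x + b x * b' x) - \<psi> x * (partial1 b' x - partial2 a' x)) = 0"
  proof (rule cell_divergence)
    show "C1_Omega (\<lambda>x. - (\<psi> x * b' x))" "C1_Omega (\<lambda>x. \<psi> x * a' x)"
      using s s' by simp_all
  qed (use s s' in \<open>simp_all add: algebra_simps\<close>)
  moreover have "(\<lambda>x. a x * a' x + b x * b' x) integrable_on cell"
    "(\<lambda>x. \<psi> x * (partial1 b' x - partial2 a' x)) integrable_on cell"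
    by (intro integrable_on_box continuous_intros c; simp)+
  moreover have "integral cell (\<lambda>x. \<psi> x * w' x) = integral cell (\<lambda>x. \<psi> x * (partial1 b' x - partial2 a' x))"
    by (rule integral_cong) (use s' cell_subset_strip in auto)
  ultimately show ?thesis
    by (simp add: integral_diff)
qed

text \<open>The vorticity form \<open>W U\<^sup>\<bottom>\<close> of the advection of a divergence free field \<open>U = (A, B)\<close> by itself
  differs from \<open>U \<cdot> \<nabla>U\<close> by a gradient, which \<open>u = (a, b)\<close> does not see; a further integration by
  parts moves the derivative from \<open>U\<close> to \<open>u\<close>.\<close>

lemma vorticity_momentum:
  assumes U: "stream_flow W \<Psi> A B" and u: "stream_flow w \<psi> a b"
  shows "integral cell (\<lambda>x. W x * (a x * partial1 \<Psi> x + b x * partial2 \<Psi> x)) =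
    - integral cell (\<lambda>x. A x * A x * partial1 a x + A x * B x * partial2 a x +
        B x * A x * partial1 b x + B x * B x * partial2 b x)"
proof -
  note s = stream_flowD[OF U] and s' = stream_flowD[OF u]
  note c = C1_cont[OF s(2)] C1_cont[OF s(3)] C1_cont[OF s'(2)] C1_cont[OF s'(3)]
    C1_cont1[OF s'(2)] C1_cont1[OF s'(3)] C1_cont2[OF s'(2)] C1_cont2[OF s'(3)]
    C1_cont1[OF s(3)] C1_cont2[OF s(2)]
  let ?W = "\<lambda>x. (partial1 B x - partial2 A x) * (b x * A x - a x * B x)"
  let ?Q = "\<lambda>x. A x * A x * partial1 a x + A x * B x * partial2 a x +
        B x * A x * partial1 b x + B x * B x * partial2 b x"
  have "integral cell (\<lambda>x. 2 * (?W x + ?Q x)) = 0"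
  proof (rule cell_divergence)
    show "C1_Omega (\<lambda>x. 2 * (A x * (a x * A x + b x * B x)) - a x * (A x * A x + B x * B x))"
      "C1_Omega (\<lambda>x. 2 * (B x * (a x * A x + b x * B x)) - b x * (A x * A x + B x * B x))"
      using s s' by simp_all
  qed (use s s' in \<open>simp_all add: stream_flow_walls[OF u] stream_flow_walls[OF U]
      stream_flow_div[OF u] stream_flow_div[OF U] algebra_simps\<close>)
  then have "integral cell (\<lambda>x. ?W x + ?Q x) = 0"
    by (simp del: distrib_left_numeral)
  moreover have "?W integrable_on cell" "?Q integrable_on cell"
    by (intro integrable_on_box continuous_intros c; simp)+
  moreover have "integral cell (\<lambda>x. W x * (a x * partial1 \<Psi> x + b x * partial2 \<Psi> x)) = integral cell ?W"
  proof (rule integral_cong)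
    fix x assume "x \<in> cell"
    then have x: "x \<in> strip" using cell_subset_strip by auto
    show "W x * (a x * partial1 \<Psi> x + b x * partial2 \<Psi> x) = ?W x"
      by (simp add: s(4,5,6)[OF x] algebra_simps)
  qed
  ultimately show ?thesis
    by (simp add: integral_add)
qed

section \<open>Time-dependent fields\<close>

text \<open>A field on the closed time interval \<open>[0, t1]\<close> that is jointly \<open>C\<^sup>1\<close>, with time derivative \<open>f'\<close>.\<close>

definition evolves ::
  "real \<Rightarrow> (real \<Rightarrow> real \<times> real \<Rightarrow> real) \<Rightarrow> (real \<Rightarrow> real \<times> real \<Rightarrow> real) \<Rightarrow> bool" where
  "evolves t1 f f' \<longleftrightarrow>
     (\<forall>t\<in>{0..t1}. C1_Omega (f t)) \<and>
     (\<forall>t\<in>{0..t1}. \<forall>x\<in>strip. ((\<lambda>s. f s x) has_real_derivative f' t x) (at t within {0..t1})) \<and>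
     continuous_on ({0..t1} \<times> strip) (\<lambda>z. f (fst z) (snd z)) \<and>
     continuous_on ({0..t1} \<times> strip) (\<lambda>z. f' (fst z) (snd z)) \<and>
     continuous_on ({0..t1} \<times> strip) (\<lambda>z. partial1 (f (fst z)) (snd z)) \<and>
     continuous_on ({0..t1} \<times> strip) (\<lambda>z. partial2 (f (fst z)) (snd z))"

lemma evolvesD:
  assumes "evolves t1 f f'"
  shows "\<And>t. t \<in> {0..t1} \<Longrightarrow> C1_Omega (f t)"
    "\<And>t x. t \<in> {0..t1} \<Longrightarrow> x \<in> strip \<Longrightarrow> ((\<lambda>s. f s x) has_real_derivative f' t x) (at t within {0..t1})"
    "continuous_on ({0..t1} \<times> strip) (\<lambda>z. f (fst z) (snd z))"
    "continuous_on ({0..t1} \<times> strip) (\<lambda>z. f' (fst z) (snd z))"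
    "continuous_on ({0..t1} \<times> strip) (\<lambda>z. partial1 (f (fst z)) (snd z))"
    "continuous_on ({0..t1} \<times> strip) (\<lambda>z. partial2 (f (fst z)) (snd z))"
  using assms by (auto simp: evolves_def)

lemma evolves_mult:
  assumes f: "evolves t1 f f'" and g: "evolves t1 g g'"
  shows "evolves t1 (\<lambda>t x. f t x * g t x) (\<lambda>t x. f' t x * g t x + f t x * g' t x)"
proof -
  note c = evolvesD(3-6)[OF f] evolvesD(3-6)[OF g]
  have 1: "continuous_on ({0..t1} \<times> strip) (\<lambda>z. partial1 (f (fst z)) (snd z) * g (fst z) (snd z) +
      f (fst z) (snd z) * partial1 (g (fst z)) (snd z))"
    "continuous_on ({0..t1} \<times> strip) (\<lambda>z. partial2 (f (fst z)) (snd z) * g (fst z) (snd z) +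
      f (fst z) (snd z) * partial2 (g (fst z)) (snd z))"
    by (intro continuous_intros c)+
  have "continuous_on ({0..t1} \<times> strip) (\<lambda>z. partial1 (\<lambda>x. f (fst z) x * g (fst z) x) (snd z))"
    "continuous_on ({0..t1} \<times> strip) (\<lambda>z. partial2 (\<lambda>x. f (fst z) x * g (fst z) x) (snd z))"
    by (rule continuous_on_eq[OF 1(1)] continuous_on_eq[OF 1(2)],
        use evolvesD(1)[OF f] evolvesD(1)[OF g] in \<open>auto simp del: mem_strip\<close>)+
  moreover have "((\<lambda>s. f s x * g s x) has_real_derivative f' t x * g t x + f t x * g' t x) (at t within {0..t1})"
    if "t \<in> {0..t1}" "x \<in> strip" for t x
    by (rule DERIV_cong[OF DERIV_mult[OF evolvesD(2)[OF f that] evolvesD(2)[OF g that]]]) simp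
  ultimately show ?thesis
    unfolding evolves_def using evolvesD(1)[OF f] evolvesD(1)[OF g]
    by (auto intro!: continuous_on_add continuous_on_mult c simp del: mem_strip)
qed

lemma evolves_minus:
  assumes f: "evolves t1 f f'" and g: "evolves t1 g g'"
  shows "evolves t1 (\<lambda>t x. f t x - g t x) (\<lambda>t x. f' t x - g' t x)"
proof -
  note c = evolvesD(3-6)[OF f] evolvesD(3-6)[OF g]
  have 1: "continuous_on ({0..t1} \<times> strip) (\<lambda>z. partial1 (f (fst z)) (snd z) - partial1 (g (fst z)) (snd z))"
    "continuous_on ({0..t1} \<times> strip) (\<lambda>z. partial2 (f (fst z)) (snd z) - partial2 (g (fst z)) (snd z))"
    by (intro continuous_intros c)+
  have "continuous_on ({0..t1} \<times> strip) (\<lambda>z. partial1 (\<lambda>x. f (fst z) x - g (fst z) x) (snd z))"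
    "continuous_on ({0..t1} \<times> strip) (\<lambda>z. partial2 (\<lambda>x. f (fst z) x - g (fst z) x) (snd z))"
    by (rule continuous_on_eq[OF 1(1)] continuous_on_eq[OF 1(2)],
        use evolvesD(1)[OF f] evolvesD(1)[OF g] in \<open>auto simp del: mem_strip\<close>)+
  then show ?thesis
    unfolding evolves_def
    using evolvesD(1)[OF f] evolvesD(1)[OF g] evolvesD(2)[OF f] evolvesD(2)[OF g]
    by (auto intro!: continuous_on_diff c DERIV_diff)
qed

lemma evolves_const:
  assumes f: "C1_Omega f"
  shows "evolves t1 (\<lambda>_. f) (\<lambda>_ _. 0)"
  unfolding evolves_def
  by (intro conjI ballI f continuous_on_const DERIV_const continuous_on_compose2[OF C1_cont[OF f]]
      continuous_on_compose2[OF C1_cont1[OF f]] continuous_on_compose2[OF C1_cont2[OF f]])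
    (auto intro!: continuous_intros)

lemma evolves_integral:
  assumes f: "evolves t1 f f'" and t: "t \<in> {0..t1}"
  shows "((\<lambda>s. integral (cbox (a, 0) (b, pi)) (f s)) has_real_derivative
    integral (cbox (a, 0) (b, pi)) (f' t)) (at t within {0..t1})"
proof (rule leibniz_rule_field_derivative)
  show "f s integrable_on cbox (a, 0) (b, pi)" if "s \<in> {0..t1}" for s
    by (intro integrable_on_box C1_cont evolvesD(1)[OF f that]) auto
  show "continuous_on ({0..t1} \<times> cbox (a, 0) (b, pi)) (\<lambda>(s, x). f' s x)"
    unfolding split_beta
    by (rule continuous_on_subset[OF evolvesD(4)[OF f]]) (use cbox_subset_strip[of 0 pi a b] in auto)
  show "((\<lambda>s. f s x) has_real_derivative f' s x) (at s within {0..t1})"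
    if "s \<in> {0..t1}" "x \<in> cbox (a, 0) (b, pi)" for s x
    using that cbox_subset_strip[of 0 pi a b] by (intro evolvesD(2)[OF f]) auto
qed (use t in auto)

text \<open>The stream function carries no regularity in time. For fixed \<open>t\<close> it enters the pairing
  \<open>\<integral> u(t) \<cdot> u(s) = \<integral> \<psi>(t) \<omega>(s)\<close> as a constant; differentiating in \<open>s\<close> at \<open>s = t\<close> gives half of the
  derivative of the energy.\<close>

lemma kinetic_energy_derivative:
  assumes u: "\<And>t. t \<in> {0..t1} \<Longrightarrow> stream_flow (w t) (\<psi> t) (a t) (b t)"
    and a: "evolves t1 a a'" and b: "evolves t1 b b'" and w: "evolves t1 w w'"
    and t: "0 < t1" "t \<in> {0..t1}"
  shows "((\<lambda>s. integral cell (\<lambda>x. a s x * a s x) + integral cell (\<lambda>x. b s x * b s x)) has_real_derivative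
    2 * integral cell (\<lambda>x. \<psi> t x * w' t x)) (at t within {0..t1})"
proof -
  note s = stream_flowD[OF u[OF t(2)]]
  note ca = evolves_const[OF s(2)] and cb = evolves_const[OF s(3)] and cp = evolves_const[OF s(1)]
  define I where "I f = integral cell f" for f :: "real \<times> real \<Rightarrow> real"
  have int: "f integrable_on cell" if "C1_Omega f" for f
    by (intro integrable_on_box C1_cont that) auto
  have "((\<lambda>r. I (\<lambda>x. a t x * a r x) + I (\<lambda>x. b t x * b r x)) has_real_derivative
      I (\<lambda>x. 0 * a t x + a t x * a' t x) + I (\<lambda>x. 0 * b t x + b t x * b' t x)) (at t within {0..t1})"
    unfolding I_def
    by (intro DERIV_add evolves_integral[OF evolves_mult[OF ca a] t(2)] evolves_integral[OF evolves_mult[OF cb b] t(2)])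
  moreover have "I (\<lambda>x. a t x * a r x) + I (\<lambda>x. b t x * b r x) = I (\<lambda>x. \<psi> t x * w r x)"
    if "r \<in> {0..t1}" for r
    unfolding I_def using stream_function_parts[OF u[OF t(2)] u[OF that]] s stream_flowD[OF u[OF that]]
    by (simp add: integral_add int)
  moreover have "((\<lambda>r. I (\<lambda>x. \<psi> t x * w r x)) has_real_derivative
      I (\<lambda>x. 0 * w t x + \<psi> t x * w' t x)) (at t within {0..t1})"
    unfolding I_def by (rule evolves_integral[OF evolves_mult[OF cp w] t(2)])
  then have "((\<lambda>r. I (\<lambda>x. \<psi> t x * w r x)) has_real_derivative I (\<lambda>x. \<psi> t x * w' t x)) (at t within {0..t1})"
    by simp
  ultimately have key: "I (\<lambda>x. \<psi> t x * w' t x) = I (\<lambda>x. a t x * a' t x) + I (\<lambda>x. b t x * b' t x)"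
    using t by (intro DERIV_unique_Icc[of _ _ t 0 t1]) (auto intro: DERIV_cong_within)
  have "((\<lambda>r. I (\<lambda>x. a r x * a r x) + I (\<lambda>x. b r x * b r x)) has_real_derivative
      I (\<lambda>x. a' t x * a t x + a t x * a' t x) + I (\<lambda>x. b' t x * b t x + b t x * b' t x)) (at t within {0..t1})"
    unfolding I_def
    by (intro DERIV_add evolves_integral[OF evolves_mult[OF a a] t(2)] evolves_integral[OF evolves_mult[OF b b] t(2)])
  also have "(\<lambda>x. a' t x * a t x + a t x * a' t x) = (\<lambda>x. 2 * (a t x * a' t x))"
    by (simp add: algebra_simps)
  also have "(\<lambda>x. b' t x * b t x + b t x * b' t x) = (\<lambda>x. 2 * (b t x * b' t x))"
    by (simp add: algebra_simps)
  finally have D: "((\<lambda>r. I (\<lambda>x. a r x * a r x) + I (\<lambda>x. b r x * b r x)) has_real_derivative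
      2 * (I (\<lambda>x. a t x * a' t x) + I (\<lambda>x. b t x * b' t x))) (at t within {0..t1})"
    by (simp add: I_def)
  show ?thesis using D key by (simp add: I_def)
qed

section \<open>Uniqueness and the reflection symmetry\<close>

text \<open>The first-order content of the Boussinesq system on a compact time interval, with the velocity in
  components. It is weak enough to be visibly stable under reflection in \<open>x1\<close>, and strong enough for
  uniqueness.\<close>

definition classical_solution where
  "classical_solution t1 \<rho> \<omega> a b \<longleftrightarrow>
     evolves t1 \<rho> (\<lambda>t x. - (a t x * partial1 (\<rho> t) x + b t x * partial2 (\<rho> t) x)) \<and>
     evolves t1 \<omega> (\<lambda>t x. - (a t x * partial1 (\<omega> t) x + b t x * partial2 (\<omega> t) x) - partial1 (\<rho> t) x) \<and>
     (\<exists>a'. evolves t1 a a') \<and> (\<exists>b'. evolves t1 b b') \<and>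
     (\<forall>t\<in>{0..t1}. \<exists>\<psi>. stream_flow (\<omega> t) \<psi> (a t) (b t))"

lemma continuous_bound:
  fixes t1 :: real and f :: "real \<Rightarrow> real \<times> real \<Rightarrow> real"
  assumes "continuous_on ({0..t1} \<times> strip) (\<lambda>z. f (fst z) (snd z))"
  obtains K where "0 \<le> K" "\<And>t x. t \<in> {0..t1} \<Longrightarrow> x \<in> cell \<Longrightarrow> \<bar>f t x\<bar> \<le> K"
proof -
  have "compact ((\<lambda>z. f (fst z) (snd z)) ` ({0..t1} \<times> cell))"
    using cell_subset_strip
    by (intro compact_continuous_image continuous_on_subset[OF assms] compact_Times compact_Icc compact_cbox) auto
  then obtain K where "\<forall>y \<in> (\<lambda>z. f (fst z) (snd z)) ` ({0..t1} \<times> cell). norm y \<le> K"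
    by (meson bounded_iff compact_imp_bounded)
  then have "\<bar>f t x\<bar> \<le> max 0 K" if "t \<in> {0..t1}" "x \<in> cell" for t x
    using that by (force simp: max_def)
  then show thesis using that[of "max 0 K"] by auto
qed

text \<open>Gronwall's argument: \<open>E exp (- C t)\<close> is nonincreasing.\<close>

lemma gronwall_zero:
  fixes E :: "real \<Rightarrow> real"
  assumes d: "\<And>t. t \<in> {0..t1} \<Longrightarrow> (E has_real_derivative E' t) (at t within {0..t1})"
    and le: "\<And>t. t \<in> {0..t1} \<Longrightarrow> E' t \<le> C * E t"
    and E0: "E 0 = 0" and nonneg: "\<And>t. t \<in> {0..t1} \<Longrightarrow> 0 \<le> E t" and t: "t \<in> {0..t1}"
  shows "E t = 0"
proof (cases "t = 0")
  case False
  with t have "0 < t" by auto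
  have d': "((\<lambda>s. E s * exp (- C * s)) has_real_derivative (E' s - C * E s) * exp (- C * s))
      (at s within {0..t1})" if "s \<in> {0..t1}" for s
    by (rule derivative_eq_intros d that refl)+ (simp add: algebra_simps)
  have "E t * exp (- C * t) \<le> E 0 * exp (- C * 0)"
  proof (rule DERIV_nonpos_imp_decreasing_open[OF \<open>0 < t\<close>[THEN less_imp_le]])
    fix s assume s: "0 < s" "s < t"
    then have "at s within {0..t1} = at s" using t by (intro at_within_Icc_at) auto
    then have "((\<lambda>s. E s * exp (- C * s)) has_real_derivative (E' s - C * E s) * exp (- C * s)) (at s)"
      using d'[of s] s t by simp
    moreover have "(E' s - C * E s) * exp (- C * s) \<le> 0"
      using le[of s] s t by (simp add: mult_nonpos_nonneg)
    ultimately show "\<exists>y. ((\<lambda>s. E s * exp (- C * s)) has_real_derivative y) (at s) \<and> y \<le> 0"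
      by blast
  next
    show "continuous_on {0..t} (\<lambda>s. E s * exp (- C * s))"
      using t by (intro continuous_on_subset[OF DERIV_continuous_on[OF d']]) auto
  qed
  then have "E t \<le> 0"
    by (simp add: E0 mult_le_0_iff)
  with nonneg[OF t] show ?thesis by simp
qed (simp add: E0)

text \<open>Every product is split by \<open>2 x y \<le> x\<^sup>2 + y\<^sup>2\<close>. The \<open>q\<close> stand for the gradient of the velocity, the \<open>r\<close>
  for the gradient of the density.\<close>

lemma difference_energy_bound:
  fixes A B R K q11 q12 q21 q22 r1 r2 :: real
  assumes "0 \<le> K" "\<bar>q11\<bar> \<le> K" "\<bar>q12\<bar> \<le> K" "\<bar>q21\<bar> \<le> K" "\<bar>q22\<bar> \<le> K" "\<bar>r1\<bar> \<le> K" "\<bar>r2\<bar> \<le> K"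
  shows "2 * (- (A * A * q11 + A * B * q12 + B * A * q21 + B * B * q22) - B * R) -
      2 * (R * (A * r1 + B * r2)) \<le> (5 * K + 1) * (A * A + B * B + R * R)"
proof -
  have m: "- (x * y * q) \<le> K * (x * x + y * y) / 2" if "\<bar>q\<bar> \<le> K" for x y q :: real
  proof -
    have "- (x * y * q) \<le> \<bar>x * y\<bar> * \<bar>q\<bar>" by (metis abs_ge_minus_self abs_mult)
    also have "\<dots> \<le> \<bar>x * y\<bar> * K" using that by (intro mult_left_mono) auto
    also have "\<dots> \<le> ((x * x + y * y) / 2) * K"
    proof (rule mult_right_mono[OF _ assms(1)])
      have "0 \<le> (\<bar>x\<bar> - \<bar>y\<bar>)\<^sup>2" by simp
      then show "\<bar>x * y\<bar> \<le> (x * x + y * y) / 2"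
        by (simp add: power2_diff abs_mult power2_eq_square[symmetric])
    qed
    finally show ?thesis by (simp add: mult.commute)
  qed
  have br: "- (B * R) \<le> (B * B + R * R) / 2"
    using sum_squares_ge_zero[of "B + R" 0] by (simp add: algebra_simps)
  have "2 * (- (A * A * q11 + A * B * q12 + B * A * q21 + B * B * q22) - B * R) -
      2 * (R * (A * r1 + B * r2)) \<le> 5 * K * (A * A + B * B) + 2 * K * (R * R) + (B * B + R * R)"
    using m[OF assms(2), of A A] m[OF assms(3), of A B] m[OF assms(4), of B A] m[OF assms(5), of B B]
      m[OF assms(6), of R A] m[OF assms(7), of R B] br
    by (simp add: algebra_simps)
  also have "\<dots> = (5 * K + 1) * (A * A + B * B + R * R) - (A * A + 3 * (K * (R * R)))"
    by (simp add: algebra_simps)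
  also have "\<dots> \<le> (5 * K + 1) * (A * A + B * B + R * R)"
    using mult_nonneg_nonneg[OF assms(1), of "R * R"] zero_le_square[of A] zero_le_square[of R] by linarith
  finally show ?thesis .
qed

text \<open>The differences \<open>U = (A, B)\<close> of the velocities and \<open>R\<close> of the densities are estimated through
  \<open>\<integral> |U|\<^sup>2 + R\<^sup>2\<close>. An estimate of the vorticity difference \<open>W\<close> itself would lose a derivative of \<open>R\<close> in the
  buoyancy term; tested with the stream function this term becomes \<open>B R\<close>, and the transport of \<open>W\<close>
  becomes quadratic in \<open>U\<close> by \<open>vorticity_momentum\<close>.\<close>

lemma classical_solution_unique:
  assumes 1: "classical_solution t1 \<rho>1 \<omega>1 a1 b1" and 2: "classical_solution t1 \<rho>2 \<omega>2 a2 b2"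
    and t1: "0 < t1"
    and init: "\<And>x. x \<in> strip \<Longrightarrow> \<rho>1 0 x = \<rho>2 0 x" "\<And>x. x \<in> strip \<Longrightarrow> \<omega>1 0 x = \<omega>2 0 x"
    and t: "t \<in> {0..t1}" and x: "x \<in> cell"
  shows "a1 t x = a2 t x"
proof -
  let ?I = "{0..t1}"
  define R where "R = (\<lambda>t x. \<rho>1 t x - \<rho>2 t x)"
  define W where "W = (\<lambda>t x. \<omega>1 t x - \<omega>2 t x)"
  define A where "A = (\<lambda>t x. a1 t x - a2 t x)"
  define B where "B = (\<lambda>t x. b1 t x - b2 t x)"
  note c1 = 1[unfolded classical_solution_def] and c2 = 2[unfolded classical_solution_def]
  have r1: "evolves t1 \<rho>1 (\<lambda>t x. - (a1 t x * partial1 (\<rho>1 t) x + b1 t x * partial2 (\<rho>1 t) x))"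
    and r2: "evolves t1 \<rho>2 (\<lambda>t x. - (a2 t x * partial1 (\<rho>2 t) x + b2 t x * partial2 (\<rho>2 t) x))"
    and w1: "evolves t1 \<omega>1 (\<lambda>t x. - (a1 t x * partial1 (\<omega>1 t) x + b1 t x * partial2 (\<omega>1 t) x) - partial1 (\<rho>1 t) x)"
    and w2: "evolves t1 \<omega>2 (\<lambda>t x. - (a2 t x * partial1 (\<omega>2 t) x + b2 t x * partial2 (\<omega>2 t) x) - partial1 (\<rho>2 t) x)"
    using c1 c2 by blast+
  obtain a1' a2' b1' b2' where e: "evolves t1 a1 a1'" "evolves t1 a2 a2'" "evolves t1 b1 b1'" "evolves t1 b2 b2'"
    using c1 c2 by blast
  obtain \<psi>1 where s1: "\<And>t. t \<in> ?I \<Longrightarrow> stream_flow (\<omega>1 t) (\<psi>1 t) (a1 t) (b1 t)"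
    using c1 by metis
  obtain \<psi>2 where s2: "\<And>t. t \<in> ?I \<Longrightarrow> stream_flow (\<omega>2 t) (\<psi>2 t) (a2 t) (b2 t)"
    using c2 by metis
  define \<Psi> where "\<Psi> = (\<lambda>t x. \<psi>1 t x - \<psi>2 t x)"
  have s: "stream_flow (W t) (\<Psi> t) (A t) (B t)" if "t \<in> ?I" for t
    unfolding W_def \<Psi>_def A_def B_def by (rule stream_flow_minus[OF s1[OF that] s2[OF that]])
  note eA = evolves_minus[OF e(1,2), folded A_def] and eB = evolves_minus[OF e(3,4), folded B_def]
    and eR = evolves_minus[OF r1 r2, folded R_def] and eW = evolves_minus[OF w1 w2, folded W_def]
  define W' where "W' = (\<lambda>t x. - (a1 t x * partial1 (\<omega>1 t) x + b1 t x * partial2 (\<omega>1 t) x) - partial1 (\<rho>1 t) x -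
      (- (a2 t x * partial1 (\<omega>2 t) x + b2 t x * partial2 (\<omega>2 t) x) - partial1 (\<rho>2 t) x))"
  define R' where "R' = (\<lambda>t x. - (a1 t x * partial1 (\<rho>1 t) x + b1 t x * partial2 (\<rho>1 t) x) -
      - (a2 t x * partial1 (\<rho>2 t) x + b2 t x * partial2 (\<rho>2 t) x))"
  define E where "E = (\<lambda>t. integral cell (\<lambda>x. A t x * A t x) + integral cell (\<lambda>x. B t x * B t x) +
      integral cell (\<lambda>x. R t x * R t x))"
  define E' where "E' = (\<lambda>t. 2 * integral cell (\<lambda>x. \<Psi> t x * W' t x) + integral cell (\<lambda>x. R' t x * R t x + R t x * R' t x))"
  have dE: "(E has_real_derivative E' t) (at t within ?I)" if "t \<in> ?I" for t
    unfolding E_def E'_def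
    by (intro DERIV_add kinetic_energy_derivative[OF s eA eB eW[folded W'_def] t1 that]
        evolves_integral[OF evolves_mult[OF eR[folded R'_def] eR[folded R'_def]] that])
  have E_eq: "E t = integral cell (\<lambda>x. A t x * A t x + B t x * B t x + R t x * R t x)"
    and E_int: "(\<lambda>x. A t x * A t x + B t x * B t x + R t x * R t x) integrable_on cell"
    and E_cont: "continuous_on cell (\<lambda>x. A t x * A t x + B t x * B t x + R t x * R t x)"
    if "t \<in> ?I" for t
  proof -
    have C: "C1_Omega (A t)" "C1_Omega (B t)" "C1_Omega (R t)"
      using evolvesD(1) eA eB eR that by blast+
    have i: "f integrable_on cell" if "C1_Omega f" for f
      by (intro integrable_on_box C1_cont that) auto
    show "E t = integral cell (\<lambda>x. A t x * A t x + B t x * B t x + R t x * R t x)"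
      unfolding E_def using C by (simp add: integral_add i)
    show "(\<lambda>x. A t x * A t x + B t x * B t x + R t x * R t x) integrable_on cell"
      using C by (intro i) auto
    show "continuous_on cell (\<lambda>x. A t x * A t x + B t x * B t x + R t x * R t x)"
      using C by (intro continuous_on_subset[OF C1_cont cell_subset_strip]) auto
  qed
  obtain K1 where K1: "0 \<le> K1" "\<And>t x. t \<in> ?I \<Longrightarrow> x \<in> cell \<Longrightarrow> \<bar>partial1 (a1 t) x\<bar> \<le> K1"
    using continuous_bound[OF evolvesD(5)[OF e(1)]] by blast
  obtain K2 where K2: "0 \<le> K2" "\<And>t x. t \<in> ?I \<Longrightarrow> x \<in> cell \<Longrightarrow> \<bar>partial2 (a1 t) x\<bar> \<le> K2"
    using continuous_bound[OF evolvesD(6)[OF e(1)]] by blast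
  obtain K3 where K3: "0 \<le> K3" "\<And>t x. t \<in> ?I \<Longrightarrow> x \<in> cell \<Longrightarrow> \<bar>partial1 (b1 t) x\<bar> \<le> K3"
    using continuous_bound[OF evolvesD(5)[OF e(3)]] by blast
  obtain K4 where K4: "0 \<le> K4" "\<And>t x. t \<in> ?I \<Longrightarrow> x \<in> cell \<Longrightarrow> \<bar>partial2 (b1 t) x\<bar> \<le> K4"
    using continuous_bound[OF evolvesD(6)[OF e(3)]] by blast
  obtain K5 where K5: "0 \<le> K5" "\<And>t x. t \<in> ?I \<Longrightarrow> x \<in> cell \<Longrightarrow> \<bar>partial1 (\<rho>2 t) x\<bar> \<le> K5"
    using continuous_bound[OF evolvesD(5)[OF r2]] by blast
  obtain K6 where K6: "0 \<le> K6" "\<And>t x. t \<in> ?I \<Longrightarrow> x \<in> cell \<Longrightarrow> \<bar>partial2 (\<rho>2 t) x\<bar> \<le> K6"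
    using continuous_bound[OF evolvesD(6)[OF r2]] by blast
  define K where "K = K1 + K2 + K3 + K4 + K5 + K6"
  have K: "0 \<le> K" "K1 \<le> K" "K2 \<le> K" "K3 \<le> K" "K4 \<le> K" "K5 \<le> K" "K6 \<le> K"
    using K1 K2 K3 K4 K5 K6 by (auto simp: K_def)
  have le: "E' t \<le> (5 * K + 1) * E t" if t: "t \<in> ?I" for t
  proof -
    note f = stream_flowD[OF s[OF t]] and f1 = stream_flowD[OF s1[OF t]] and f2 = stream_flowD[OF s2[OF t]]
    have C: "C1_Omega (R t)" "C1_Omega (W t)" "C1_Omega (\<rho>1 t)" "C1_Omega (\<rho>2 t)" "C1_Omega (\<omega>1 t)" "C1_Omega (\<omega>2 t)"
      using evolvesD(1) eR eW r1 r2 w1 w2 t by blast+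
    note c = C1_cont[OF f(1)] C1_cont[OF f(2)] C1_cont[OF f(3)] C1_cont[OF C(1)] C1_cont[OF C(2)]
      C1_cont[OF f1(2)] C1_cont[OF f1(3)] C1_cont1[OF C(1)] C1_cont2[OF C(1)]
      C1_cont1[OF C(2)] C1_cont2[OF C(2)] C1_cont1[OF C(6)] C1_cont2[OF C(6)] C1_cont[OF C(6)]
      C1_cont1[OF C(4)] C1_cont2[OF C(4)] C1_cont1[OF f1(2)] C1_cont2[OF f1(2)] C1_cont1[OF f1(3)] C1_cont2[OF f1(3)]
    have dR: "partial1 (R t) x = partial1 (\<rho>1 t) x - partial1 (\<rho>2 t) x"
      "partial2 (R t) x = partial2 (\<rho>1 t) x - partial2 (\<rho>2 t) x"
      "partial1 (W t) x = partial1 (\<omega>1 t) x - partial1 (\<omega>2 t) x"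
      "partial2 (W t) x = partial2 (\<omega>1 t) x - partial2 (\<omega>2 t) x" if "x \<in> strip" for x
      using C that by (simp_all add: R_def W_def)
    \<comment> \<open>advection of W by u1 and of omega2 by U, buoyancy, advection of R by u1 and of rho2 by U; the second and the fourth term integrate to zero\<close>
    let ?T1 = "\<lambda>x. \<Psi> t x * (a1 t x * partial1 (W t) x + b1 t x * partial2 (W t) x)"
    let ?T2 = "\<lambda>x. \<Psi> t x * (A t x * partial1 (\<omega>2 t) x + B t x * partial2 (\<omega>2 t) x)"
    let ?T3 = "\<lambda>x. \<Psi> t x * partial1 (R t) x"
    let ?T4 = "\<lambda>x. R t x * (a1 t x * partial1 (R t) x + b1 t x * partial2 (R t) x)"
    let ?T5 = "\<lambda>x. R t x * (A t x * partial1 (\<rho>2 t) x + B t x * partial2 (\<rho>2 t) x)"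
    let ?Q = "\<lambda>x. A t x * A t x * partial1 (a1 t) x + A t x * B t x * partial2 (a1 t) x +
        B t x * A t x * partial1 (b1 t) x + B t x * B t x * partial2 (b1 t) x"
    let ?BR = "\<lambda>x. B t x * R t x"
    have int: "?T1 integrable_on cell" "?T2 integrable_on cell" "?T3 integrable_on cell"
        "?T4 integrable_on cell" "?T5 integrable_on cell" "?Q integrable_on cell" "?BR integrable_on cell"
      by (intro integrable_on_box continuous_intros c; simp)+
    have "integral cell (\<lambda>x. \<Psi> t x * W' t x) = integral cell (\<lambda>x. - ?T1 x - ?T2 x - ?T3 x)"
      by (rule integral_cong)
        (use cell_subset_strip in \<open>auto simp: subset_iff dR W'_def A_def B_def algebra_simps simp del: mem_strip\<close>)
    also have "\<dots> = - integral cell ?T1 - integral cell ?T2 - integral cell ?T3"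
      using int by (simp add: integral_diff integrable_diff integrable_neg)
    also have "integral cell ?T1 = integral cell ?Q"
      using transport_parts[OF s1[OF t] C(2) f(1)] vorticity_momentum[OF s[OF t] s1[OF t]] by simp
    also have "integral cell ?T2 = - integral cell (\<lambda>x. \<omega>2 t x * (A t x * partial1 (\<Psi> t) x + B t x * partial2 (\<Psi> t) x))"
      by (rule transport_parts[OF s[OF t] C(6) f(1)])
    also have "\<dots> = - integral cell (\<lambda>x. 0)"
      by (intro arg_cong[where f=uminus] integral_cong)
        (use cell_subset_strip f in \<open>auto simp: subset_iff simp del: mem_strip\<close>)
    also have "integral cell ?T3 = integral cell ?BR"
    proof -
      have "integral cell (\<lambda>x. ?T3 x - ?BR x) = 0"
        by (rule cell_divergence[where g="\<lambda>x. \<Psi> t x * R t x" and h="\<lambda>_. 0"]) (use f C in simp_all)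
      then show ?thesis by (simp add: integral_diff int)
    qed
    finally have kin: "integral cell (\<lambda>x. \<Psi> t x * W' t x) = - integral cell ?Q - integral cell ?BR"
      by simp
    have "integral cell (\<lambda>x. R' t x * R t x + R t x * R' t x) = integral cell (\<lambda>x. 2 * (- ?T4 x - ?T5 x))"
      by (rule integral_cong)
        (use cell_subset_strip in \<open>auto simp: subset_iff dR R'_def A_def B_def algebra_simps simp del: mem_strip\<close>)
    also have "\<dots> = 2 * (- integral cell ?T4 - integral cell ?T5)"
      using int by (simp add: integral_diff integrable_diff integrable_neg del: right_diff_distrib_numeral)
    also have "integral cell ?T4 = 0"
      using transport_parts[OF s1[OF t] C(1) C(1)] by simp
    finally have pot: "integral cell (\<lambda>x. R' t x * R t x + R t x * R' t x) = - 2 * integral cell ?T5"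
      by simp
    have "((\<lambda>x. 2 * (- ?Q x - ?BR x) - 2 * ?T5 x) has_integral
        (2 * (- integral cell ?Q - integral cell ?BR) - 2 * integral cell ?T5)) cell"
      by (intro has_integral_diff has_integral_mult_right has_integral_neg integrable_integral int)
    then have "E' t = integral cell (\<lambda>x. 2 * (- ?Q x - ?BR x) - 2 * ?T5 x)"
      unfolding E'_def kin pot by (subst integral_unique) auto
    also have "\<dots> \<le> integral cell (\<lambda>x. (5 * K + 1) * (A t x * A t x + B t x * B t x + R t x * R t x))"
    proof (rule integral_le)
      show "(\<lambda>x. 2 * (- ?Q x - ?BR x) - 2 * ?T5 x) integrable_on cell"
        using int by (intro integrable_diff integrable_neg integrable_on_mult_right) auto
      show "(\<lambda>x. (5 * K + 1) * (A t x * A t x + B t x * B t x + R t x * R t x)) integrable_on cell"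
        by (intro integrable_on_mult_right E_int t)
      fix x assume x: "x \<in> cell"
      show "2 * (- ?Q x - ?BR x) - 2 * ?T5 x \<le> (5 * K + 1) * (A t x * A t x + B t x * B t x + R t x * R t x)"
        by (rule difference_energy_bound)
          (use K K1(2)[OF t x] K2(2)[OF t x] K3(2)[OF t x] K4(2)[OF t x] K5(2)[OF t x] K6(2)[OF t x] in auto)
    qed
    also have "\<dots> = (5 * K + 1) * E t"
      by (simp add: E_eq[OF t])
    finally show ?thesis .
  qed
  have nonneg: "0 \<le> E t" if "t \<in> ?I" for t
    unfolding E_eq[OF that] by (rule integral_nonneg[OF E_int[OF that]]) simp
  have E0: "E 0 = 0"
  proof -
    have 0: "0 \<in> ?I" using t1 by simp
    note f = stream_flowD[OF s[OF 0]]
    have i: "f integrable_on cell" if "C1_Omega f" for f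
      by (intro integrable_on_box C1_cont that) auto
    have "integral cell (\<lambda>x. A 0 x * A 0 x) + integral cell (\<lambda>x. B 0 x * B 0 x) = integral cell (\<lambda>x. \<Psi> 0 x * W 0 x)"
      using stream_function_parts[OF s[OF 0] s[OF 0]] f by (simp add: integral_add i)
    also have "\<dots> = integral cell (\<lambda>x. 0)"
      by (rule integral_cong) (use init cell_subset_strip in \<open>auto simp: W_def subset_iff simp del: mem_strip\<close>)
    finally have "integral cell (\<lambda>x. A 0 x * A 0 x) + integral cell (\<lambda>x. B 0 x * B 0 x) = 0" by simp
    moreover have "integral cell (\<lambda>x. R 0 x * R 0 x) = integral cell (\<lambda>x. 0)"
      by (rule integral_cong) (use init cell_subset_strip in \<open>auto simp: R_def subset_iff simp del: mem_strip\<close>)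
    ultimately show ?thesis by (simp add: E_def)
  qed
  have "E t = 0"
    by (rule gronwall_zero[OF dE le E0 nonneg t])
  then have int0: "((\<lambda>x. A t x * A t x + B t x * B t x + R t x * R t x) has_integral 0) cell"
    using integrable_integral[OF E_int[OF t]] unfolding E_eq[OF t, symmetric] by simp
  have "A t x * A t x + B t x * B t x + R t x * R t x = 0"
    by (rule has_integral_0_cbox_imp_0[OF E_cont[OF t] _ int0]) (use x in \<open>auto simp: box_ne_empty Basis_prod_def\<close>)
  then have "A t x * A t x = 0"
    using zero_le_square[of "A t x"] zero_le_square[of "B t x"] zero_le_square[of "R t x"] by linarith
  then show ?thesis by (simp add: A_def)
qed

abbreviation mirror :: "real \<times> real \<Rightarrow> real \<times> real" where "mirror x \<equiv> (- fst x, snd x)"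

lemma C1_mirror:
  assumes f: "C1_Omega f"
  shows "C1_Omega (\<lambda>x. f (mirror x)) \<and> (\<forall>x\<in>strip.
    partial1 (\<lambda>x. f (mirror x)) x = - partial1 f (mirror x) \<and>
    partial2 (\<lambda>x. f (mirror x)) x = partial2 f (mirror x))"
proof (rule C1_OmegaI)
  have im: "mirror ` strip \<subseteq> strip" by (auto simp: strip_def)
  have "mirror differentiable_on strip"
    unfolding differentiable_on_def differentiable_def by (auto intro!: derivative_eq_intros exI)
  moreover have "f differentiable_on mirror ` strip"
    using f im by (auto simp: C1_Omega_def intro: differentiable_on_subset)
  ultimately show "(\<lambda>x. f (mirror x)) differentiable_on strip"
    using differentiable_on_compose[of mirror strip f] by blast
  show "x1_periodic (\<lambda>x. f (mirror x))"
    using C1_periodic[OF f, of _ "- x - 2 * pi" for x] by (auto simp: x1_periodic_def)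
  fix x y :: real assume y: "0 \<le> y" "y \<le> pi"
  have "((\<lambda>a. f (- a, y)) has_real_derivative partial1 f (- x, y) * - 1) (at x)"
    by (rule DERIV_chain2[where f="\<lambda>a. f (a, y)"]) (auto intro!: C1_DERIV1 f y derivative_eq_intros)
  then show "((\<lambda>a. f (mirror (a, y))) has_real_derivative - partial1 f (mirror (x, y))) (at x)"
    by simp
  show "((\<lambda>b. f (mirror (x, b))) has_real_derivative partial2 f (mirror (x, y))) (at y within {0..pi})"
    using C1_DERIV2[OF f y, of "- x"] by simp
next
  show "continuous_on strip (\<lambda>x. - partial1 f (mirror x))" "continuous_on strip (\<lambda>x. partial2 f (mirror x))"
    by (intro continuous_on_minus continuous_on_compose2[OF C1_cont1[OF f]]
        continuous_on_compose2[OF C1_cont2[OF f]]; auto intro!: continuous_intros simp: strip_def)+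
qed

lemma evolves_cong:
  assumes "evolves t1 f f'" "\<And>t x. t \<in> {0..t1} \<Longrightarrow> x \<in> strip \<Longrightarrow> g' t x = f' t x"
  shows "evolves t1 f g'"
proof -
  have "continuous_on ({0..t1} \<times> strip) (\<lambda>z. g' (fst z) (snd z))"
    by (rule continuous_on_eq[OF evolvesD(4)[OF assms(1)]]) (use assms(2) in auto)
  then show ?thesis using assms by (auto simp: evolves_def)
qed

text \<open>Composition in space with a map of the strip that preserves \<open>C1_Omega\<close>; the factors
  \<open>p\<close> and \<open>q\<close> come from the chain rule.\<close>

lemma evolves_compose:
  assumes f: "evolves t1 f f'"
    and m: "continuous_on strip m" "m ` strip \<subseteq> strip"
    and C: "\<And>g. C1_Omega g \<Longrightarrow> C1_Omega (\<lambda>x. g (m x)) \<and> (\<forall>x\<in>strip.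
      partial1 (\<lambda>x. g (m x)) x = p * partial1 g (m x) \<and> partial2 (\<lambda>x. g (m x)) x = q * partial2 g (m x))"
  shows "evolves t1 (\<lambda>t x. f t (m x)) (\<lambda>t x. f' t (m x))"
proof -
  have "continuous_on ({0..t1} \<times> strip) (\<lambda>z. (fst z, m (snd z)))"
    by (intro continuous_intros continuous_on_compose2[OF m(1)]) auto
  then have cc: "continuous_on ({0..t1} \<times> strip) (\<lambda>z. h (fst z) (m (snd z)))"
    if "continuous_on ({0..t1} \<times> strip) (\<lambda>z. h (fst z) (snd z))" for h :: "real \<Rightarrow> real \<times> real \<Rightarrow> real"
    by (rule continuous_on_compose2[OF that, of "{0..t1} \<times> strip" "\<lambda>z. (fst z, m (snd z))", simplified])
      (use m(2) in auto)
  have CC: "C1_Omega (\<lambda>x. f t (m x))" "\<forall>x\<in>strip. partial1 (\<lambda>x. f t (m x)) x = p * partial1 (f t) (m x) \<and>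
      partial2 (\<lambda>x. f t (m x)) x = q * partial2 (f t) (m x)" if "t \<in> {0..t1}" for t
    using C[OF evolvesD(1)[OF f that]] by blast+
  have "continuous_on ({0..t1} \<times> strip) (\<lambda>z. partial1 (\<lambda>x. f (fst z) (m x)) (snd z))"
    by (rule continuous_on_eq[OF continuous_on_mult[OF continuous_on_const[of _ p] cc[OF evolvesD(5)[OF f]]]])
      (use CC in \<open>auto simp del: mem_strip\<close>)
  moreover have "continuous_on ({0..t1} \<times> strip) (\<lambda>z. partial2 (\<lambda>x. f (fst z) (m x)) (snd z))"
    by (rule continuous_on_eq[OF continuous_on_mult[OF continuous_on_const[of _ q] cc[OF evolvesD(6)[OF f]]]])
      (use CC in \<open>auto simp del: mem_strip\<close>)
  ultimately show ?thesis
    unfolding evolves_def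
    using CC cc[OF evolvesD(3)[OF f]] cc[OF evolvesD(4)[OF f]] evolvesD(2)[OF f] m(2)
    by (auto simp: image_subset_iff simp del: mem_strip)
qed

lemma evolves_mirror:
  assumes "evolves t1 f f'" shows "evolves t1 (\<lambda>t x. f t (mirror x)) (\<lambda>t x. f' t (mirror x))"
  by (rule evolves_compose[OF assms, where p="-1" and q=1])
    (use C1_mirror in \<open>auto intro!: continuous_intros simp: strip_def\<close>)

lemma evolves_uminus:
  assumes f: "evolves t1 f f'" shows "evolves t1 (\<lambda>t x. - f t x) (\<lambda>t x. - f' t x)"
  using evolves_minus[OF evolves_const[OF C1_const[of 0]] f] by simp

lemma stream_flow_mirror:
  assumes "stream_flow w \<psi> a b"
  shows "stream_flow (\<lambda>x. - w (mirror x)) (\<lambda>x. - \<psi> (mirror x)) (\<lambda>x. - a (mirror x)) (\<lambda>x. b (mirror x))"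
proof -
  note s = stream_flowD[OF assms]
  note m = C1_mirror[OF s(1)] C1_mirror[OF s(2)] C1_mirror[OF s(3)]
  have "mirror x \<in> strip" if "x \<in> strip" for x using that by (auto simp: strip_def)
  then show ?thesis
    unfolding stream_flow_def using m s by (auto simp del: mem_strip split_paired_All)
qed

lemma classical_solution_mirror:
  assumes "classical_solution t1 \<rho> \<omega> a b"
  shows "classical_solution t1 (\<lambda>t x. \<rho> t (mirror x)) (\<lambda>t x. - \<omega> t (mirror x))
    (\<lambda>t x. - a t (mirror x)) (\<lambda>t x. b t (mirror x))"
proof -
  note c = assms[unfolded classical_solution_def]
  have r: "evolves t1 \<rho> (\<lambda>t x. - (a t x * partial1 (\<rho> t) x + b t x * partial2 (\<rho> t) x))"
    and w: "evolves t1 \<omega> (\<lambda>t x. - (a t x * partial1 (\<omega> t) x + b t x * partial2 (\<omega> t) x) - partial1 (\<rho> t) x)"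
    using c by blast+
  have C: "C1_Omega (\<rho> t)" "C1_Omega (\<omega> t)" if "t \<in> {0..t1}" for t
    using evolvesD(1) r w that by blast+
  show ?thesis unfolding classical_solution_def
  proof (intro conjI ballI)
    show "evolves t1 (\<lambda>t x. \<rho> t (mirror x)) (\<lambda>t x. - (- a t (mirror x) * partial1 (\<lambda>x. \<rho> t (mirror x)) x +
        b t (mirror x) * partial2 (\<lambda>x. \<rho> t (mirror x)) x))"
      by (rule evolves_cong[OF evolves_mirror[OF r]]) (use C1_mirror C in \<open>auto simp del: mem_strip\<close>)
    show "evolves t1 (\<lambda>t x. - \<omega> t (mirror x)) (\<lambda>t x. - (- a t (mirror x) * partial1 (\<lambda>x. - \<omega> t (mirror x)) x +
        b t (mirror x) * partial2 (\<lambda>x. - \<omega> t (mirror x)) x) - partial1 (\<lambda>x. \<rho> t (mirror x)) x)"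
      by (rule evolves_cong[OF evolves_uminus[OF evolves_mirror[OF w]]])
        (use C1_mirror C in \<open>auto simp del: mem_strip\<close>)
    show "\<exists>a'. evolves t1 (\<lambda>t x. - a t (mirror x)) a'" "\<exists>b'. evolves t1 (\<lambda>t x. b t (mirror x)) b'"
      using c evolves_uminus evolves_mirror by blast+
    show "\<exists>\<psi>. stream_flow (\<lambda>x. - \<omega> t (mirror x)) \<psi> (\<lambda>x. - a t (mirror x)) (\<lambda>x. b t (mirror x))"
      if "t \<in> {0..t1}" for t
      using c stream_flow_mirror that by meson
  qed
qed

text \<open>The mirror image of a solution with symmetric data has the same data, hence by uniqueness the
  same velocity: \<open>a\<close> is odd in \<open>x1\<close>, and with periodicity it vanishes on \<open>x1 = 0\<close> and \<open>x1 = \<pi>\<close>.\<close>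

lemma no_flow_through_sides:
  assumes c: "classical_solution t1 \<rho> \<omega> a b" and "0 < t1"
    and init: "\<And>x. x \<in> strip \<Longrightarrow> \<rho> 0 (mirror x) = \<rho> 0 x" "\<And>x. x \<in> strip \<Longrightarrow> \<omega> 0 (mirror x) = - \<omega> 0 x"
    and t: "t \<in> {0..t1}" and y: "0 \<le> y" "y \<le> pi"
  shows "a t (0, y) = 0" "a t (pi, y) = 0"
proof -
  have odd: "a t x = - a t (mirror x)" if "x \<in> cell" for x
    by (rule classical_solution_unique[OF c classical_solution_mirror[OF c] \<open>0 < t1\<close> _ _ t that])
      (use init in auto)
  have "C1_Omega (a t)"
    using c t by (auto simp: classical_solution_def dest: evolvesD(1))
  from C1_periodic[OF this y, of "- pi"] odd[of "(0, y)"] odd[of "(pi, y)"] y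
  show "a t (0, y) = 0" "a t (pi, y) = 0" by auto
qed

section \<open>The maximum principle for transport equations\<close>

lemma periodic_reduce:
  assumes f: "C1_Omega f" and y: "0 \<le> y" "y \<le> pi"
  obtains x' where "x' \<in> {-pi..pi}" "f (x', y) = f (x, y)"
proof -
  have n: "f (x + 2 * pi * real n, y) = f (x, y)" for x n
  proof (induction n)
    case (Suc n)
    then show ?case using C1_periodic[OF f y, of "x + 2 * pi * real n"] by (simp add: algebra_simps)
  qed simp
  have z: "f (x + 2 * pi * of_int k, y) = f (x, y)" for k
  proof (cases "0 \<le> k")
    case True
    then show ?thesis using n[of x "nat k"] by simp
  next
    case False
    then show ?thesis using n[of "x + 2 * pi * of_int k" "nat (- k)"] by simp
  qed
  define k where "k = \<lfloor>(x + pi) / (2 * pi)\<rfloor>"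
  have "of_int k \<le> (x + pi) / (2 * pi)" "(x + pi) / (2 * pi) < of_int k + 1"
    unfolding k_def by linarith+
  then have "of_int k * (2 * pi) \<le> x + pi" "x + pi < (of_int k + 1) * (2 * pi)"
    by (simp_all add: field_simps)
  then have "x + 2 * pi * of_int (- k) \<in> {-pi..pi}" by (simp add: algebra_simps)
  then show thesis using that z[of "- k"] by blast
qed

text \<open>Consider a maximum point of \<open>f - (G + e) t\<close> over \<open>[0, t1]\<close> and one period. The advection term vanishes
  there: the horizontal derivative is zero, and so is the vertical derivative unless the point lies on
  a wall, where the vertical velocity is zero. So at a positive time the time derivative would be at
  most \<open>G - (G + e) < 0\<close>, and slightly earlier values would be larger. Hence the maximum is attained at
  time zero. This argument works along points, without following trajectories.\<close>

lemma transport_max_principle: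
  assumes f: "evolves t1 f (\<lambda>t x. - (a t x * partial1 (f t) x + b t x * partial2 (f t) x) + g t x)"
    and walls: "\<And>t x. t \<in> {0..t1} \<Longrightarrow> b t (x, 0) = 0 \<and> b t (x, pi) = 0"
    and g: "\<And>t x. t \<in> {0..t1} \<Longrightarrow> x \<in> cell \<Longrightarrow> g t x \<le> G"
    and M: "\<And>x. x \<in> cell \<Longrightarrow> f 0 x \<le> M"
    and t: "t \<in> {0..t1}" and x: "x \<in> strip"
  shows "f t x \<le> M + G * t"
proof -
  have eps: "f t x \<le> M + (G + e) * t" if e: "0 < e" for e
  proof -
    let ?h = "\<lambda>z. f (fst z) (snd z) - (G + e) * fst z"
    have "compact ({0..t1} \<times> cell)" by (intro compact_Times compact_Icc compact_cbox)
    moreover have "(t, 0, 0) \<in> {0..t1} \<times> cell" using t by simp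
    then have "{0..t1} \<times> cell \<noteq> {}" by blast
    moreover have "continuous_on ({0..t1} \<times> cell) ?h"
      by (intro continuous_intros continuous_on_subset[OF evolvesD(3)[OF f]])
        (use cell_subset_strip in auto)
    ultimately have "\<exists>z\<in>{0..t1} \<times> cell. \<forall>z'\<in>{0..t1} \<times> cell. ?h z' \<le> ?h z"
      by (intro continuous_attains_sup)
    then obtain z where z: "z \<in> {0..t1} \<times> cell" and max: "\<And>z'. z' \<in> {0..t1} \<times> cell \<Longrightarrow> ?h z' \<le> ?h z"
      by blast
    obtain s x0 y0 where z_eq: "z = (s, x0, y0)" by (cases z)
    have s: "s \<in> {0..t1}" and xy: "(x0, y0) \<in> cell" and y0: "0 \<le> y0" "y0 \<le> pi"
      using z z_eq by auto
    have C: "C1_Omega (f r)" if "r \<in> {0..t1}" for r by (rule evolvesD(1)[OF f that])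
    have gmax: "f s (x1, y1) \<le> f s (x0, y0)" if y1: "0 \<le> y1" "y1 \<le> pi" for x1 y1
    proof -
      obtain x' where "x' \<in> {-pi..pi}" "f s (x', y1) = f s (x1, y1)"
        by (rule periodic_reduce[OF C[OF s] y1])
      then show ?thesis using max[of "(s, x', y1)"] s y1 z_eq by auto
    qed
    have "s = 0"
    proof (rule ccontr)
      assume "s \<noteq> 0"
      with s have "0 < s" by auto
      have p1: "partial1 (f s) (x0, y0) = 0"
        by (rule DERIV_local_max[OF C1_DERIV1[OF C[OF s] y0] zero_less_one]) (use gmax y0 in auto)
      have p2: "b s (x0, y0) * partial2 (f s) (x0, y0) = 0"
      proof (cases "0 < y0 \<and> y0 < pi")
        case True
        then have "((\<lambda>b. f s (x0, b)) has_real_derivative partial2 (f s) (x0, y0)) (at y0)"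
          using C1_DERIV2[OF C[OF s] y0, of x0] by (simp add: at_within_Icc_at)
        then have "partial2 (f s) (x0, y0) = 0"
          by (rule DERIV_local_max[where d="min y0 (pi - y0)"]) (use gmax True in auto)
        then show ?thesis by simp
      next
        case False
        then have "y0 = 0 \<or> y0 = pi" using y0 by auto
        then show ?thesis using walls[OF s] by auto
      qed
      let ?d = "g s (x0, y0) - (G + e)"
      have "((\<lambda>r. f r (x0, y0) - (G + e) * r) has_real_derivative ?d) (at s within {0..t1})"
        using evolvesD(2)[OF f s, of "(x0, y0)"] y0 p1 p2
        by (auto intro!: derivative_eq_intros)
      moreover have "?d < 0" using g[OF s xy] e by auto
      ultimately obtain d where d: "0 < d" "\<And>h. 0 < h \<Longrightarrow> s - h \<in> {0..t1} \<Longrightarrow> h < d \<Longrightarrow>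
          f s (x0, y0) - (G + e) * s < f (s - h) (x0, y0) - (G + e) * (s - h)"
        using has_real_derivative_neg_dec_left by blast
      define h where "h = min (d / 2) s"
      have h: "0 < h" "h < d" "s - h \<in> {0..t1}"
        using d \<open>0 < s\<close> s by (auto simp: h_def min_def)
      have "f (s - h) (x0, y0) - (G + e) * (s - h) \<le> f s (x0, y0) - (G + e) * s"
        using max[of "(s - h, x0, y0)"] h(3) xy z_eq by simp
      with d(2)[OF h(1,3,2)] show False by simp
    qed
    obtain x1 y1 where x_eq: "x = (x1, y1)" by (cases x)
    obtain x' where x': "x' \<in> {-pi..pi}" "f t (x', y1) = f t (x1, y1)"
      using x x_eq by (metis mem_strip periodic_reduce[OF C[OF t]])
    have "f t x - (G + e) * t \<le> f 0 (x0, y0)"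
      using max[of "(t, x', y1)"] t x' x x_eq z_eq \<open>s = 0\<close> by auto
    also have "\<dots> \<le> M" by (rule M[OF xy])
    finally show ?thesis by simp
  qed
  show ?thesis
  proof (rule field_le_epsilon)
    fix d :: real assume d: "0 < d"
    have t0: "0 \<le> t" using t by simp
    \<comment> \<open>a fixed slope e would depend on t; this choice costs at most d\<close>
    have "f t x \<le> M + (G + d / (t + 1)) * t" by (rule eps) (use d t0 in auto)
    also have "\<dots> = M + G * t + d * (t / (t + 1))" using t0 by (simp add: field_simps)
    also have "d * (t / (t + 1)) \<le> d * 1" by (rule mult_left_mono) (use d t0 in auto)
    finally show "f t x \<le> M + G * t + d" by simp
  qed
qed

text \<open>A vertical line that the flow does not cross is a one-dimensional transport problem of its own:
  the density on the line, extended as a constant in \<open>x1\<close>, is transported by the vertical velocity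
  on the line.\<close>

lemma C1_column:
  assumes f: "C1_Omega f"
  shows "C1_Omega (\<lambda>x. f (c, snd x)) \<and> (\<forall>x\<in>strip.
    partial1 (\<lambda>x. f (c, snd x)) x = 0 * partial1 f (c, snd x) \<and>
    partial2 (\<lambda>x. f (c, snd x)) x = 1 * partial2 f (c, snd x))"
proof (rule C1_OmegaI)
  have im: "(\<lambda>x. (c, snd x)) ` strip \<subseteq> strip" by (auto simp: strip_def)
  have "(\<lambda>x. (c, snd x)) differentiable_on strip"
    unfolding differentiable_on_def differentiable_def by (auto intro!: derivative_eq_intros exI)
  moreover have "f differentiable_on (\<lambda>x. (c, snd x)) ` strip"
    using f im by (auto simp: C1_Omega_def intro: differentiable_on_subset)
  ultimately show "(\<lambda>x. f (c, snd x)) differentiable_on strip"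
    using differentiable_on_compose[of "\<lambda>x. (c, snd x)" strip f] by blast
  show "x1_periodic (\<lambda>x. f (c, snd x))"
    by (auto simp: x1_periodic_def)
  fix x y :: real assume y: "0 \<le> y" "y \<le> pi"
  show "((\<lambda>a. f (c, snd (a, y))) has_real_derivative 0 * partial1 f (c, snd (x, y))) (at x)"
    by simp
  show "((\<lambda>b. f (c, snd (x, b))) has_real_derivative 1 * partial2 f (c, snd (x, y))) (at y within {0..pi})"
    using C1_DERIV2[OF f y, of c] by simp
next
  show "continuous_on strip (\<lambda>x. 0 * partial1 f (c, snd x))" by simp
  show "continuous_on strip (\<lambda>x. 1 * partial2 f (c, snd x))"
    unfolding mult_1
    by (rule continuous_on_compose2[OF C1_cont2[OF f]]) (auto intro!: continuous_intros simp: strip_def)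
qed

lemma column_max_principle:
  assumes f: "evolves t1 f (\<lambda>t x. - (a t x * partial1 (f t) x + b t x * partial2 (f t) x))"
    and walls: "\<And>t x. t \<in> {0..t1} \<Longrightarrow> b t (x, 0) = 0 \<and> b t (x, pi) = 0"
    and side: "\<And>t y. t \<in> {0..t1} \<Longrightarrow> 0 \<le> y \<Longrightarrow> y \<le> pi \<Longrightarrow> a t (c, y) = 0"
    and M: "\<And>y. 0 \<le> y \<Longrightarrow> y \<le> pi \<Longrightarrow> f 0 (c, y) \<le> M"
    and t: "t \<in> {0..t1}" and y: "0 \<le> y" "y \<le> pi"
  shows "f t (c, y) \<le> M"
proof -
  have C: "C1_Omega (f t)" if "t \<in> {0..t1}" for t by (rule evolvesD(1)[OF f that])
  have e: "evolves t1 (\<lambda>t x. f t (c, snd x))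
      (\<lambda>t x. - (a t (c, snd x) * partial1 (f t) (c, snd x) + b t (c, snd x) * partial2 (f t) (c, snd x)))"
    by (rule evolves_compose[OF f, where p=0 and q=1])
      (use C1_column in \<open>auto intro!: continuous_intros simp: strip_def\<close>)
  have "(\<lambda>t x. f t (c, snd x)) t (0 :: real, y) \<le> M + 0 * t"
  proof (rule transport_max_principle[where f="\<lambda>t x. f t (c, snd x)" and a="\<lambda>_ _. 0" and b="\<lambda>t x. b t (c, snd x)" and g="\<lambda>_ _. 0"])
    show "evolves t1 (\<lambda>t x. f t (c, snd x)) (\<lambda>t x. - (0 * partial1 (\<lambda>x. f t (c, snd x)) x +
        b t (c, snd x) * partial2 (\<lambda>x. f t (c, snd x)) x) + 0)"
    proof (rule evolves_cong[OF e])
      fix t and x :: "real \<times> real" assume "t \<in> {0..t1}" "x \<in> strip"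
      then show "- (0 * partial1 (\<lambda>x. f t (c, snd x)) x + b t (c, snd x) * partial2 (\<lambda>x. f t (c, snd x)) x) + 0 =
          - (a t (c, snd x) * partial1 (f t) (c, snd x) + b t (c, snd x) * partial2 (f t) (c, snd x))"
        using C1_column[OF C, of t c] side by (cases x) auto
    qed
  qed (use walls M t y in auto)
  then show ?thesis by simp
qed

section \<open>Solutions of the Boussinesq system\<close>

text \<open>The linear map \<open>l\<close> is the identity for the density and the vorticity, and a projection for the
  components of the velocity.\<close>

lemma smooth_evolves:
  fixes F :: "real \<Rightarrow> real \<times> real \<Rightarrow> 'b::real_normed_vector" and l :: "'b \<Rightarrow> real"
  assumes smooth: "smooth_on (spacetime T) (\<lambda>(t, x). F t x)" and T: "ereal t1 < T"
    and l: "bounded_linear l" and per: "\<And>t. t \<in> {0..t1} \<Longrightarrow> x1_periodic (F t)"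
  shows "\<exists>f'. evolves t1 (\<lambda>t x. l (F t x)) f'"
proof -
  interpret l: bounded_linear l by (rule l)
  let ?S = "spacetime T" and ?G = "\<lambda>(t, x). F t x"
  define D where "D z = frechet_derivative ?G (at z within ?S)" for z
  have sub: "{0..t1} \<times> strip \<subseteq> ?S"
    using T by (auto simp: spacetime_def strip_def intro: le_less_trans[of "ereal _" "ereal t1"])
  have Ck: "Ck_on (Suc 0) ?S ?G" using smooth by (auto simp: smooth_on_def)
  have G: "(?G has_derivative D z) (at z within ?S)" if "z \<in> ?S" for z
    using Ck that unfolding D_def by (auto simp: differentiable_on_def frechet_derivative_works[symmetric])
  have contD: "continuous_on ({0..t1} \<times> strip) (\<lambda>z. D z v)" if "v \<in> Basis" for v
    using Ck that sub unfolding D_def by (auto intro: continuous_on_subset)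
  have basis: "(1, 0) \<in> (Basis :: (real \<times> real \<times> real) set)" "(0, 1, 0) \<in> (Basis :: (real \<times> real \<times> real) set)"
    "(0, 0, 1) \<in> (Basis :: (real \<times> real \<times> real) set)"
    by (auto simp: Basis_prod_def zero_prod_def)
  have st: "(t, x) \<in> ?S" if "t \<in> {0..t1}" "x \<in> strip" for t x using sub that by auto
  have dt: "((\<lambda>s. l (F s x)) has_real_derivative l (D (t, x) (1, 0))) (at t within {0..t1})"
    if "t \<in> {0..t1}" "x \<in> strip" for t x
  proof -
    have "((\<lambda>s. (s, x)) has_vector_derivative (1, 0)) (at t within {0..t1})"
      by (auto intro!: derivative_eq_intros simp: has_vector_derivative_def zero_prod_def)
    moreover have "(\<lambda>s. (s, x)) ` {0..t1} \<subseteq> ?S" using st that(2) by auto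
    ultimately have "((\<lambda>s. ?G (s, x)) has_vector_derivative D (t, x) (1, 0)) (at t within {0..t1})"
      by (rule has_derivative_along_curve[of ?G _ "\<lambda>s. (s, x)", OF G[OF st[OF that]]])
    then show ?thesis
      by (simp add: has_real_derivative_iff_has_vector_derivative l.has_vector_derivative)
  qed
  have d1: "((\<lambda>a. l (F t (a, y))) has_real_derivative l (D (t, x, y) (0, 1, 0))) (at x)"
    if "t \<in> {0..t1}" "(x, y) \<in> strip" for t x y
  proof -
    have "((\<lambda>a. (t, a, y)) has_vector_derivative (0, 1, 0)) (at x within UNIV)"
      by (auto intro!: derivative_eq_intros simp: has_vector_derivative_def)
    moreover have "(\<lambda>a. (t, a, y)) ` UNIV \<subseteq> ?S" using st that by auto
    ultimately have "((\<lambda>a. ?G (t, a, y)) has_vector_derivative D (t, x, y) (0, 1, 0)) (at x within UNIV)"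
      by (rule has_derivative_along_curve[of ?G _ "\<lambda>a. (t, a, y)", OF G[OF st[OF that]]])
    then show ?thesis
      by (simp add: has_real_derivative_iff_has_vector_derivative l.has_vector_derivative)
  qed
  have d2: "((\<lambda>b. l (F t (x, b))) has_real_derivative l (D (t, x, y) (0, 0, 1))) (at y within {0..pi})"
    if "t \<in> {0..t1}" "(x, y) \<in> strip" for t x y
  proof -
    have "((\<lambda>b. (t, x, b)) has_vector_derivative (0, 0, 1)) (at y within {0..pi})"
      by (auto intro!: derivative_eq_intros simp: has_vector_derivative_def)
    moreover have "(\<lambda>b. (t, x, b)) ` {0..pi} \<subseteq> ?S" using st that by auto
    ultimately have "((\<lambda>b. ?G (t, x, b)) has_vector_derivative D (t, x, y) (0, 0, 1)) (at y within {0..pi})"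
      by (rule has_derivative_along_curve[of ?G _ "\<lambda>b. (t, x, b)", OF G[OF st[OF that]]])
    then show ?thesis
      by (simp add: has_real_derivative_iff_has_vector_derivative l.has_vector_derivative)
  qed
  have contx: "continuous_on strip (\<lambda>x. l (D (t, x) v))" if "t \<in> {0..t1}" "v \<in> Basis" for t v
    by (intro l.continuous_on continuous_on_compose2[OF contD[OF that(2)]])
      (use that in \<open>auto intro!: continuous_intros\<close>)
  have C: "C1_Omega (\<lambda>x. l (F t x)) \<and> (\<forall>x\<in>strip. partial1 (\<lambda>x. l (F t x)) x = l (D (t, x) (0, 1, 0)) \<and>
      partial2 (\<lambda>x. l (F t x)) x = l (D (t, x) (0, 0, 1)))" if t: "t \<in> {0..t1}" for t
  proof (rule C1_OmegaI)
    show "(\<lambda>x. l (F t x)) differentiable_on strip"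
      unfolding differentiable_on_def
    proof
      fix x assume x: "x \<in> strip"
      have "((\<lambda>x. ?G (t, x)) has_derivative (\<lambda>h. D (t, x) (0, h))) (at x within strip)"
      proof (rule has_derivative_in_compose[where f="\<lambda>x. (t, x)" and g="?G"])
        show "((\<lambda>x. (t, x)) has_derivative (\<lambda>h. (0, h))) (at x within strip)"
          by (auto intro!: derivative_eq_intros)
        show "(?G has_derivative D (t, x)) (at (t, x) within (\<lambda>x. (t, x)) ` strip)"
          by (rule has_derivative_subset[OF G[OF st[OF t x]]]) (use st t in auto)
      qed
      then have "((\<lambda>x. l (F t x)) has_derivative (\<lambda>h. l (D (t, x) (0, h)))) (at x within strip)"
        using l.has_derivative by fastforce
      then show "(\<lambda>x. l (F t x)) differentiable at x within strip"
        by (rule differentiableI)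
    qed
    show "x1_periodic (\<lambda>x. l (F t x))"
      using per[OF t] by (auto simp: x1_periodic_def)
  qed (use t d1 d2 contx basis in auto)
  have "evolves t1 (\<lambda>t x. l (F t x)) (\<lambda>t x. l (D (t, x) (1, 0)))"
    unfolding evolves_def
  proof (intro conjI ballI)
    show "continuous_on ({0..t1} \<times> strip) (\<lambda>z. l (F (fst z) (snd z)))"
      using continuous_on_subset[OF differentiable_imp_continuous_on sub, of ?G] Ck
      by (auto simp: split_beta intro!: l.continuous_on)
    have *: "continuous_on ({0..t1} \<times> strip) (\<lambda>z. l (D z v))" if "v \<in> Basis" for v
      by (intro l.continuous_on contD that)
    show "continuous_on ({0..t1} \<times> strip) (\<lambda>z. l (D (fst z, snd z) (1, 0)))"
      using *[OF basis(1)] by simp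
    show "continuous_on ({0..t1} \<times> strip) (\<lambda>z. partial1 (\<lambda>x. l (F (fst z) x)) (snd z))"
      by (rule continuous_on_eq[OF *[OF basis(2)]]) (use C in \<open>auto simp del: mem_strip\<close>)
    show "continuous_on ({0..t1} \<times> strip) (\<lambda>z. partial2 (\<lambda>x. l (F (fst z) x)) (snd z))"
      by (rule continuous_on_eq[OF *[OF basis(3)]]) (use C in \<open>auto simp del: mem_strip\<close>)
  qed (use C dt in auto)
  then show ?thesis by blast
qed

lemma boussinesq_imp_classical:
  assumes sol: "boussinesq_solution T \<rho>0 \<omega>0 \<rho> \<omega> u" and t1: "0 < t1" "ereal t1 < T"
  shows "classical_solution t1 \<rho> \<omega> (\<lambda>t x. fst (u t x)) (\<lambda>t x. snd (u t x))"
proof -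
  let ?a = "\<lambda>t x. fst (u t x)" and ?b = "\<lambda>t x. snd (u t x)"
  have smooth: "smooth_on (spacetime T) (\<lambda>(t, x). \<rho> t x)" "smooth_on (spacetime T) (\<lambda>(t, x). \<omega> t x)"
      "smooth_on (spacetime T) (\<lambda>(t, x). u t x)"
    using sol by (auto simp: boussinesq_solution_def)
  have lt: "ereal t < T" if "t \<in> {0..t1}" for t
    using that t1(2) by (auto intro: le_less_trans[of "ereal _" "ereal t1"])
  have per: "x1_periodic (\<rho> t)" "x1_periodic (\<omega> t)" "x1_periodic (u t)" "biot_savart (\<omega> t) (u t)"
    and eq\<rho>: "\<And>x. x \<in> strip \<Longrightarrow> ((\<lambda>s. \<rho> s x) has_real_derivative - (u t x \<bullet> grad (\<rho> t) x)) (at t within {0..})"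
    and eq\<omega>: "\<And>x. x \<in> strip \<Longrightarrow> ((\<lambda>s. \<omega> s x) has_real_derivative - (u t x \<bullet> grad (\<omega> t) x) - partial1 (\<rho> t) x)
             (at t within {0..})"
    if "t \<in> {0..t1}" for t
    using sol lt[OF that] that by (auto simp: boussinesq_solution_def)
  obtain r' where r': "evolves t1 \<rho> r'"
    using smooth_evolves[OF smooth(1) t1(2) bounded_linear_ident per(1)] by auto
  obtain w' where w': "evolves t1 \<omega> w'"
    using smooth_evolves[OF smooth(2) t1(2) bounded_linear_ident per(2)] by auto
  obtain a' where a': "evolves t1 ?a a'"
    using smooth_evolves[OF smooth(3) t1(2) bounded_linear_fst per(3)] by auto
  obtain b' where b': "evolves t1 ?b b'"
    using smooth_evolves[OF smooth(3) t1(2) bounded_linear_snd per(3)] by auto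
  have inner: "u t x \<bullet> grad f x = ?a t x * partial1 f x + ?b t x * partial2 f x" for t x f
    by (simp add: grad_def inner_prod_def)
  have sub: "(f has_real_derivative d) (at t within {0..t1})" if "(f has_real_derivative d) (at t within {0..})" for f d t
    by (rule has_field_derivative_subset[OF that]) auto
  show ?thesis unfolding classical_solution_def
  proof (intro conjI ballI)
    show "evolves t1 \<rho> (\<lambda>t x. - (?a t x * partial1 (\<rho> t) x + ?b t x * partial2 (\<rho> t) x))"
    proof (rule evolves_cong[OF r'])
      fix t x assume "t \<in> {0..t1}" "x \<in> strip"
      then show "- (?a t x * partial1 (\<rho> t) x + ?b t x * partial2 (\<rho> t) x) = r' t x"
        using DERIV_unique_Icc[OF sub[OF eq\<rho>] evolvesD(2)[OF r'] t1(1)] by (simp add: inner)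
    qed
    show "evolves t1 \<omega> (\<lambda>t x. - (?a t x * partial1 (\<omega> t) x + ?b t x * partial2 (\<omega> t) x) - partial1 (\<rho> t) x)"
    proof (rule evolves_cong[OF w'])
      fix t x assume "t \<in> {0..t1}" "x \<in> strip"
      then show "- (?a t x * partial1 (\<omega> t) x + ?b t x * partial2 (\<omega> t) x) - partial1 (\<rho> t) x = w' t x"
        using DERIV_unique_Icc[OF sub[OF eq\<omega>] evolvesD(2)[OF w'] t1(1)] by (simp add: inner)
    qed
    show "\<exists>a'. evolves t1 ?a a'" "\<exists>b'. evolves t1 ?b b'" using a' b' by blast+
    fix t assume t: "t \<in> {0..t1}"
    have C: "C1_Omega (?a t)" "C1_Omega (?b t)" using evolvesD(1) a' b' t by blast+
    obtain \<psi> where \<psi>: "smooth_Omega \<psi>" "\<And>x. x \<in> strip \<Longrightarrow> - laplacian \<psi> x = \<omega> t x"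
        "\<And>x1. \<psi> (x1, 0) = 0" "\<And>x1. \<psi> (x1, pi) = 0" and u: "\<And>x. x \<in> strip \<Longrightarrow> u t x = grad_perp \<psi> x"
      using per(4)[OF t] by (auto simp: biot_savart_def inv_neg_laplacian_def)
    have a: "?a t x = partial2 \<psi> x" and b: "?b t x = - partial1 \<psi> x" if "x \<in> strip" for x
      using u[OF that] by (auto simp: grad_perp_def)
    have 1: "\<forall>x\<in>strip. partial1 (partial1 \<psi>) x = partial1 (\<lambda>x. - ?b t x) x"
      using C1_cong[of "\<lambda>x. - ?b t x" "partial1 \<psi>"] b C by auto
    have 2: "\<forall>x\<in>strip. partial2 (partial2 \<psi>) x = partial2 (?a t) x"
      using C1_cong[of "?a t" "partial2 \<psi>"] a C by auto
    have "\<omega> t x = partial1 (?b t) x - partial2 (?a t) x" if "x \<in> strip" for x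
      using \<psi>(2)[OF that] 1 2 C that by (auto simp: laplacian_def)
    then have "stream_flow (\<omega> t) \<psi> (?a t) (?b t)"
      unfolding stream_flow_def using smooth_Omega_C1[OF \<psi>(1)] \<psi> C a b by auto
    then show "\<exists>\<psi>. stream_flow (\<omega> t) \<psi> (?a t) (?b t)" by blast
  qed
qed

section \<open>Growth of the total vorticity and conservation of energy\<close>

lemma integral_Icc_ge:
  fixes f :: "real \<Rightarrow> real"
  assumes "continuous_on {0..pi} f" "\<And>y. 0 \<le> y \<Longrightarrow> y \<le> pi \<Longrightarrow> k \<le> f y"
  shows "k * pi \<le> integral {0..pi} f"
proof -
  have "integral {0..pi} (\<lambda>_. k) \<le> integral {0..pi} f"
    by (rule integral_le) (use assms in \<open>auto intro: integrable_continuous_real\<close>)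
  then show ?thesis by (simp add: mult.commute)
qed

text \<open>On the half cell the velocity is tangent to all four sides, so the advection term integrates to zero
  and \<open>d/dt \<integral> \<omega> = - \<integral> \<partial>\<^sub>1\<rho>\<close> is the difference of the density integrals over the two vertical sides.\<close>

lemma vorticity_growth:
  assumes c: "classical_solution t1 \<rho> \<omega> a b"
    and sides: "\<And>t y. t \<in> {0..t1} \<Longrightarrow> 0 \<le> y \<Longrightarrow> y \<le> pi \<Longrightarrow> a t (0, y) = 0 \<and> a t (pi, y) = 0"
    and \<rho>: "\<And>t y. t \<in> {0..t1} \<Longrightarrow> 0 \<le> y \<Longrightarrow> y \<le> pi \<Longrightarrow> k0 \<le> \<rho> t (0, y) \<and> \<rho> t (pi, y) \<le> 0"
    and t: "t \<in> {0..t1}"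
  shows "integral half_cell (\<omega> 0) + k0 * pi * t \<le> integral half_cell (\<omega> t)"
proof -
  have r: "evolves t1 \<rho> (\<lambda>t x. - (a t x * partial1 (\<rho> t) x + b t x * partial2 (\<rho> t) x))"
    and w: "evolves t1 \<omega> (\<lambda>t x. - (a t x * partial1 (\<omega> t) x + b t x * partial2 (\<omega> t) x) - partial1 (\<rho> t) x)"
    using c by (auto simp: classical_solution_def)
  let ?w' = "\<lambda>t x. - (a t x * partial1 (\<omega> t) x + b t x * partial2 (\<omega> t) x) - partial1 (\<rho> t) x"
  have D: "((\<lambda>s. integral half_cell (\<omega> s)) has_real_derivative integral half_cell (?w' s)) (at s within {0..t1})"
    if "s \<in> {0..t1}" for s by (rule evolves_integral[OF w that])
  have ge: "k0 * pi \<le> integral half_cell (?w' s)" if s: "s \<in> {0..t1}" for s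
  proof -
    obtain \<psi> where f: "stream_flow (\<omega> s) \<psi> (a s) (b s)"
      using c s unfolding classical_solution_def by blast
    note f' = stream_flowD[OF f]
    have C: "C1_Omega (\<rho> s)" "C1_Omega (\<omega> s)" using evolvesD(1) r w s by blast+
    have cy: "continuous_on {0..pi} (\<lambda>y. \<rho> s (x, y))" for x
      by (rule continuous_on_compose2[OF C1_cont[OF C(1)]]) (auto intro!: continuous_intros)
    have "k0 * pi \<le> integral {0..pi} (\<lambda>y. \<rho> s (0, y) - \<rho> s (pi, y))"
    proof (rule integral_Icc_ge)
      show "continuous_on {0..pi} (\<lambda>y. \<rho> s (0, y) - \<rho> s (pi, y))"
        by (intro continuous_intros cy)
      show "k0 \<le> \<rho> s (0, y) - \<rho> s (pi, y)" if "0 \<le> y" "y \<le> pi" for y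
        using \<rho>[OF s that] by linarith
    qed
    also have "\<dots> = integral {0..pi} (\<lambda>y. (- (a s (pi, y) * \<omega> s (pi, y)) - \<rho> s (pi, y)) -
        (- (a s (0, y) * \<omega> s (0, y)) - \<rho> s (0, y)))"
      by (rule integral_cong) (use sides[OF s] in auto)
    also have "\<dots> = integral half_cell (?w' s)"
    proof -
      have "integral half_cell (?w' s) = integral {0..pi} (\<lambda>y. (- (a s (pi, y) * \<omega> s (pi, y)) - \<rho> s (pi, y)) -
          (- (a s (0, y) * \<omega> s (0, y)) - \<rho> s (0, y))) +
          integral {0..pi} (\<lambda>x. - (b s (x, pi) * \<omega> s (x, pi)) - - (b s (x, 0) * \<omega> s (x, 0)))"
        by (rule box_divergence[where g="\<lambda>x. - (a s x * \<omega> s x) - \<rho> s x" and h="\<lambda>x. - (b s x * \<omega> s x)"])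
          (use C f' in \<open>simp_all add: stream_flow_div[OF f] algebra_simps\<close>)
      then show ?thesis by (simp add: stream_flow_walls[OF f])
    qed
    finally show ?thesis .
  qed
  have "integral half_cell (\<omega> 0) - k0 * pi * 0 \<le> integral half_cell (\<omega> t) - k0 * pi * t"
  proof (rule DERIV_nonneg_imp_increasing_open[where f="\<lambda>s. integral half_cell (\<omega> s) - k0 * pi * s"])
    have D': "((\<lambda>s. integral half_cell (\<omega> s) - k0 * pi * s) has_real_derivative integral half_cell (?w' s) - k0 * pi)
        (at s within {0..t1})" if "s \<in> {0..t1}" for s
      by (rule derivative_eq_intros D that refl)+ simp
    show "\<exists>y. ((\<lambda>s. integral half_cell (\<omega> s) - k0 * pi * s) has_real_derivative y) (at s) \<and> 0 \<le> y"
      if "0 < s" "s < t" for s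
      using D'[of s] ge[of s] that t at_within_Icc_at[of 0 s t1] by fastforce
    show "continuous_on {0..t} (\<lambda>s. integral half_cell (\<omega> s) - k0 * pi * s)"
      using t by (intro continuous_on_subset[OF DERIV_continuous_on[OF D']]) auto
  qed (use t in auto)
  then show ?thesis by simp
qed

text \<open>Kinetic energy is gained at the rate \<open>- \<integral> b \<rho>\<close>, which is what the potential energy \<open>\<integral> x2 \<rho>\<close> loses.\<close>

lemma energy_conservation:
  assumes c: "classical_solution t1 \<rho> \<omega> a b" and t1: "0 < t1" and t: "t \<in> {0..t1}"
  shows "integral cell (\<lambda>x. a t x * a t x) + integral cell (\<lambda>x. b t x * b t x) + 2 * integral cell (\<lambda>x. snd x * \<rho> t x) =
    integral cell (\<lambda>x. a 0 x * a 0 x) + integral cell (\<lambda>x. b 0 x * b 0 x) + 2 * integral cell (\<lambda>x. snd x * \<rho> 0 x)"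
proof -
  have r: "evolves t1 \<rho> (\<lambda>t x. - (a t x * partial1 (\<rho> t) x + b t x * partial2 (\<rho> t) x))"
    and w: "evolves t1 \<omega> (\<lambda>t x. - (a t x * partial1 (\<omega> t) x + b t x * partial2 (\<omega> t) x) - partial1 (\<rho> t) x)"
    using c by (auto simp: classical_solution_def)
  let ?w' = "\<lambda>t x. - (a t x * partial1 (\<omega> t) x + b t x * partial2 (\<omega> t) x) - partial1 (\<rho> t) x"
  obtain a' b' where e: "evolves t1 a a'" "evolves t1 b b'"
    using c by (auto simp: classical_solution_def)
  obtain \<psi> where s: "\<And>t. t \<in> {0..t1} \<Longrightarrow> stream_flow (\<omega> t) (\<psi> t) (a t) (b t)"
    using c unfolding classical_solution_def by metis
  let ?E = "\<lambda>t. integral cell (\<lambda>x. a t x * a t x) + integral cell (\<lambda>x. b t x * b t x) + 2 * integral cell (\<lambda>x. snd x * \<rho> t x)"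
  have D: "(?E has_real_derivative 0) (at t within {0..t1})" if t: "t \<in> {0..t1}" for t
  proof -
    note f = stream_flowD[OF s[OF t]]
    have C: "C1_Omega (\<rho> t)" "C1_Omega (\<omega> t)" using evolvesD(1) r w t by blast+
    note cc = C1_cont[OF f(1)] C1_cont[OF f(2)] C1_cont[OF f(3)] C1_cont[OF C(1)] C1_cont[OF C(2)]
      C1_cont1[OF C(1)] C1_cont2[OF C(1)] C1_cont1[OF C(2)] C1_cont2[OF C(2)]
    \<comment> \<open>T1 integrates to zero, T2 and T3 are the exchange between kinetic and potential energy\<close>
    let ?T1 = "\<lambda>x. \<psi> t x * (a t x * partial1 (\<omega> t) x + b t x * partial2 (\<omega> t) x)"
    let ?T2 = "\<lambda>x. \<psi> t x * partial1 (\<rho> t) x"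
    let ?T3 = "\<lambda>x. snd x * (a t x * partial1 (\<rho> t) x + b t x * partial2 (\<rho> t) x)"
    let ?T4 = "\<lambda>x. b t x * \<rho> t x"
    have int: "?T1 integrable_on cell" "?T2 integrable_on cell" "?T3 integrable_on cell" "?T4 integrable_on cell"
      by (intro integrable_on_box continuous_intros cc; simp)+
    have "integral cell ?T1 = - integral cell (\<lambda>x. \<omega> t x * (a t x * partial1 (\<psi> t) x + b t x * partial2 (\<psi> t) x))"
      by (rule transport_parts[OF s[OF t] C(2) f(1)])
    also have "\<dots> = - integral cell (\<lambda>x. 0)"
      by (intro arg_cong[where f=uminus] integral_cong)
        (use cell_subset_strip f in \<open>auto simp: subset_iff simp del: mem_strip\<close>)
    finally have T1: "integral cell ?T1 = 0" by simp
    have "integral cell (\<lambda>x. ?T2 x - ?T4 x) = 0"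
      by (rule cell_divergence[where g="\<lambda>x. \<psi> t x * \<rho> t x" and h="\<lambda>_. 0"]) (use f C in simp_all)
    then have T2: "integral cell ?T2 = integral cell ?T4" by (simp add: integral_diff int)
    have "integral cell ?T3 = - integral cell (\<lambda>x. \<rho> t x * (a t x * partial1 snd x + b t x * partial2 snd x))"
      by (rule transport_parts[OF s[OF t] C(1) C1_snd])
    also have "\<dots> = - integral cell ?T4"
      by (intro arg_cong[where f=uminus] integral_cong)
        (use cell_subset_strip in \<open>auto simp: subset_iff simp del: mem_strip\<close>)
    finally have T3: "integral cell ?T3 = - integral cell ?T4" .
    have "((\<lambda>x. - ?T1 x - ?T2 x) has_integral (- integral cell ?T1 - integral cell ?T2)) cell"
      by (intro has_integral_diff has_integral_neg integrable_integral int)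
    also have "(\<lambda>x. - ?T1 x - ?T2 x) = (\<lambda>x. \<psi> t x * ?w' t x)" by (simp add: algebra_simps)
    finally have kin: "integral cell (\<lambda>x. \<psi> t x * ?w' t x) = - integral cell ?T4"
      using T1 T2 by (simp add: integral_unique)
    have "(\<lambda>x. 0 * \<rho> t x + snd x * - (a t x * partial1 (\<rho> t) x + b t x * partial2 (\<rho> t) x)) = (\<lambda>x. - ?T3 x)"
      by (simp add: algebra_simps)
    then have pot: "integral cell (\<lambda>x. 0 * \<rho> t x + snd x * - (a t x * partial1 (\<rho> t) x + b t x * partial2 (\<rho> t) x)) =
        integral cell ?T4"
      using T3 by simp
    have "(?E has_real_derivative 2 * integral cell (\<lambda>x. \<psi> t x * ?w' t x) +
        2 * integral cell (\<lambda>x. 0 * \<rho> t x + snd x * - (a t x * partial1 (\<rho> t) x + b t x * partial2 (\<rho> t) x)))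
        (at t within {0..t1})"
      by (intro DERIV_add DERIV_cmult kinetic_energy_derivative[OF s e w t1 t]
          evolves_integral[OF evolves_mult[OF evolves_const[OF C1_snd] r] t])
    then show ?thesis unfolding kin pot by simp
  qed
  have "?E t = ?E 0"
  proof (rule has_field_derivative_zero_constant[OF _ D, THEN exE])
    fix k assume "\<forall>x\<in>{0..t1}. ?E x = k"
    then show ?thesis using t t1 by auto
  qed auto
  then show ?thesis .
qed

section \<open>Lebesgue norms of continuous functions\<close>

lemma period_cell_measurable: "period_cell \<in> sets borel"
proof -
  have "period_cell = cell \<inter> {x. - pi < fst x}" by (auto simp: period_cell_def cbox_Pair_eq)
  moreover have "open {x :: real \<times> real. - pi < fst x}"
    by (intro open_Collect_less continuous_intros)
  ultimately show ?thesis by (metis borel_closed borel_open closed_cbox sets.Int)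
qed

lemma period_cell_subset_cell: "period_cell \<subseteq> cell" and half_cell_subset_period_cell: "half_cell \<subseteq> period_cell"
  by (auto simp: period_cell_def cbox_Pair_eq) (use pi_gt_zero in linarith)

lemma norm_bound_on_cell:
  fixes f :: "real \<times> real \<Rightarrow> 'b::real_normed_vector"
  assumes "continuous_on strip f"
  shows "\<exists>K. \<forall>x\<in>cell. norm (f x) \<le> K"
proof -
  have "compact (f ` cell)"
    by (intro compact_continuous_image continuous_on_subset[OF assms cell_subset_strip] compact_cbox)
  then show ?thesis by (metis bounded_iff compact_imp_bounded image_eqI)
qed

text \<open>The essential supremum of a continuous function is its supremum, because a nonempty open set is
  not negligible; the half-open cell lies in the closure of its interior.\<close>

lemma Linf_norm:
  fixes f :: "real \<times> real \<Rightarrow> 'b::real_normed_vector"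
  assumes f: "continuous_on strip f"
  shows "\<And>x. x \<in> cell \<Longrightarrow> norm (f x) \<le> Lp_norm \<infinity> f"
    and "\<And>K. (\<And>x. x \<in> cell \<Longrightarrow> norm (f x) \<le> K) \<Longrightarrow> Lp_norm \<infinity> f \<le> K"
proof -
  let ?R = "restrict_space lborel period_cell" and ?B = "box (- pi, 0) (pi, pi) :: (real \<times> real) set"
  define g where "g x = ereal (norm (f x))" for x
  define M where "M = esssup ?R g"
  have cg: "continuous_on S g" if "S \<subseteq> strip" for S
    unfolding g_def by (intro continuous_on_ereal continuous_on_norm continuous_on_subset[OF f that])
  have sub: "?B \<subseteq> cell" "?B \<subseteq> period_cell" "?B \<subseteq> strip" "period_cell \<subseteq> strip"
    by (auto simp: period_cell_def strip_def box_def Basis_prod_def cbox_Pair_eq)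
  have "g \<in> borel_measurable (restrict_space borel period_cell)"
    by (rule borel_measurable_continuous_on_restrict[OF cg[OF sub(4)]])
  also have "borel_measurable (restrict_space borel period_cell) = borel_measurable ?R"
    by (intro measurable_cong_sets sets_restrict_space_cong) auto
  finally have meas: "g \<in> borel_measurable ?R" .
  have le: "M \<le> ereal K" if "\<And>x. x \<in> cell \<Longrightarrow> norm (f x) \<le> K" for K
    unfolding M_def
    by (rule esssup_I[OF meas])
      (use that period_cell_subset_cell in \<open>auto simp: g_def space_restrict_space intro!: AE_I2\<close>)
  have AE: "AE x in lborel. x \<in> period_cell \<longrightarrow> g x \<le> M"
    using esssup_AE[of g ?R] period_cell_measurable by (simp add: M_def AE_restrict_space_iff)
  have inner: "g x \<le> M" if x: "x \<in> ?B" for x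
  proof (rule ccontr)
    assume "\<not> g x \<le> M"
    let ?S = "?B \<inter> g -` {M<..}"
    have op: "open ?S"
      by (intro continuous_open_preimage cg sub(3) open_box open_greaterThan)
    then have "?S \<in> sets lborel" by auto
    moreover have "AE x in lborel. x \<notin> ?S"
      using AE sub(2) by (auto elim!: eventually_mono)
    ultimately have "?S \<in> null_sets lborel" by (simp add: AE_iff_null_sets)
    then have "negligible ?S" by (simp add: negligible_iff_null_sets null_sets_completionI)
    moreover have "?S \<noteq> {}" using x \<open>\<not> g x \<le> M\<close> by auto
    ultimately show False using open_not_negligible[OF op] by simp
  qed
  have ne: "(0, pi / 2) \<in> ?B" by (auto simp: box_def Basis_prod_def)
  obtain K where "\<And>x. x \<in> cell \<Longrightarrow> norm (f x) \<le> K" using norm_bound_on_cell[OF f] by blast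
  then have "M \<le> ereal K" by (rule le)
  moreover have "ereal (norm (f (0, pi / 2))) \<le> M" using inner[OF ne] by (simp add: g_def)
  ultimately obtain r where r: "M = ereal r" by (cases M) auto
  have norm: "Lp_norm \<infinity> f = r"
    using r by (simp add: Lp_norm_def M_def g_def[abs_def])
  have cl: "closure ?B = cell" using ne by (intro closure_box) auto
  show "norm (f x) \<le> Lp_norm \<infinity> f" if "x \<in> cell" for x
    unfolding norm
  proof (rule continuous_le_on_closure[where f="\<lambda>x. norm (f x)"])
    show "continuous_on (closure ?B) (\<lambda>x. norm (f x))"
      unfolding cl by (intro continuous_on_norm continuous_on_subset[OF f cell_subset_strip])
    show "x \<in> closure ?B" using that cl by simp
    show "norm (f x) \<le> r" if "x \<in> ?B" for x
      using inner[OF that] r by (simp add: g_def)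
  qed
  show "Lp_norm \<infinity> f \<le> K" if "\<And>x. x \<in> cell \<Longrightarrow> norm (f x) \<le> K" for K
    using le[OF that] r norm by simp
qed

lemma Lp_integral_ge_half_cell:
  fixes f :: "real \<times> real \<Rightarrow> 'b::real_normed_vector"
  assumes f: "continuous_on strip f" and r: "1 \<le> r"
  shows "integral half_cell (\<lambda>x. norm (f x) powr r) \<le>
    (LINT x|restrict_space lborel period_cell. norm (f x) powr r)"
proof -
  define h where "h x = norm (f x) powr r" for x
  have ch: "continuous_on cell h"
    unfolding h_def using r
    by (intro continuous_on_powr' continuous_intros continuous_on_subset[OF f cell_subset_strip]) auto
  have int: "set_integrable lborel cell h"
    unfolding set_integrable_def by (rule borel_integrable_compact[OF compact_cbox ch])
  have int': "set_integrable lborel half_cell h" "set_integrable lborel period_cell h"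
    using set_integrable_subset[OF int] half_cell_subset_cell period_cell_subset_cell period_cell_measurable
    by auto
  have "integral half_cell h = (LINT x:half_cell|lborel. h x)"
    by (rule set_borel_integral_eq_integral(2)[OF int'(1), symmetric])
  also have "\<dots> \<le> (LINT x:period_cell|lborel. h x)"
    unfolding set_lebesgue_integral_def
    by (rule integral_mono)
      (use int' half_cell_subset_period_cell in \<open>auto simp: set_integrable_def indicator_def h_def\<close>)
  also have "\<dots> = (LINT x|restrict_space lborel period_cell. h x)"
    using period_cell_measurable by (simp add: integral_restrict_space set_lebesgue_integral_def)
  finally show ?thesis unfolding h_def .
qed

text \<open>Where \<open>a \<le> s\<close> the second term suffices, where \<open>a > s\<close> the first one does since \<open>(a / s) powr (r - 1) \<ge> 1\<close>.\<close>

lemma powr_truncation: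
  fixes a s r \<theta> :: real
  assumes "0 \<le> a" "0 < s" "1 \<le> r" "0 \<le> \<theta>" "\<theta> \<le> 1"
  shows "a * \<theta> \<le> s powr (1 - r) * a powr r + s * \<theta>"
proof (cases "a \<le> s")
  case True
  then have "a * \<theta> \<le> s * \<theta>" using assms by (intro mult_right_mono) auto
  moreover have "0 \<le> s powr (1 - r) * a powr r" by simp
  ultimately show ?thesis by linarith
next
  case False
  then have a: "0 < a" "s \<le> a" using assms by auto
  have "a * \<theta> \<le> a * 1" using assms by (intro mult_left_mono) auto
  also have "\<dots> = a powr (1 - r) * a powr r" using a by (simp flip: powr_add)
  also have "\<dots> \<le> s powr (1 - r) * a powr r"
    using assms a by (intro mult_right_mono powr_mono2') auto
  also have "\<dots> \<le> s powr (1 - r) * a powr r + s * \<theta>" using assms by simp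
  finally show ?thesis .
qed

text \<open>Mass of \<open>f\<close> on a small set forces a large norm. The value \<open>s = B / (4 m)\<close> is the level below
  which \<open>f\<close> contributes at most half of the mass.\<close>

lemma Lp_norm_concentration:
  fixes f \<theta> :: "real \<times> real \<Rightarrow> real"
  assumes f: "continuous_on strip f" and \<theta>: "continuous_on strip \<theta>"
    "\<And>x. x \<in> half_cell \<Longrightarrow> 0 \<le> \<theta> x \<and> \<theta> x \<le> 1"
    and m: "integral half_cell \<theta> \<le> m" "0 < m"
    and B: "0 < B" "B / 2 \<le> integral half_cell (\<lambda>x. \<bar>f x\<bar> * \<theta> x)"
    and p: "1 \<le> p"
  shows "B / 4 * (1 / m) powr (1 - real_of_ereal (2 / p) / 2) \<le> Lp_norm p f"
proof (cases p)
  case (real r)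
  with p have r: "1 \<le> r" by (simp add: one_ereal_def)
  define s where "s = B / (4 * m)"
  have s: "0 < s" using B m by (simp add: s_def)
  define Q where "Q = integral half_cell (\<lambda>x. \<bar>f x\<bar> powr r)"
  have cq: "continuous_on strip (\<lambda>x. \<bar>f x\<bar> powr r)"
    using r by (intro continuous_on_powr' continuous_intros f) auto
  have int: "(\<lambda>x. \<bar>f x\<bar> powr r) integrable_on half_cell" "\<theta> integrable_on half_cell"
    "(\<lambda>x. \<bar>f x\<bar> * \<theta> x) integrable_on half_cell"
    by (intro integrable_on_box cq \<theta>(1) f continuous_intros; simp)+
  have "B / 2 \<le> integral half_cell (\<lambda>x. s powr (1 - r) * \<bar>f x\<bar> powr r + s * \<theta> x)"
    by (rule order_trans[OF B(2)], rule integral_le)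
      (use int \<theta>(2) s r in \<open>auto intro!: integrable_add integrable_on_mult_right powr_truncation\<close>)
  also have "\<dots> = s powr (1 - r) * Q + s * integral half_cell \<theta>"
    unfolding Q_def using int by (simp add: integral_add integrable_on_mult_right)
  also have "\<dots> \<le> s powr (1 - r) * Q + s * m"
    using m(1) s by simp
  also have "s * m = B / 4" using m(2) by (simp add: s_def)
  finally have "B / 4 \<le> s powr (1 - r) * Q" by simp
  then have "s powr (r - 1) * (B / 4) \<le> s powr (r - 1) * (s powr (1 - r) * Q)"
    by (rule mult_left_mono) simp
  also have "\<dots> = Q" using s by (simp add: mult.assoc[symmetric] flip: powr_add)
  also have "Q \<le> (LINT x|restrict_space lborel period_cell. norm (f x) powr r)"
    using Lp_integral_ge_half_cell[OF f r] by (simp add: Q_def)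
  finally have J: "s powr (r - 1) * (B / 4) \<le> (LINT x|restrict_space lborel period_cell. norm (f x) powr r)" .
  have "(s powr (r - 1) * (B / 4)) powr (1 / r) \<le> Lp_norm p f"
    using powr_mono2[OF _ _ J, of "1 / r"] r s B real by (simp add: Lp_norm_def)
  moreover have "(s powr (r - 1) * (B / 4)) powr (1 / r) = B / 4 * (1 / m) powr (1 - 1 / r)"
  proof -
    have "(s powr (r - 1) * (B / 4)) powr (1 / r) = (s powr (r - 1)) powr (1 / r) * (B / 4) powr (1 / r)"
      by (rule powr_mult)
    also have "(s powr (r - 1)) powr (1 / r) = s powr (1 - 1 / r)"
      using r by (simp add: powr_powr diff_divide_distrib)
    also have "s powr (1 - 1 / r) = ((B / 4) * (1 / m)) powr (1 - 1 / r)" by (simp add: s_def)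
    also have "((B / 4) * (1 / m)) powr (1 - 1 / r) = (B / 4) powr (1 - 1 / r) * (1 / m) powr (1 - 1 / r)"
      by (rule powr_mult)
    also have "\<dots> * (B / 4) powr (1 / r) = ((B / 4) powr (1 - 1 / r) * (B / 4) powr (1 / r)) * (1 / m) powr (1 - 1 / r)"
      by (simp add: mult_ac)
    also have "(B / 4) powr (1 - 1 / r) * (B / 4) powr (1 / r) = B / 4"
      using B by (simp flip: powr_add)
    finally show ?thesis .
  qed
  moreover have "real_of_ereal (2 / p) / 2 = 1 / r"
    using r real by (simp add: numeral_eq_ereal)
  ultimately show ?thesis by simp
next
  case PInf
  let ?N = "Lp_norm \<infinity> f"
  have int: "\<theta> integrable_on half_cell" "(\<lambda>x. \<bar>f x\<bar> * \<theta> x) integrable_on half_cell"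
    by (intro integrable_on_box \<theta>(1) f continuous_intros; simp)+
  have N: "\<bar>f x\<bar> \<le> ?N" if "x \<in> half_cell" for x
    using Linf_norm(1)[OF f, of x] half_cell_subset_cell that by auto
  have "(0, 0) \<in> half_cell" by simp
  from N[OF this] have N0: "0 \<le> ?N" by linarith
  have "B / 2 \<le> integral half_cell (\<lambda>x. ?N * \<theta> x)"
    by (rule order_trans[OF B(2)], rule integral_le)
      (use int \<theta>(2) N in \<open>auto intro!: integrable_on_mult_right mult_right_mono\<close>)
  also have "\<dots> = ?N * integral half_cell \<theta>" by simp
  also have "\<dots> \<le> ?N * m" by (rule mult_left_mono[OF m(1) N0])
  finally have "B / 2 / m \<le> ?N" using m(2) by (simp add: field_simps)
  moreover have "B / 4 * (1 / m) \<le> B / 2 / m" using B m by (simp add: field_simps)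
  ultimately show ?thesis using PInf m(2) by simp
qed (use p in auto)

section \<open>Circulation and boundary layers\<close>

text \<open>A profile equal to \<open>1\<close> at \<open>0\<close> and \<open>\<pi>\<close> that decays over a distance \<open>1 / l\<close> inside \<open>(0, \<pi>)\<close>. Taking the sine
  makes it smooth and \<open>2\<pi>\<close>-periodic, and its derivative is at most \<open>l\<close> times the profile.\<close>

abbreviation layer :: "real \<Rightarrow> real \<Rightarrow> real" where "layer l s \<equiv> exp (- (l * sin s))"

lemma C1_layer1:
  "C1_Omega (\<lambda>x. layer l (fst x)) \<and> (\<forall>x\<in>strip.
    partial1 (\<lambda>x. layer l (fst x)) x = - l * cos (fst x) * layer l (fst x) \<and> partial2 (\<lambda>x. layer l (fst x)) x = 0)"
proof (rule C1_OmegaI)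
  show "(\<lambda>x. layer l (fst x)) differentiable_on strip"
    unfolding differentiable_on_def differentiable_def by (intro ballI exI) (rule derivative_eq_intros refl)+
qed (auto intro!: derivative_eq_intros continuous_intros simp: x1_periodic_def)

lemma C1_layer2:
  "C1_Omega (\<lambda>x. layer l (snd x)) \<and> (\<forall>x\<in>strip.
    partial1 (\<lambda>x. layer l (snd x)) x = 0 \<and> partial2 (\<lambda>x. layer l (snd x)) x = - l * cos (snd x) * layer l (snd x))"
  by (rule C1_vertical) (auto intro!: derivative_eq_intros continuous_intros)

text \<open>With \<open>\<zeta> = layer l\<close>, the part \<open>cos\<^sup>2 \<zeta>\<close> is the derivative of \<open>- cos \<zeta> / l\<close> up to a term with a
  sign, and \<open>sin\<^sup>2 \<zeta> \<le> 1 / l\<close> because \<open>r exp (- r) \<le> 1\<close>.\<close>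

lemma layer_integral:
  assumes l: "0 < l"
  shows "integral {0..pi} (layer l) \<le> 2 * pi / l"
proof -
  have d: "((\<lambda>s. - cos s * layer l s / l) has_vector_derivative (sin s / l + cos s * cos s) * layer l s)
      (at s within {0..pi})" for s
    unfolding has_real_derivative_iff_has_vector_derivative[symmetric]
    using l by (auto intro!: derivative_eq_intros simp: field_simps)
  have "((\<lambda>s. (sin s / l + cos s * cos s) * layer l s) has_integral
      (- cos pi * layer l pi / l - - cos 0 * layer l 0 / l)) {0..pi}"
    by (rule fundamental_theorem_of_calculus[OF _ d]) simp
  then have I: "((\<lambda>s. (sin s / l + cos s * cos s) * layer l s + 1 / l) has_integral (2 / l + 1 / l * pi)) {0..pi}"
    using has_integral_add[OF _ has_integral_const_real[of "1 / l" 0 pi]] by fastforce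
  have le: "layer l s \<le> (sin s / l + cos s * cos s) * layer l s + 1 / l" if s: "s \<in> {0..pi}" for s
  proof -
    have sin: "0 \<le> sin s" "sin s \<le> 1" using s by (auto intro: sin_ge_zero)
    have "l * sin s \<le> exp (l * sin s)" using exp_ge_add_one_self[of "l * sin s"] by linarith
    then have "l * sin s * layer l s \<le> exp (l * sin s) * layer l s" by (intro mult_right_mono) auto
    also have "\<dots> = 1" by (simp flip: exp_add)
    finally have 1: "sin s * layer l s \<le> 1 / l" using l by (simp add: field_simps)
    have "sin s * sin s * layer l s \<le> 1 * (sin s * layer l s)"
      using sin by (simp add: mult.assoc mult_left_le_one_le)
    with 1 have 2: "sin s * sin s * layer l s \<le> 1 / l" by linarith
    have "layer l s = (sin s * sin s + cos s * cos s) * layer l s" by (simp flip: power2_eq_square)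
    also have "\<dots> = sin s * sin s * layer l s + cos s * cos s * layer l s" by (simp add: distrib_right)
    also have "\<dots> \<le> 1 / l + (sin s / l * layer l s + cos s * cos s * layer l s)"
      using 2 divide_nonneg_pos[OF mult_nonneg_nonneg[OF sin(1), of "layer l s"] l] by simp
    also have "\<dots> = (sin s / l + cos s * cos s) * layer l s + 1 / l" by (simp add: distrib_right)
    finally show ?thesis .
  qed
  have "integral {0..pi} (layer l) \<le> 2 / l + 1 / l * pi"
    by (rule has_integral_le[OF integrable_integral I le])
      (auto intro!: integrable_continuous_real continuous_intros)
  also have "\<dots> = (2 + pi) / l" using l by (simp add: field_simps)
  also have "\<dots> \<le> 2 * pi / l" using l pi_ge_two by (intro divide_right_mono) auto
  finally show ?thesis .
qed

lemma layer_integral_half_cell: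
  assumes l: "0 < l"
  shows "integral half_cell (\<lambda>x. layer l (fst x)) \<le> 2 * pi\<^sup>2 / l"
    and "integral half_cell (\<lambda>x. layer l (snd x)) \<le> 2 * pi\<^sup>2 / l"
proof -
  have le: "pi * integral {0..pi} (layer l) \<le> 2 * pi\<^sup>2 / l"
    using mult_left_mono[OF layer_integral[OF l], of pi] by (simp add: power2_eq_square mult_ac)
  have "integral half_cell (\<lambda>x. layer l (fst x)) = integral (cbox 0 pi) (\<lambda>x. integral (cbox 0 pi) (\<lambda>y. layer l (fst (x, y))))"
    by (rule integral_prod_continuous) (intro continuous_intros)
  then show "integral half_cell (\<lambda>x. layer l (fst x)) \<le> 2 * pi\<^sup>2 / l" using le by simp
  have "integral half_cell (\<lambda>x. layer l (snd x)) = integral (cbox 0 pi) (\<lambda>x. integral (cbox 0 pi) (\<lambda>y. layer l (snd (x, y))))"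
    by (rule integral_prod_continuous) (intro continuous_intros)
  then show "integral half_cell (\<lambda>x. layer l (snd x)) \<le> 2 * pi\<^sup>2 / l" using le by simp
qed

text \<open>A smoothed indicator of the \<open>1 / l\<close>-neighbourhood of the boundary of the half cell; it equals \<open>1\<close> on the
  boundary.\<close>

definition collar :: "real \<Rightarrow> real \<times> real \<Rightarrow> real" where
  "collar l x = 1 - (1 - layer l (fst x)) * (1 - layer l (snd x))"

lemma collar_cont: "continuous_on S (collar l)"
  unfolding collar_def[abs_def] by (intro continuous_intros)

lemma layer_bounds: "0 < l \<Longrightarrow> 0 \<le> s \<Longrightarrow> s \<le> pi \<Longrightarrow> 0 < layer l s \<and> layer l s \<le> 1"
  by (simp add: sin_ge_zero)

lemma collar_bounds:
  assumes "0 < l" "x \<in> half_cell"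
  shows "0 \<le> collar l x" "collar l x \<le> 1" "collar l x \<le> layer l (fst x) + layer l (snd x)"
proof -
  have "0 < layer l (fst x) \<and> layer l (fst x) \<le> 1" "0 < layer l (snd x) \<and> layer l (snd x) \<le> 1"
    using assms by (cases x; intro layer_bounds; simp)+
  moreover from this have "0 \<le> (1 - layer l (fst x)) * (1 - layer l (snd x))"
      "(1 - layer l (fst x)) * (1 - layer l (snd x)) \<le> 1 * 1" "0 \<le> layer l (fst x) * layer l (snd x)"
    by (intro mult_nonneg_nonneg mult_mono; simp)+
  ultimately show "0 \<le> collar l x" "collar l x \<le> 1" "collar l x \<le> layer l (fst x) + layer l (snd x)"
    by (auto simp: collar_def algebra_simps)
qed

lemma collar_integral:
  assumes l: "0 < l"
  shows "integral half_cell (collar l) \<le> 4 * pi\<^sup>2 / l"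
proof -
  have int: "(\<lambda>x. layer l (fst x)) integrable_on half_cell" "(\<lambda>x. layer l (snd x)) integrable_on half_cell"
    by (intro integrable_continuous continuous_intros)+
  have "integral half_cell (collar l) \<le> integral half_cell (\<lambda>x. layer l (fst x) + layer l (snd x))"
  proof (rule integral_le)
    show "collar l integrable_on half_cell" by (rule integrable_continuous[OF collar_cont])
    show "(\<lambda>x. layer l (fst x) + layer l (snd x)) integrable_on half_cell" by (rule integrable_add[OF int])
  qed (rule collar_bounds(3)[OF l])
  also have "\<dots> \<le> 4 * pi\<^sup>2 / l"
    using layer_integral_half_cell[OF l] by (simp add: integral_add[OF int])
  finally show ?thesis .
qed

text \<open>Stokes' theorem for the vorticity weighted with \<open>1 - collar l\<close>, which vanishes on the boundary
  of the half_cell cell: outside the boundary layer the vorticity is controlled by the velocity there.\<close>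

lemma circulation_collar:
  assumes u: "stream_flow w \<psi> a b" and l: "0 < l" and w: "continuous_on strip w"
  shows "integral half_cell w \<le>
    integral half_cell (\<lambda>x. l * (\<bar>b x\<bar> * layer l (fst x) + \<bar>a x\<bar> * layer l (snd x))) +
    integral half_cell (\<lambda>x. \<bar>w x\<bar> * collar l x)"
proof -
  note s = stream_flowD[OF u]
  let ?z1 = "\<lambda>x. layer l (fst x)" and ?z2 = "\<lambda>x. layer l (snd x)"
  let ?phi = "\<lambda>x. (1 - ?z1 x) * (1 - ?z2 x)"
  note z1 = C1_layer1[of l, THEN conjunct1] and z2 = C1_layer2[of l, THEN conjunct1]
  have d: "partial1 ?z1 x = - l * cos (fst x) * ?z1 x" "partial2 ?z1 x = 0"
    "partial1 ?z2 x = 0" "partial2 ?z2 x = - l * cos (snd x) * ?z2 x" if "x \<in> strip" for x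
    using C1_layer1[of l] C1_layer2[of l] that by auto
  let ?F = "\<lambda>x. l * (b x * (cos (fst x) * ?z1 x * (1 - ?z2 x)) - a x * (cos (snd x) * ?z2 x * (1 - ?z1 x)))"
  have cF: "continuous_on strip ?F"
    by (intro continuous_intros C1_cont[OF s(2)] C1_cont[OF s(3)])
  have Fe: "w x * ?phi x + ?F x = partial1 (\<lambda>x. b x * ((1 - ?z1 x) * (1 - ?z2 x))) x +
      partial2 (\<lambda>x. - (a x * ((1 - ?z1 x) * (1 - ?z2 x)))) x" if "x \<in> strip" for x
    using that s z1 z2 by (simp add: d del: mem_strip) (simp add: algebra_simps)
  have C: "C1_Omega (\<lambda>x. b x * ((1 - ?z1 x) * (1 - ?z2 x)))"
    "C1_Omega (\<lambda>x. - (a x * ((1 - ?z1 x) * (1 - ?z2 x))))"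
    using s z1 z2 by auto
  have zero: "integral half_cell (\<lambda>x. w x * ?phi x + ?F x) = 0"
    using box_divergence[OF C pi_ge_zero Fe] by simp
  have int: "(\<lambda>x. w x * ?phi x) integrable_on half_cell" "?F integrable_on half_cell"
    "(\<lambda>x. - ?F x) integrable_on half_cell"
    "(\<lambda>x. w x * collar l x) integrable_on half_cell" "(\<lambda>x. \<bar>w x\<bar> * collar l x) integrable_on half_cell"
    "(\<lambda>x. l * (\<bar>b x\<bar> * layer l (fst x) + \<bar>a x\<bar> * layer l (snd x))) integrable_on half_cell"
    by (intro integrable_on_box continuous_intros w collar_cont C1_cont[OF s(2)] C1_cont[OF s(3)]; simp)+
  have "integral half_cell w = integral half_cell (\<lambda>x. w x * ?phi x + w x * collar l x)"
    by (simp add: collar_def algebra_simps)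
  also have "\<dots> = integral half_cell (\<lambda>x. w x * ?phi x) + integral half_cell (\<lambda>x. w x * collar l x)"
    by (rule integral_add[OF int(1,4)])
  finally have split: "integral half_cell w = integral half_cell (\<lambda>x. w x * ?phi x) + integral half_cell (\<lambda>x. w x * collar l x)" .
  have "integral half_cell (\<lambda>x. w x * ?phi x) = integral half_cell (\<lambda>x. - ?F x)"
    using zero integral_add[OF int(1,2)] by simp
  also have "\<dots> \<le> integral half_cell (\<lambda>x. l * (\<bar>b x\<bar> * layer l (fst x) + \<bar>a x\<bar> * layer l (snd x)))"
  proof (rule integral_le[OF int(3,6)])
    fix x assume x: "x \<in> half_cell"
    have z: "0 < ?z1 x \<and> ?z1 x \<le> 1" "0 < ?z2 x \<and> ?z2 x \<le> 1"
      using x by (cases x; intro layer_bounds l; simp)+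
    have key: "\<bar>c * (k * z * (1 - z'))\<bar> \<le> \<bar>c\<bar> * z" if "\<bar>k\<bar> \<le> 1" "0 < z" "0 < z'" "z' \<le> 1" for c k z z' :: real
    proof -
      have "\<bar>k\<bar> * (z * (1 - z')) \<le> 1 * (z * 1)"
        using that by (intro mult_mono) auto
      then have "\<bar>c\<bar> * (\<bar>k\<bar> * (z * (1 - z'))) \<le> \<bar>c\<bar> * z" by (intro mult_left_mono) auto
      then show ?thesis using that by (simp add: abs_mult mult.assoc)
    qed
    have "- (b x * (cos (fst x) * ?z1 x * (1 - ?z2 x)) - a x * (cos (snd x) * ?z2 x * (1 - ?z1 x))) \<le>
        \<bar>b x\<bar> * ?z1 x + \<bar>a x\<bar> * ?z2 x"
      using key[of "cos (fst x)" "?z1 x" "?z2 x" "b x"] key[of "cos (snd x)" "?z2 x" "?z1 x" "a x"] z by auto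
    from mult_left_mono[OF this less_imp_le[OF l]]
    show "- ?F x \<le> l * (\<bar>b x\<bar> * ?z1 x + \<bar>a x\<bar> * ?z2 x)" by (simp only: mult_minus_right)
  qed
  finally have "integral half_cell (\<lambda>x. w x * ?phi x) \<le>
      integral half_cell (\<lambda>x. l * (\<bar>b x\<bar> * layer l (fst x) + \<bar>a x\<bar> * layer l (snd x)))" .
  moreover have "integral half_cell (\<lambda>x. w x * collar l x) \<le> integral half_cell (\<lambda>x. \<bar>w x\<bar> * collar l x)"
    by (rule integral_le[OF int(4,5)]) (use collar_bounds(1)[OF l] in \<open>auto intro!: mult_right_mono\<close>)
  ultimately show ?thesis unfolding split by (rule add_mono)
qed

text \<open>The parameter \<open>m\<close> balances the two terms of Young's inequality; the boundary layer has area of order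
  \<open>1 / l\<close>, which turns \<open>m l\<^sup>2\<close> into \<open>m l\<close>.\<close>

lemma collar_velocity_L2:
  assumes a: "continuous_on strip a" and b: "continuous_on strip b" and l: "0 < l" and m: "0 < m"
    and K: "integral cell (\<lambda>x. a x * a x) + integral cell (\<lambda>x. b x * b x) \<le> K"
  shows "integral half_cell (\<lambda>x. l * (\<bar>b x\<bar> * layer l (fst x) + \<bar>a x\<bar> * layer l (snd x))) \<le> K / (2 * m) + 2 * pi\<^sup>2 * m * l"
proof -
  have ptw: "l * (v * z) \<le> v * v / (2 * m) + m * l\<^sup>2 / 2 * z" if "0 < z" "z \<le> 1" for v z :: real
  proof -
    have "0 \<le> (v - m * l * z)\<^sup>2 / (2 * m)" using m by simp
    also have "\<dots> = v * v / (2 * m) - l * (v * z) + m * l\<^sup>2 / 2 * (z * z)"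
      using m by (simp add: power2_eq_square field_simps)
    also have "z * z \<le> z" using that by (simp add: mult_left_le_one_le)
    then have "m * l\<^sup>2 / 2 * (z * z) \<le> m * l\<^sup>2 / 2 * z" using m by (intro mult_left_mono) auto
    finally show ?thesis by linarith
  qed
  have ia: "(\<lambda>x. a x * a x) integrable_on cell" "(\<lambda>x. a x * a x) integrable_on half_cell"
    and ib: "(\<lambda>x. b x * b x) integrable_on cell" "(\<lambda>x. b x * b x) integrable_on half_cell"
    and il: "(\<lambda>x. layer l (fst x)) integrable_on half_cell" "(\<lambda>x. layer l (snd x)) integrable_on half_cell"
    and i: "(\<lambda>x. l * (\<bar>b x\<bar> * layer l (fst x) + \<bar>a x\<bar> * layer l (snd x))) integrable_on half_cell"
    by (intro integrable_on_box continuous_intros a b; simp)+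
  have "integral half_cell (\<lambda>x. l * (\<bar>b x\<bar> * layer l (fst x) + \<bar>a x\<bar> * layer l (snd x))) \<le>
      integral half_cell (\<lambda>x. (a x * a x + b x * b x) * (1 / (2 * m)) +
        m * l\<^sup>2 / 2 * (layer l (fst x) + layer l (snd x)))"
  proof (rule integral_le[OF i])
    show "(\<lambda>x. (a x * a x + b x * b x) * (1 / (2 * m)) + m * l\<^sup>2 / 2 * (layer l (fst x) + layer l (snd x)))
        integrable_on half_cell"
      by (intro integrable_add integrable_on_mult_right integrable_on_mult_left ia ib il)
    fix x assume "x \<in> half_cell"
    then have "0 < layer l (fst x) \<and> layer l (fst x) \<le> 1" "0 < layer l (snd x) \<and> layer l (snd x) \<le> 1"
      by (cases x; intro layer_bounds l; simp)+
    then have "l * (\<bar>b x\<bar> * layer l (fst x)) \<le> \<bar>b x\<bar> * \<bar>b x\<bar> / (2 * m) + m * l\<^sup>2 / 2 * layer l (fst x)"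
      "l * (\<bar>a x\<bar> * layer l (snd x)) \<le> \<bar>a x\<bar> * \<bar>a x\<bar> / (2 * m) + m * l\<^sup>2 / 2 * layer l (snd x)"
      using ptw by blast+
    then show "l * (\<bar>b x\<bar> * layer l (fst x) + \<bar>a x\<bar> * layer l (snd x)) \<le>
        (a x * a x + b x * b x) * (1 / (2 * m)) + m * l\<^sup>2 / 2 * (layer l (fst x) + layer l (snd x))"
      by (simp add: distrib_left distrib_right add_divide_distrib)
  qed
  also have "\<dots> = (integral half_cell (\<lambda>x. a x * a x) + integral half_cell (\<lambda>x. b x * b x)) * (1 / (2 * m)) +
      m * l\<^sup>2 / 2 * (integral half_cell (\<lambda>x. layer l (fst x)) + integral half_cell (\<lambda>x. layer l (snd x)))"
    by (intro integral_unique has_integral_add has_integral_mult_right has_integral_mult_left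
        integrable_integral ia ib il)
  also have "\<dots> \<le> K * (1 / (2 * m)) + m * l\<^sup>2 / 2 * (4 * pi\<^sup>2 / l)"
  proof (intro add_mono mult_right_mono mult_left_mono)
    have "integral half_cell (\<lambda>x. a x * a x) \<le> integral cell (\<lambda>x. a x * a x)"
      "integral half_cell (\<lambda>x. b x * b x) \<le> integral cell (\<lambda>x. b x * b x)"
      by (intro integral_subset_le ia ib half_cell_subset_cell; simp)+
    then show "integral half_cell (\<lambda>x. a x * a x) + integral half_cell (\<lambda>x. b x * b x) \<le> K" using K by linarith
    show "integral half_cell (\<lambda>x. layer l (fst x)) + integral half_cell (\<lambda>x. layer l (snd x)) \<le> 4 * pi\<^sup>2 / l"
      using layer_integral_half_cell[OF l] by simp
  qed (use m in auto)
  also have "\<dots> = K / (2 * m) + 2 * pi\<^sup>2 * m * l" using l by (simp add: power2_eq_square)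
  finally show ?thesis .
qed

lemma collar_velocity_Linf:
  assumes a: "continuous_on strip a" and b: "continuous_on strip b" and l: "0 < l"
    and U: "\<And>x. x \<in> half_cell \<Longrightarrow> \<bar>a x\<bar> \<le> U \<and> \<bar>b x\<bar> \<le> U"
  shows "integral half_cell (\<lambda>x. l * (\<bar>b x\<bar> * layer l (fst x) + \<bar>a x\<bar> * layer l (snd x))) \<le> 4 * pi\<^sup>2 * U"
proof -
  have il: "(\<lambda>x. layer l (fst x)) integrable_on half_cell" "(\<lambda>x. layer l (snd x)) integrable_on half_cell"
    and i: "(\<lambda>x. l * (\<bar>b x\<bar> * layer l (fst x) + \<bar>a x\<bar> * layer l (snd x))) integrable_on half_cell"
    by (intro integrable_on_box continuous_intros a b; simp)+
  have "(0, 0) \<in> half_cell" by simp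
  from U[OF this] have U0: "0 \<le> U" by linarith
  have "integral half_cell (\<lambda>x. l * (\<bar>b x\<bar> * layer l (fst x) + \<bar>a x\<bar> * layer l (snd x))) \<le>
      integral half_cell (\<lambda>x. l * U * (layer l (fst x) + layer l (snd x)))"
  proof (rule integral_le[OF i])
    show "(\<lambda>x. l * U * (layer l (fst x) + layer l (snd x))) integrable_on half_cell"
      by (intro integrable_add integrable_on_mult_right il)
    fix x assume "x \<in> half_cell"
    then have "\<bar>b x\<bar> * layer l (fst x) + \<bar>a x\<bar> * layer l (snd x) \<le> U * layer l (fst x) + U * layer l (snd x)"
      using U by (intro add_mono mult_right_mono) auto
    from mult_left_mono[OF this less_imp_le[OF l]]
    show "l * (\<bar>b x\<bar> * layer l (fst x) + \<bar>a x\<bar> * layer l (snd x)) \<le> l * U * (layer l (fst x) + layer l (snd x))"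
      by (simp add: distrib_left mult.assoc)
  qed
  also have "\<dots> = l * U * (integral half_cell (\<lambda>x. layer l (fst x)) + integral half_cell (\<lambda>x. layer l (snd x)))"
    by (intro integral_unique has_integral_add has_integral_mult_right integrable_integral il)
  also have "\<dots> \<le> l * U * (4 * pi\<^sup>2 / l)"
    using layer_integral_half_cell[OF l] l U0 by (intro mult_left_mono) auto
  also have "\<dots> = 4 * pi\<^sup>2 * U" using l by simp
  finally show ?thesis .
qed

text \<open>The width \<open>1 / l\<close> of the layer is chosen such that the energy bound \<open>K\<close> accounts for at most half
  of the circulation; the other half has to be carried by the vorticity in the layer.\<close>

lemma circulation_Lp:
  assumes u: "stream_flow w \<psi> a b" and w: "continuous_on strip w"
    and K: "integral cell (\<lambda>x. a x * a x) + integral cell (\<lambda>x. b x * b x) \<le> K" "0 < K"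
    and B: "0 < B" "B \<le> integral half_cell w" and p: "1 \<le> p"
  shows "B / 4 * (B\<^sup>2 / (64 * pi ^ 4 * K)) powr (1 - real_of_ereal (2 / p) / 2) \<le> Lp_norm p w"
proof -
  define l where "l = B\<^sup>2 / (16 * pi\<^sup>2 * K)"
  define m where "m = 2 * K / B"
  have l: "0 < l" and m: "0 < m" using B K by (auto simp: l_def m_def)
  note s = stream_flowD[OF u]
  have "K / (2 * m) + 2 * pi\<^sup>2 * m * l = B / 2"
    using B K by (simp add: l_def m_def power2_eq_square field_simps)
  then have "integral half_cell w \<le> B / 2 + integral half_cell (\<lambda>x. \<bar>w x\<bar> * collar l x)"
    using circulation_collar[OF u l w] collar_velocity_L2[OF C1_cont[OF s(2)] C1_cont[OF s(3)] l m K(1)]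
    by linarith
  with B have half: "B / 2 \<le> integral half_cell (\<lambda>x. \<bar>w x\<bar> * collar l x)" by linarith
  have "B / 4 * (1 / (4 * pi\<^sup>2 / l)) powr (1 - real_of_ereal (2 / p) / 2) \<le> Lp_norm p w"
    by (rule Lp_norm_concentration[OF w collar_cont _ collar_integral[OF l] _ B(1) half p])
      (use collar_bounds(1,2)[OF l] l in auto)
  moreover have "1 / (4 * pi\<^sup>2 / l) = B\<^sup>2 / (64 * pi ^ 4 * K)"
    by (simp add: l_def power2_eq_square power4_eq_xxxx)
  ultimately show ?thesis by simp
qed

text \<open>As the layer shrinks, the vorticity in it contributes nothing, and the weighted velocity integral
  stays bounded by the maximum of the velocity.\<close>

lemma circulation_velocity:
  assumes u: "stream_flow w \<psi> a b" and w: "continuous_on strip w"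
    and U: "\<And>x. x \<in> half_cell \<Longrightarrow> \<bar>a x\<bar> \<le> U \<and> \<bar>b x\<bar> \<le> U"
  shows "integral half_cell w \<le> 4 * pi\<^sup>2 * U"
proof (rule field_le_epsilon)
  fix e :: real assume e: "0 < e"
  note s = stream_flowD[OF u]
  obtain W' where W': "\<And>x. x \<in> cell \<Longrightarrow> norm (w x) \<le> W'" using norm_bound_on_cell[OF w] by blast
  \<comment> \<open>adding 1 makes l positive also for vanishing vorticity\<close>
  define W where "W = \<bar>W'\<bar> + 1"
  have W: "0 < W" by (simp add: W_def)
  have wW: "\<bar>w x\<bar> \<le> W" if "x \<in> half_cell" for x
    using W'[of x] that half_cell_subset_cell by (auto simp: W_def)
  define l where "l = 4 * pi\<^sup>2 * W / e"
  have l: "0 < l" using W e by (simp add: l_def)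
  have "integral half_cell (\<lambda>x. \<bar>w x\<bar> * collar l x) \<le> integral half_cell (\<lambda>x. W * collar l x)"
  proof (rule integral_le)
    show "(\<lambda>x. \<bar>w x\<bar> * collar l x) integrable_on half_cell" "(\<lambda>x. W * collar l x) integrable_on half_cell"
      by (intro integrable_on_box continuous_intros w collar_cont; simp)+
  qed (use wW collar_bounds(1)[OF l] in \<open>auto intro!: mult_right_mono\<close>)
  also have "\<dots> = W * integral half_cell (collar l)" by simp
  also have "\<dots> \<le> W * (4 * pi\<^sup>2 / l)" using collar_integral[OF l] W by (intro mult_left_mono) auto
  also have "\<dots> = e" using W e by (simp add: l_def)
  finally show "integral half_cell w \<le> 4 * pi\<^sup>2 * U + e"
    using circulation_collar[OF u l w] collar_velocity_Linf[OF C1_cont[OF s(2)] C1_cont[OF s(3)] l U] by linarith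
qed

section \<open>Bounds for solutions in terms of the initial data\<close>

text \<open>The initial velocity enters the constants only through its energy, which the vorticity determines:
  by the symmetry of the pairing both energies equal the mixed product \<open>\<integral> u \<cdot> u'\<close>.\<close>

lemma kinetic_energy_determined:
  assumes 1: "stream_flow w \<psi> a b" and 2: "stream_flow w' \<psi>' a' b'"
    and eq: "\<And>x. x \<in> strip \<Longrightarrow> w x = w' x"
  shows "integral cell (\<lambda>x. a x * a x) + integral cell (\<lambda>x. b x * b x) =
    integral cell (\<lambda>x. a' x * a' x) + integral cell (\<lambda>x. b' x * b' x)"
proof -
  note s = stream_flowD[OF 1] and s' = stream_flowD[OF 2]
  have i: "f integrable_on cell" if "C1_Omega f" for f
    by (intro integrable_on_box C1_cont that) auto
  have cong: "integral cell (\<lambda>x. p x * w x) = integral cell (\<lambda>x. p x * w' x)" for p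
    by (rule integral_cong) (use eq cell_subset_strip in auto)
  have "integral cell (\<lambda>x. a x * a x + b x * b x) = integral cell (\<lambda>x. a' x * a x + b' x * b x)"
    using stream_function_parts[OF 1 1] stream_function_parts[OF 1 2] cong by (simp add: mult.commute)
  also have "\<dots> = integral cell (\<lambda>x. a' x * a' x + b' x * b' x)"
    using stream_function_parts[OF 2 1] stream_function_parts[OF 2 2] cong by simp
  finally show ?thesis using s s' by (simp add: integral_add i)
qed

lemma transported_bound:
  assumes f: "evolves t1 f (\<lambda>t x. - (a t x * partial1 (f t) x + b t x * partial2 (f t) x) - g t x)"
    and walls: "\<And>t x. t \<in> {0..t1} \<Longrightarrow> b t (x, 0) = 0 \<and> b t (x, pi) = 0"
    and g: "\<And>t x. t \<in> {0..t1} \<Longrightarrow> x \<in> cell \<Longrightarrow> \<bar>g t x\<bar> \<le> G"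
    and M: "\<And>x. x \<in> cell \<Longrightarrow> \<bar>f 0 x\<bar> \<le> M"
    and t: "t \<in> {0..t1}" and x: "x \<in> strip"
  shows "\<bar>f t x\<bar> \<le> M + G * t"
proof -
  have C: "C1_Omega (f t)" if "t \<in> {0..t1}" for t by (rule evolvesD(1)[OF f that])
  have "f t x \<le> M + G * t"
  proof (rule transport_max_principle[OF _ walls _ _ t x])
    show "evolves t1 f (\<lambda>t x. - (a t x * partial1 (f t) x + b t x * partial2 (f t) x) + - g t x)"
      using f by simp
  qed (use g M in \<open>force simp: abs_le_iff\<close>)+
  moreover have "- f t x \<le> M + G * t"
  proof (rule transport_max_principle[where f="\<lambda>t x. - f t x", OF _ walls _ _ t x])
    show "evolves t1 (\<lambda>t x. - f t x)
        (\<lambda>t x. - (a t x * partial1 (\<lambda>x. - f t x) x + b t x * partial2 (\<lambda>x. - f t x) x) + g t x)"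
      by (rule evolves_cong[OF evolves_uminus[OF f]]) (use C in \<open>simp del: mem_strip\<close>)
  qed (use g M in \<open>force simp: abs_le_iff\<close>)+
  ultimately show ?thesis by linarith
qed

lemma classical_walls:
  assumes "classical_solution t1 \<rho> \<omega> a b" "t \<in> {0..t1}"
  shows "b t (x, 0) = 0 \<and> b t (x, pi) = 0"
  using assms stream_flow_walls unfolding classical_solution_def by blast

lemma kinetic_energy_bound:
  assumes c: "classical_solution t1 \<rho> \<omega> a b" and t1: "0 < t1"
    and M: "\<And>x. x \<in> cell \<Longrightarrow> \<bar>\<rho> 0 x\<bar> \<le> M" and t: "t \<in> {0..t1}"
  shows "integral cell (\<lambda>x. a t x * a t x) + integral cell (\<lambda>x. b t x * b t x) \<le>
    integral cell (\<lambda>x. a 0 x * a 0 x) + integral cell (\<lambda>x. b 0 x * b 0 x) + 8 * pi ^ 3 * M"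
proof -
  have r: "evolves t1 \<rho> (\<lambda>t x. - (a t x * partial1 (\<rho> t) x + b t x * partial2 (\<rho> t) x))"
    using c by (auto simp: classical_solution_def)
  have bound: "\<bar>\<rho> t x\<bar> \<le> M" if "t \<in> {0..t1}" "x \<in> strip" for t x
    using transported_bound[of t1 \<rho> a b "\<lambda>_ _. 0" 0 M t x] r classical_walls[OF c] M that by simp
  have pot: "\<bar>integral cell (\<lambda>x. snd x * \<rho> s x)\<bar> \<le> 2 * pi ^ 3 * M" if s: "s \<in> {0..t1}" for s
  proof -
    have "C1_Omega (\<rho> s)" by (rule evolvesD(1)[OF r s])
    then have i: "(\<lambda>x. snd x * \<rho> s x) integrable_on cell"
      by (intro integrable_on_box C1_cont) auto
    have "norm (integral cell (\<lambda>x. snd x * \<rho> s x)) \<le> integral cell (\<lambda>x. pi * M)"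
    proof (rule integral_norm_bound_integral[OF i])
      fix x assume x: "x \<in> cell"
      then have "x \<in> strip" "\<bar>snd x\<bar> \<le> pi" using cell_subset_strip by (cases x; auto)+
      then have "\<bar>snd x\<bar> * \<bar>\<rho> s x\<bar> \<le> pi * M"
        using bound[OF s] by (intro mult_mono) auto
      then show "norm (snd x * \<rho> s x) \<le> pi * M" by (simp add: abs_mult)
    qed (rule integrable_const)
    also have "\<dots> = 2 * pi ^ 3 * M"
      by (simp add: content_Pair power3_eq_cube)
    finally show ?thesis by simp
  qed
  show ?thesis using energy_conservation[OF c t1 t] pot[OF t] pot[of 0] t1
    by (simp add: abs_le_iff)
qed

lemma density_on_sides:
  assumes c: "classical_solution t1 \<rho> \<omega> a b" and t1: "0 < t1"
    and sides: "\<And>t y. t \<in> {0..t1} \<Longrightarrow> 0 \<le> y \<Longrightarrow> y \<le> pi \<Longrightarrow> a t (0, y) = 0 \<and> a t (pi, y) = 0"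
    and init: "\<And>y. 0 \<le> y \<Longrightarrow> y \<le> pi \<Longrightarrow> k0 \<le> \<rho> 0 (0, y) \<and> \<rho> 0 (pi, y) \<le> 0"
    and t: "t \<in> {0..t1}" and y: "0 \<le> y" "y \<le> pi"
  shows "k0 \<le> \<rho> t (0, y) \<and> \<rho> t (pi, y) \<le> 0"
proof -
  have r: "evolves t1 \<rho> (\<lambda>t x. - (a t x * partial1 (\<rho> t) x + b t x * partial2 (\<rho> t) x))"
    using c by (auto simp: classical_solution_def)
  have r': "evolves t1 (\<lambda>t x. - \<rho> t x)
      (\<lambda>t x. - (a t x * partial1 (\<lambda>x. - \<rho> t x) x + b t x * partial2 (\<lambda>x. - \<rho> t x) x))"
    by (rule evolves_cong[OF evolves_uminus[OF r]]) (use evolvesD(1)[OF r] in \<open>simp del: mem_strip\<close>)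
  have "\<rho> t (pi, y) \<le> 0"
    by (rule column_max_principle[OF r classical_walls[OF c] _ _ t y]) (use sides init in auto)
  moreover have "- \<rho> t (0, y) \<le> - k0"
    by (rule column_max_principle[OF r' classical_walls[OF c] _ _ t y]) (use sides init in auto)
  ultimately show ?thesis by simp
qed

lemma grad_continuous: "C1_Omega f \<Longrightarrow> continuous_on strip (grad f)"
  unfolding grad_def[abs_def] by (intro continuous_on_Pair C1_cont1 C1_cont2)

lemma grad_ge_partial1: "\<bar>partial1 f x\<bar> \<le> norm (grad f x)"
  using norm_fst_le[of "partial1 f x" "partial2 f x"] by (simp add: grad_def)

text \<open>Mean value theorem along the bottom wall, from one side of the half cell to the other.\<close>

lemma grad_norm_ge:
  assumes f: "C1_Omega f" and k: "k0 \<le> f (0, 0)" "f (pi, 0) \<le> 0"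
  shows "k0 / pi \<le> Lp_norm \<infinity> (grad f)"
proof -
  have "\<exists>z>0. z < pi \<and> f (pi, 0) - f (0, 0) = (pi - 0) * partial1 f (z, 0)"
    by (rule MVT2[of 0 pi "\<lambda>s. f (s, 0)"]) (auto intro: C1_DERIV1[OF f])
  then obtain z where z: "0 < z" "z < pi" "f (pi, 0) - f (0, 0) = pi * partial1 f (z, 0)" by auto
  have "k0 \<le> pi * \<bar>partial1 f (z, 0)\<bar>" using z(3) k pi_gt_zero
    by (smt (verit) mult_minus_right abs_of_nonpos abs_of_nonneg mult_nonneg_nonneg)
  then have "k0 / pi \<le> \<bar>partial1 f (z, 0)\<bar>" by (simp add: field_simps)
  also have "\<dots> \<le> norm (grad f (z, 0))" by (rule grad_ge_partial1)
  also have "\<dots> \<le> Lp_norm \<infinity> (grad f)" by (rule Linf_norm(1)[OF grad_continuous[OF f]]) (use z in auto)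
  finally show ?thesis .
qed

lemma powr_combine:
  fixes t c h q :: real
  assumes t: "0 < t" and c: "0 < c" and h: "0 < h" and q: "0 \<le> q" "q \<le> 2"
  shows "c / 4 * min 1 h * t powr (3 - q) \<le> c * t / 4 * (h * t\<^sup>2) powr (1 - q / 2)"
proof -
  have "min 1 h \<le> h powr (1 - q / 2)"
  proof (cases "1 \<le> h")
    case True
    then show ?thesis using ge_one_powr_ge_zero[of h "1 - q / 2"] q by simp
  next
    case False
    then have "h powr 1 \<le> h powr (1 - q / 2)" using h q by (intro powr_mono') auto
    then show ?thesis using False h by simp
  qed
  moreover have "t * (t\<^sup>2) powr (1 - q / 2) = t powr (3 - q)"
  proof -
    have "t * (t\<^sup>2) powr (1 - q / 2) = t powr 1 * (t powr 2) powr (1 - q / 2)" using t by simp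
    also have "\<dots> = t powr (1 + 2 * (1 - q / 2))" by (simp only: powr_powr powr_add)
    also have "1 + 2 * (1 - q / 2) = 3 - q" by simp
    finally show ?thesis .
  qed
  moreover have "c * t / 4 * (h * t\<^sup>2) powr (1 - q / 2) = c / 4 * (h powr (1 - q / 2) * (t * (t\<^sup>2) powr (1 - q / 2)))"
    by (simp add: powr_mult)
  ultimately show ?thesis using c by (simp add: mult_right_mono)
qed

text \<open>Everything the lower bounds use about a solution at time \<open>t\<close>, in terms of bounds \<open>M\<close>, \<open>W\<close>, \<open>K0\<close> of the
  data. The final item turns growth of the vorticity into growth of the density gradient: \<open>\<partial>\<^sub>1\<rho>\<close> is the
  only source in the vorticity equation.\<close>

lemma boussinesq_a_priori:
  assumes sol: "boussinesq_solution T \<rho>0 \<omega>0 \<rho> \<omega> u" and t: "0 \<le> t" "ereal t < T"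
    and even: "x1_even \<rho>0" and odd: "x1_odd \<omega>0"
    and left: "\<forall>y\<in>{0..pi}. k0 \<le> \<rho>0 (0, y)" and right: "\<forall>y\<in>{0..pi}. \<rho>0 (pi, y) \<le> 0"
    and M: "\<forall>x\<in>cell. \<bar>\<rho>0 x\<bar> \<le> M" and W: "\<forall>x\<in>cell. \<bar>\<omega>0 x\<bar> \<le> W"
    and K0: "\<forall>\<psi> a b. stream_flow \<omega>0 \<psi> a b \<longrightarrow>
      integral cell (\<lambda>x. a x * a x) + integral cell (\<lambda>x. b x * b x) \<le> K0"
  shows "\<exists>\<psi>. stream_flow (\<omega> t) \<psi> (\<lambda>x. fst (u t x)) (\<lambda>x. snd (u t x))"
    and "C1_Omega (\<omega> t)"
    and "integral half_cell \<omega>0 + k0 * pi * t \<le> integral half_cell (\<omega> t)"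
    and "integral cell (\<lambda>x. fst (u t x) * fst (u t x)) + integral cell (\<lambda>x. snd (u t x) * snd (u t x)) \<le>
      K0 + 8 * pi ^ 3 * M"
    and "k0 / pi \<le> Lp_norm \<infinity> (grad (\<rho> t))"
    and "\<exists>G. \<forall>\<tau>\<in>{0..t}. Lp_norm \<infinity> (grad (\<rho> \<tau>)) \<le> G"
    and "\<And>G. (\<And>\<tau>. \<tau> \<in> {0..t} \<Longrightarrow> Lp_norm \<infinity> (grad (\<rho> \<tau>)) \<le> G) \<Longrightarrow> Lp_norm \<infinity> (\<omega> t) \<le> W + G * t"
proof -
  obtain t1 where t1: "t < t1" "ereal t1 < T"
    using ereal_dense2[OF t(2)] by auto
  have pos: "0 < t1" and tI: "t \<in> {0..t1}" and 0: "0 \<in> {0..t1}" using t t1 by auto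
  let ?a = "\<lambda>t x. fst (u t x)" and ?b = "\<lambda>t x. snd (u t x)"
  have c: "classical_solution t1 \<rho> \<omega> ?a ?b"
    by (rule boussinesq_imp_classical[OF sol pos t1(2)])
  have r: "evolves t1 \<rho> (\<lambda>t x. - (?a t x * partial1 (\<rho> t) x + ?b t x * partial2 (\<rho> t) x))"
    and w: "evolves t1 \<omega> (\<lambda>t x. - (?a t x * partial1 (\<omega> t) x + ?b t x * partial2 (\<omega> t) x) - partial1 (\<rho> t) x)"
    using c by (auto simp: classical_solution_def)
  have init: "\<rho> 0 x = \<rho>0 x" "\<omega> 0 x = \<omega>0 x" if "x \<in> strip" for x
    using sol that by (auto simp: boussinesq_solution_def)
  have cell_strip: "x \<in> strip" if "x \<in> cell" for x using that cell_subset_strip by auto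
  have sides: "?a s (0, y) = 0 \<and> ?a s (pi, y) = 0" if "s \<in> {0..t1}" "0 \<le> y" "y \<le> pi" for s y
  proof -
    have sym: "\<rho> 0 (mirror x) = \<rho> 0 x" "\<omega> 0 (mirror x) = - \<omega> 0 x" if "x \<in> strip" for x
      using that even odd init by (auto simp: x1_even_def x1_odd_def)
    show ?thesis
      by (intro conjI no_flow_through_sides[OF c pos _ _ that]) (rule sym, assumption)+
  qed
  have dens: "k0 \<le> \<rho> s (0, y) \<and> \<rho> s (pi, y) \<le> 0" if "s \<in> {0..t1}" "0 \<le> y" "y \<le> pi" for s y
    by (rule density_on_sides[OF c pos sides _ that]) (use left right init in auto)
  have flow: "\<exists>\<psi>. stream_flow (\<omega> s) \<psi> (?a s) (?b s)" if "s \<in> {0..t1}" for s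
    using c that by (auto simp: classical_solution_def)
  show "\<exists>\<psi>. stream_flow (\<omega> t) \<psi> (?a t) (?b t)" by (rule flow[OF tI])
  show "C1_Omega (\<omega> t)" by (rule evolvesD(1)[OF w tI])
  have "integral half_cell (\<omega> 0) = integral half_cell \<omega>0"
    by (rule integral_cong) (use init half_cell_subset_strip in \<open>auto simp del: mem_strip\<close>)
  then show "integral half_cell \<omega>0 + k0 * pi * t \<le> integral half_cell (\<omega> t)"
    using vorticity_growth[OF c sides dens tI] by simp
  obtain \<psi>0 where \<psi>0: "stream_flow (\<omega> 0) \<psi>0 (?a 0) (?b 0)" using flow[OF 0] by blast
  then have "stream_flow \<omega>0 \<psi>0 (?a 0) (?b 0)"
    using init by (auto simp: stream_flow_def)
  then have init_energy: "integral cell (\<lambda>x. ?a 0 x * ?a 0 x) + integral cell (\<lambda>x. ?b 0 x * ?b 0 x) \<le> K0"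
    by (rule K0[rule_format])
  have init_bound: "\<bar>\<rho> 0 x\<bar> \<le> M" if "x \<in> cell" for x
    using bspec[OF M that] init[OF cell_strip[OF that]] by simp
  show "integral cell (\<lambda>x. ?a t x * ?a t x) + integral cell (\<lambda>x. ?b t x * ?b t x) \<le> K0 + 8 * pi ^ 3 * M"
    by (rule order_trans[OF kinetic_energy_bound[OF c pos _ tI] add_right_mono[OF init_energy]])
      (rule init_bound)
  show "k0 / pi \<le> Lp_norm \<infinity> (grad (\<rho> t))"
    by (rule grad_norm_ge[OF evolvesD(1)[OF r tI]]) (use dens[OF tI, of 0] in auto)
  have gc: "continuous_on strip (grad (\<rho> s))" if "s \<in> {0..t1}" for s
    by (rule grad_continuous[OF evolvesD(1)[OF r that]])
  show "\<exists>G. \<forall>\<tau>\<in>{0..t}. Lp_norm \<infinity> (grad (\<rho> \<tau>)) \<le> G"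
  proof -
    obtain P where "0 \<le> P" and P: "\<And>s x. s \<in> {0..t1} \<Longrightarrow> x \<in> cell \<Longrightarrow> \<bar>partial1 (\<rho> s) x\<bar> \<le> P"
      using continuous_bound[where f="\<lambda>t. partial1 (\<rho> t)", OF evolvesD(5)[OF r]] by blast
    obtain Q where "0 \<le> Q" and Q: "\<And>s x. s \<in> {0..t1} \<Longrightarrow> x \<in> cell \<Longrightarrow> \<bar>partial2 (\<rho> s) x\<bar> \<le> Q"
      using continuous_bound[where f="\<lambda>t. partial2 (\<rho> t)", OF evolvesD(6)[OF r]] by blast
    have "Lp_norm \<infinity> (grad (\<rho> s)) \<le> P + Q" if s: "s \<in> {0..t}" for s
    proof (rule Linf_norm(2))
      have sI: "s \<in> {0..t1}" using s t1 by auto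
      show "continuous_on strip (grad (\<rho> s))" by (rule gc[OF sI])
      fix x assume x: "x \<in> cell"
      have "norm (grad (\<rho> s) x) \<le> \<bar>partial1 (\<rho> s) x\<bar> + \<bar>partial2 (\<rho> s) x\<bar>"
        using norm_Pair_le[of "partial1 (\<rho> s) x" "partial2 (\<rho> s) x"] by (simp add: grad_def)
      then show "norm (grad (\<rho> s) x) \<le> P + Q" using P[OF sI x] Q[OF sI x] by linarith
    qed
    then show ?thesis by blast
  qed
  show "Lp_norm \<infinity> (\<omega> t) \<le> W + G * t"
    if G: "\<And>\<tau>. \<tau> \<in> {0..t} \<Longrightarrow> Lp_norm \<infinity> (grad (\<rho> \<tau>)) \<le> G" for G
  proof (rule Linf_norm(2)[OF C1_cont[OF evolvesD(1)[OF w tI]]])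
    have c': "classical_solution t \<rho> \<omega> ?a ?b" if "0 < t"
      by (rule boussinesq_imp_classical[OF sol that t(2)])
    fix x assume x: "x \<in> cell"
    show "norm (\<omega> t x) \<le> W + G * t"
    proof (cases "t = 0")
      case True
      then show ?thesis using bspec[OF W x] init[OF cell_strip[OF x]] by simp
    next
      case False
      then have tp: "0 < t" using t by simp
      have "\<bar>\<omega> t x\<bar> \<le> W + G * t"
      proof (rule transported_bound[where a="?a" and b="?b" and g="\<lambda>s. partial1 (\<rho> s)" and ?t1.0=t])
        show "evolves t \<omega> (\<lambda>t x. - (?a t x * partial1 (\<omega> t) x + ?b t x * partial2 (\<omega> t) x) - partial1 (\<rho> t) x)"
          using c'[OF tp] by (auto simp: classical_solution_def)
        show "?b s (x1, 0) = 0 \<and> ?b s (x1, pi) = 0" if "s \<in> {0..t}" for s x1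
          by (rule classical_walls[OF c'[OF tp] that])
        show "\<bar>partial1 (\<rho> s) y\<bar> \<le> G" if s: "s \<in> {0..t}" and y: "y \<in> cell" for s y
        proof -
          have "s \<in> {0..t1}" using s t1 by auto
          from Linf_norm(1)[OF gc[OF this] y] G[OF s] grad_ge_partial1[of "\<rho> s" y]
          show ?thesis by linarith
        qed
        show "\<bar>\<omega> 0 y\<bar> \<le> W" if "y \<in> cell" for y
          using bspec[OF W that] init[OF cell_strip[OF that]] by simp
      qed (use t cell_strip[OF x] in auto)
      then show ?thesis by simp
    qed
  qed
qed

theorem theorem1p4:
  fixes \<rho>0 \<omega>0 :: "real \<times> real \<Rightarrow> real" and k0 :: real
  assumes "smooth_Omega \<rho>0" and "x1_even \<rho>0"
    and "smooth_Omega \<omega>0" and "x1_odd \<omega>0"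
    and "k0 > 0"
    and "\<forall>x2\<in>{0..pi}. \<rho>0 (0, x2) \<ge> k0"
    and "\<forall>x2\<in>{0..pi}. \<rho>0 (pi, x2) \<le> 0"
  shows "\<exists>(T0::real) (c::real). T0 \<ge> 0 \<and> c > 0 \<and>
    ((LINT x:{0..pi} \<times> {0..pi}|lborel. \<omega>0 x) \<ge> 0 \<longrightarrow> T0 = 0) \<and>
    (\<forall>T \<rho> \<omega> u. T = lifespan \<rho>0 \<omega>0 \<longrightarrow> boussinesq_solution T \<rho>0 \<omega>0 \<rho> \<omega> u \<longrightarrow>
       (\<forall>(p::ereal) t. 1 \<le> p \<and> T0 \<le> t \<and> ereal t < T \<longrightarrow>
          Lp_norm p (\<omega> t) \<ge> c * t powr (3 - real_of_ereal (2 / p))) \<and>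
       (\<forall>t. T0 \<le> t \<and> ereal t < T \<longrightarrow> Lp_norm \<infinity> (u t) \<ge> c * t) \<and>
       (\<forall>t. 0 \<le> t \<and> ereal t < T \<longrightarrow>
          (SUP \<tau>\<in>{0..t}. Lp_norm \<infinity> (grad (\<rho> \<tau>))) > c * t\<^sup>2))"
proof -
  have cont: "continuous_on strip \<rho>0" "continuous_on strip \<omega>0"
    using assms by (auto intro: C1_cont smooth_Omega_C1)
  define A0 where "A0 = integral half_cell \<omega>0"
  have A0: "(LINT x:{0..pi} \<times> {0..pi}|lborel. \<omega>0 x) = A0"
  proof -
    have "set_integrable lborel half_cell \<omega>0"
      unfolding set_integrable_def
      by (rule borel_integrable_compact[OF compact_cbox continuous_on_subset[OF cont(2) half_cell_subset_strip]])
    then show ?thesis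
      using set_borel_integral_eq_integral(2)[of half_cell \<omega>0] by (simp add: A0_def cbox_Pair_eq)
  qed
  obtain M where M: "\<forall>x\<in>cell. \<bar>\<rho>0 x\<bar> \<le> M"
    using norm_bound_on_cell[OF cont(1)] unfolding real_norm_def by blast
  obtain W where W: "\<forall>x\<in>cell. \<bar>\<omega>0 x\<bar> \<le> W"
    using norm_bound_on_cell[OF cont(2)] unfolding real_norm_def by blast
  have "(0, 0) \<in> cell" by simp
  from bspec[OF M this] bspec[OF W this] have MW: "0 \<le> M" "0 \<le> W" by linarith+
  obtain K0 where K0: "0 \<le> K0" "\<forall>\<psi> a b. stream_flow \<omega>0 \<psi> a b \<longrightarrow>
      integral cell (\<lambda>x. a x * a x) + integral cell (\<lambda>x. b x * b x) \<le> K0"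
  proof (cases "\<exists>\<psi> a b. stream_flow \<omega>0 \<psi> a b")
    case True
    then obtain \<psi>' a' b' where s: "stream_flow \<omega>0 \<psi>' a' b'" by blast
    let ?K = "integral cell (\<lambda>x. a' x * a' x) + integral cell (\<lambda>x. b' x * b' x)"
    have "integral cell (\<lambda>x. a x * a x) + integral cell (\<lambda>x. b x * b x) \<le> \<bar>?K\<bar>"
      if "stream_flow \<omega>0 \<psi> a b" for \<psi> a b
      using kinetic_energy_determined[OF that s] by simp
    then show thesis using that[of "\<bar>?K\<bar>"] by simp
  next
    case False
    then show thesis using that[of 0] by auto
  qed
  define K where "K = K0 + 8 * pi ^ 3 * M + 1"
  have K: "0 < K" using K0(1) MW(1) by (simp add: K_def add_nonneg_pos)
  \<comment> \<open>once t exceeds T0, half of the growth k0 pi t makes up for a negative initial value A0\<close>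
  define T0 where "T0 = (if 0 \<le> A0 then 0 else - 2 * A0 / (k0 * pi))"
  define c0 where "c0 = k0 * pi / 2"
  have c0: "0 < c0" using assms(5) by (simp add: c0_def)
  have T0: "0 \<le> T0" using assms(5) by (auto simp: T0_def divide_nonpos_pos mult_nonpos_nonneg)
  have lin: "c0 * t \<le> A0 + k0 * pi * t" if "T0 \<le> t" for t
  proof (cases "0 \<le> A0")
    case True
    then have "0 \<le> t" using that T0 by linarith
    then have "0 \<le> c0 * t" using c0 by simp
    moreover have "k0 * pi * t = 2 * (c0 * t)" by (simp add: c0_def)
    ultimately show ?thesis using True by linarith
  next
    case False
    then have "- 2 * A0 / (k0 * pi) \<le> t" using that by (simp add: T0_def)
    moreover have "0 < k0 * pi" using assms(5) by simp
    ultimately have "- 2 * A0 \<le> t * (k0 * pi)" by (simp only: pos_divide_le_eq)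
    then have "- 2 * A0 \<le> k0 * pi * t" by (simp only: mult.commute)
    moreover have "k0 * pi * t = 2 * (c0 * t)" by (simp add: c0_def)
    ultimately show ?thesis by linarith
  qed
  \<comment> \<open>h t^2 is the quotient in circulation_Lp for B = c0 t, of the order of the inverse layer width\<close>
  define h where "h = c0\<^sup>2 / (64 * pi ^ 4 * K)"
  have h: "0 < h" using c0 K by (simp add: h_def)
  define c1 where "c1 = c0 / 4 * min 1 h"
  have c1: "0 < c1" using c0 h by (simp add: c1_def)
  define c2 where "c2 = c0 / (4 * pi\<^sup>2)"
  have c2: "0 < c2" using c0 by (simp add: c2_def)
  \<comment> \<open>beyond T1 the vorticity is at least twice its initial bound W; before T1 the gradient bound k0 / pi suffices\<close>
  define T1 where "T1 = max 1 (max T0 (2 * W / c1))"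
  have T1: "1 \<le> T1" "T0 \<le> T1" "2 * W / c1 \<le> T1" by (auto simp: T1_def)
  define c3 where "c3 = min (c1 / 4) (k0 / (2 * pi * T1\<^sup>2))"
  have c3: "0 < c3" using c1 assms(5) T1 by (simp add: c3_def)
  define c where "c = min c1 (min c2 c3)"
  have c: "0 < c" "c \<le> c1" "c \<le> c2" "c \<le> c3" using c1 c2 c3 by (auto simp: c_def)

  have main: "(\<forall>(p::ereal) t. 1 \<le> p \<and> T0 \<le> t \<and> ereal t < T \<longrightarrow>
        Lp_norm p (\<omega> t) \<ge> c1 * t powr (3 - real_of_ereal (2 / p))) \<and>
      (\<forall>t. T0 \<le> t \<and> ereal t < T \<longrightarrow> Lp_norm \<infinity> (u t) \<ge> c2 * t) \<and>
      (\<forall>t. 0 \<le> t \<and> ereal t < T \<longrightarrow> (SUP \<tau>\<in>{0..t}. Lp_norm \<infinity> (grad (\<rho> \<tau>))) > c3 * t\<^sup>2)"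
    if sol: "boussinesq_solution T \<rho>0 \<omega>0 \<rho> \<omega> u" for T \<rho> \<omega> u
  proof -
    note ap = boussinesq_a_priori[OF sol _ _ assms(2,4,6,7) M W K0(2)]
    have vort: "c1 * t powr (3 - real_of_ereal (2 / p)) \<le> Lp_norm p (\<omega> t)"
      if p: "1 \<le> p" and t: "T0 \<le> t" "ereal t < T" for p t
    proof -
      have t0: "0 \<le> t" using t T0 by simp
      note ap = ap[OF t0 t(2)]
      have cw: "continuous_on strip (\<omega> t)" by (rule C1_cont[OF ap(2)])
      show ?thesis
      proof (cases "t = 0")
        case True
        have "(0, 0) \<in> cell" by simp
        from Linf_norm(1)[OF cw this] have "0 \<le> Lp_norm \<infinity> (\<omega> t)" by (rule order_trans[OF norm_ge_zero])
        then have "0 \<le> Lp_norm p (\<omega> t)" by (cases "p = \<infinity>") (auto simp: Lp_norm_def)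
        then show ?thesis using True by simp
      next
        case False
        with t0 have tp: "0 < t" by simp
        obtain \<psi> where s: "stream_flow (\<omega> t) \<psi> (\<lambda>x. fst (u t x)) (\<lambda>x. snd (u t x))" using ap(1) by blast
        define q where "q = real_of_ereal (2 / p)"
        have q: "0 \<le> q" "q \<le> 2"
          using p by (cases p; auto simp: q_def one_ereal_def numeral_eq_ereal divide_le_eq)+
        have "c1 * t powr (3 - q) \<le> c0 * t / 4 * (h * t\<^sup>2) powr (1 - q / 2)"
          unfolding c1_def by (rule powr_combine[OF tp c0 h q])
        also have "h * t\<^sup>2 = (c0 * t)\<^sup>2 / (64 * pi ^ 4 * K)" by (simp add: h_def power_mult_distrib)
        also have "c0 * t / 4 * \<dots> powr (1 - q / 2) \<le> Lp_norm p (\<omega> t)"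
          unfolding q_def
        proof (rule circulation_Lp[OF s cw _ K _ _ p])
          show "integral cell (\<lambda>x. fst (u t x) * fst (u t x)) + integral cell (\<lambda>x. snd (u t x) * snd (u t x)) \<le> K"
            using ap(4) by (simp add: K_def)
          show "c0 * t \<le> integral half_cell (\<omega> t)" using ap(3) lin[OF t(1)] by (simp add: A0_def)
        qed (use c0 tp in simp)
        finally show ?thesis by (simp add: q_def)
      qed
    qed
    moreover have "c2 * t \<le> Lp_norm \<infinity> (u t)" if t: "T0 \<le> t" "ereal t < T" for t
    proof -
      have t0: "0 \<le> t" using t T0 by simp
      note ap = ap[OF t0 t(2)]
      obtain \<psi> where s: "stream_flow (\<omega> t) \<psi> (\<lambda>x. fst (u t x)) (\<lambda>x. snd (u t x))" using ap(1) by blast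
      have cu: "continuous_on strip (u t)"
        using continuous_on_Pair[OF C1_cont[OF stream_flowD(2)[OF s]] C1_cont[OF stream_flowD(3)[OF s]]] by simp
      have "c0 * t \<le> integral half_cell (\<omega> t)" using ap(3) lin[OF t(1)] by (simp add: A0_def)
      also have "\<dots> \<le> 4 * pi\<^sup>2 * Lp_norm \<infinity> (u t)"
      proof (rule circulation_velocity[OF s C1_cont[OF ap(2)]])
        fix x assume "x \<in> half_cell"
        then have "norm (u t x) \<le> Lp_norm \<infinity> (u t)"
          using half_cell_subset_cell by (intro Linf_norm(1)[OF cu]) auto
        then show "\<bar>fst (u t x)\<bar> \<le> Lp_norm \<infinity> (u t) \<and> \<bar>snd (u t x)\<bar> \<le> Lp_norm \<infinity> (u t)"
          using norm_fst_le[of "fst (u t x)" "snd (u t x)"] norm_snd_le[of "snd (u t x)" "fst (u t x)"] by simp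
      qed
      finally show ?thesis by (simp add: c2_def field_simps)
    qed
    moreover have "c3 * t\<^sup>2 < (SUP \<tau>\<in>{0..t}. Lp_norm \<infinity> (grad (\<rho> \<tau>)))" if t: "0 \<le> t" "ereal t < T" for t
    proof -
      note ap = ap[OF t]
      let ?G = "SUP \<tau>\<in>{0..t}. Lp_norm \<infinity> (grad (\<rho> \<tau>))"
      have bdd: "bdd_above ((\<lambda>\<tau>. Lp_norm \<infinity> (grad (\<rho> \<tau>))) ` {0..t})"
        using ap(6) by (auto simp: bdd_above_def)
      have G: "Lp_norm \<infinity> (grad (\<rho> \<tau>)) \<le> ?G" if "\<tau> \<in> {0..t}" for \<tau>
        by (rule cSUP_upper[OF that bdd])
      show ?thesis
      proof (cases "t < T1")
        case True
        have "c3 * t\<^sup>2 \<le> k0 / (2 * pi * T1\<^sup>2) * T1\<^sup>2"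
          using True t c3 T1 by (intro mult_mono power_mono) (auto simp: c3_def)
        also have "\<dots> = k0 / (2 * pi)" using T1 by simp
        also have "\<dots> < k0 / pi" using assms(5) by (simp add: divide_strict_left_mono)
        also have "\<dots> \<le> ?G" using ap(5) G[of t] t by simp
        finally show ?thesis .
      next
        case False
        then have t1: "1 \<le> t" "T0 \<le> t" "2 * W / c1 \<le> t" using T1 by auto
        have "c1 * t powr 3 \<le> Lp_norm \<infinity> (\<omega> t)" using vort[of \<infinity> t] t1 t by simp
        also have "\<dots> \<le> W + ?G * t" by (rule ap(7)) (rule G)
        finally have le: "c1 * t ^ 3 \<le> W + ?G * t" using t1 by (simp add: powr_realpow)
        have "2 * W \<le> c1 * t" using t1(3) c1 by (simp add: pos_divide_le_eq mult.commute)
        also have "\<dots> \<le> c1 * t ^ 3" using c1 power_increasing[of 1 3 t] t1(1) by simp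
        finally have "c1 / 2 * t ^ 3 \<le> ?G * t" using le by simp
        then have "c1 / 2 * t\<^sup>2 * t \<le> ?G * t" by (simp add: power3_eq_cube power2_eq_square mult.assoc)
        then have "c1 / 2 * t\<^sup>2 \<le> ?G" by (rule mult_right_le_imp_le) (use t1(1) in linarith)
        moreover have "c3 * t\<^sup>2 < c1 / 2 * t\<^sup>2" using t1 c1 by (intro mult_strict_right_mono) (auto simp: c3_def min_def)
        ultimately show ?thesis by linarith
      qed
    qed
    ultimately show ?thesis by blast
  qed
  show ?thesis
  proof (intro exI conjI allI impI)
    show "0 \<le> T0" "0 < c" by (fact T0, fact c)
    show "T0 = 0" if "0 \<le> (LINT x:{0..pi} \<times> {0..pi}|lborel. \<omega>0 x)"
      using that by (simp add: A0 T0_def)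
    fix T \<rho> \<omega> u assume sol: "boussinesq_solution T \<rho>0 \<omega>0 \<rho> \<omega> u"
    note m = main[OF sol]
    show "c * t powr (3 - real_of_ereal (2 / p)) \<le> Lp_norm p (\<omega> t)"
      if "1 \<le> p \<and> T0 \<le> t \<and> ereal t < T" for p t
      by (rule order_trans[OF mult_right_mono[OF c(2)]]) (use m that in auto)
    show "c * t \<le> Lp_norm \<infinity> (u t)" if "T0 \<le> t \<and> ereal t < T" for t
      by (rule order_trans[OF mult_right_mono[OF c(3)]]) (use m that T0 in auto)
    show "c * t\<^sup>2 < (SUP \<tau>\<in>{0..t}. Lp_norm \<infinity> (grad (\<rho> \<tau>)))" if "0 \<le> t \<and> ereal t < T" for t
      by (rule le_less_trans[OF mult_right_mono[OF c(4)]]) (use m that in auto)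
  qed
qed

end
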